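(* $$\Vert\rho_\sigma\Vert^2-\Vert\rho_{\mathfrak a\sigma}\Vert^2=\frac g{12}\dim\mathfrak g-2g\,z(\mathfrak g,\sigma)-\sum_S\left(\frac{g_S}{12}\dim\mathfrak a_S-2g_S\,z(\mathfrak a_S,\sigma)\right).$$
   Context: $\mathfrak g$ is a finite-dimensional complex Lie algebra, semisimple or abelian, with a nondegenerate symmetric invariant bilinear form $(\cdot,\cdot)$ for which the Casimir operator acts on $\mathfrak g$ (adjoint action) as $2g\,I$ with $g\ge0$ real. $\sigma$ is a semisimple automorphism of $\mathfrak g$ (not necessarily of finite order) with eigenvalues of modulus $1$ preserving the form. For $j\in\mathbb R$, $\bar j$ is its class in $\mathbb R/\mathbb Z$, $\mathfrak g^{\bar j}=\{x:\sigma(x)=e^{2\pi ij}x\}$; for a $\sigma$-stable subspace $\mathfrak u$, $\mathfrak u^{\bar j}=\mathfrak u\cap\mathfrak g^{\bar j}$ and $z(\mathfrak u,\sigma)=\frac12\sum_{0\le j<1}\frac{j(1-j)}2\dim\mathfrak u^{\bar j}$. $\mathfrak a\subset\mathfrak g$ is a reductive $\sigma$-invariant subalgebra on which the form is nondegenerate (the zero subalgebra allowed); $\mathfrak a=\bigoplus_S\mathfrak a_S$ is the eigenspace decomposition under the Casimir operator of $\mathfrak a$ with respect to the restricted form, with eigenvalue $2g_S$ on $\mathfrak a_S$. $\mathfrak h_{\mathfrak a}$ is a Cartan subalgebra of $\mathfrak a^{\bar0}$ and $\mathfrak h_0\supset\mathfrak h_{\mathfrak a}$ a Cartan subalgebra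 of $\mathfrak g^{\bar0}$; $\mathfrak h_0=\mathfrak h_{\mathfrak a}\oplus\mathfrak h_{\mathfrak p}$ is the orthogonal decomposition. $\Delta_0^+$ is a set of positive roots of $(\mathfrak g^{\bar0},\mathfrak h_0)$ with sum of positive root spaces $\mathfrak n$, chosen so that $\mathfrak n=(\mathfrak n\cap\mathfrak a)\oplus(\mathfrak n\cap\mathfrak a^\perp)$ and $\mathfrak h_{\mathfrak a}\oplus(\mathfrak n\cap\mathfrak a)$ is a Borel subalgebra of $\mathfrak a^{\bar0}$; $\Delta_{\mathfrak a}^+$ are the corresponding positive roots of $(\mathfrak a^{\bar0},\mathfrak h_{\mathfrak a})$. $\rho_0=\frac12\sum_{\alpha\in\Delta_0^+}\alpha$; for $\bar j\ne\bar0$, $\rho_{\bar j}=\frac12\sum_\alpha(\dim\mathfrak g^{\bar j}_\alpha)\alpha$ over the $\mathfrak h_0$-weights $\alpha$ of $\mathfrak g^{\bar j}$; $\rho_\sigma=\sum_{0\le j\le1/2}(1-2j)\rho_{\bar j}$. Likewise $\rho_{\mathfrak a0}=\frac12\sum_{\alpha\in\Delta^+_{\mathfrak a}}\alpha$, $\rho_{\mathfrak aj}=\frac12\sum_\alpha(\dim\mathfrak a^{\bar j}_\alpha)\alpha$ over the $\mathfrak h_{\mathfrak a}$-weights of $\mathfrak a^{\bar j}$ for $0<j<\frac12$, $\rho_{\mathfrak a\sigma}=\sum_{0\le j<1/2}(1-2j)\rho_{\mathfrak aj}$. Norms are for the forms induced by $(\cdot,\cdot)$ on $\mathfrak h_0^*$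 and $\mathfrak h_{\mathfrak a}^*$. *)

theory Defs
  imports Complex_Main
begin

section \<open>Complex Lie algebras\<close>

text \<open>A complex Lie algebra is a type; its subalgebras, ideals and eigenspaces are subsets of that
  type. Finite dimension is not part of the class.\<close>

class complex_lie_algebra = ab_group_add +
  fixes cscale :: "complex \<Rightarrow> 'a \<Rightarrow> 'a"
    and lie_bracket :: "'a \<Rightarrow> 'a \<Rightarrow> 'a"
  assumes cscale_right_distrib: "cscale c (x + y) = cscale c x + cscale c y"
    and cscale_left_distrib: "cscale (c + d) x = cscale c x + cscale d x"
    and cscale_cscale: "cscale c (cscale d x) = cscale (c * d) x"
    and cscale_one: "cscale 1 x = x"
    and bracket_add_left: "lie_bracket (x + y) z = lie_bracket x z + lie_bracket y z"
    and bracket_add_right: "lie_bracket x (y + z) = lie_bracket x y + lie_bracket x z"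
    and bracket_cscale_left: "lie_bracket (cscale c x) y = cscale c (lie_bracket x y)"
    and bracket_cscale_right: "lie_bracket x (cscale c y) = cscale c (lie_bracket x y)"
    and bracket_self: "lie_bracket x x = 0"
    and jacobi: "lie_bracket x (lie_bracket y z) + lie_bracket y (lie_bracket z x)
                   + lie_bracket z (lie_bracket x y) = 0"

interpretation cvs: vector_space "cscale :: complex \<Rightarrow> 'a \<Rightarrow> 'a::complex_lie_algebra"
  by unfold_locales
    (simp_all add: cscale_right_distrib cscale_left_distrib cscale_cscale cscale_one)

abbreviation csubspace :: "'a::complex_lie_algebra set \<Rightarrow> bool"
  where "csubspace \<equiv> module.subspace cscale"

abbreviation cspan :: "'a::complex_lie_algebra set \<Rightarrow> 'a set"
  where "cspan \<equiv> module.span cscale"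

abbreviation cdim :: "'a::complex_lie_algebra set \<Rightarrow> nat"
  where "cdim \<equiv> vector_space.dim cscale"

definition is_basis_of :: "'a::complex_lie_algebra set \<Rightarrow> 'a set \<Rightarrow> bool"
  where "is_basis_of u B \<longleftrightarrow> B \<subseteq> u \<and> \<not> module.dependent cscale B \<and> cspan B = u"

definition is_direct_sum ::
    "'a::complex_lie_algebra set \<Rightarrow> 'a set \<Rightarrow> 'a set \<Rightarrow> bool"
  where "is_direct_sum u v w \<longleftrightarrow>
    csubspace v \<and> csubspace w \<and> v \<inter> w = {0} \<and> u = {x + y | x y. x \<in> v \<and> y \<in> w}"

definition subalgebra :: "'a::complex_lie_algebra set \<Rightarrow> bool"
  where "subalgebra u \<longleftrightarrow> csubspace u \<and> (\<forall>x\<in>u. \<forall>y\<in>u. lie_bracket x y \<in> u)"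

definition lie_ideal :: "'a::complex_lie_algebra set \<Rightarrow> 'a set \<Rightarrow> bool"
  where "lie_ideal u i \<longleftrightarrow> csubspace i \<and> i \<subseteq> u \<and> (\<forall>x\<in>u. \<forall>y\<in>i. lie_bracket x y \<in> i)"

definition commutator_space ::
    "'a::complex_lie_algebra set \<Rightarrow> 'a set \<Rightarrow> 'a set"
  where "commutator_space u v = cspan {lie_bracket x y | x y. x \<in> u \<and> y \<in> v}"

primrec derived_series :: "'a::complex_lie_algebra set \<Rightarrow> nat \<Rightarrow> 'a set"
  where
    "derived_series u 0 = u"
  | "derived_series u (Suc n) = commutator_space (derived_series u n) (derived_series u n)"

primrec lower_central_series :: "'a::complex_lie_algebra set \<Rightarrow> nat \<Rightarrow> 'a set"
  where
    "lower_central_series u 0 = u"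
  | "lower_central_series u (Suc n) = commutator_space u (lower_central_series u n)"

definition solvable :: "'a::complex_lie_algebra set \<Rightarrow> bool"
  where "solvable u \<longleftrightarrow> (\<exists>n. derived_series u n = {0})"

definition nilpotent :: "'a::complex_lie_algebra set \<Rightarrow> bool"
  where "nilpotent u \<longleftrightarrow> (\<exists>n. lower_central_series u n = {0})"

definition abelian :: "'a::complex_lie_algebra set \<Rightarrow> bool"
  where "abelian u \<longleftrightarrow> (\<forall>x\<in>u. \<forall>y\<in>u. lie_bracket x y = 0)"

definition center :: "'a::complex_lie_algebra set \<Rightarrow> 'a set"
  where "center u = {x \<in> u. \<forall>y\<in>u. lie_bracket x y = 0}"

text \<open>In finite dimension the sum of all solvable ideals is the largest solvable ideal.\<close>

definition radical :: "'a::complex_lie_algebra set \<Rightarrow> 'a set"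
  where "radical u = cspan (\<Union>{i. lie_ideal u i \<and> solvable i})"

definition semisimple :: "'a::complex_lie_algebra set \<Rightarrow> bool"
  where "semisimple u \<longleftrightarrow> radical u = {0}"

definition reductive :: "'a::complex_lie_algebra set \<Rightarrow> bool"
  where "reductive u \<longleftrightarrow> radical u = center u"

definition cartan_subalgebra :: "'a::complex_lie_algebra set \<Rightarrow> 'a set \<Rightarrow> bool"
  where "cartan_subalgebra u h \<longleftrightarrow>
    subalgebra h \<and> h \<subseteq> u \<and> nilpotent h \<and> {x \<in> u. \<forall>y\<in>h. lie_bracket x y \<in> h} = h"

definition borel_subalgebra :: "'a::complex_lie_algebra set \<Rightarrow> 'a set \<Rightarrow> bool"
  where "borel_subalgebra u b \<longleftrightarrow>
    subalgebra b \<and> b \<subseteq> u \<and> solvable b \<and>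
    (\<forall>c. subalgebra c \<and> c \<subseteq> u \<and> solvable c \<and> b \<subseteq> c \<longrightarrow> c = b)"


section \<open>Invariant forms and the Casimir operator\<close>

definition symmetric_bilinear :: "('a::complex_lie_algebra \<Rightarrow> 'a \<Rightarrow> complex) \<Rightarrow> bool"
  where "symmetric_bilinear B \<longleftrightarrow>
    (\<forall>x. Vector_Spaces.linear cscale (*) (B x)) \<and> (\<forall>x y. B x y = B y x)"

definition invariant_form :: "('a::complex_lie_algebra \<Rightarrow> 'a \<Rightarrow> complex) \<Rightarrow> bool"
  where "invariant_form B \<longleftrightarrow> (\<forall>x y z. B (lie_bracket x y) z = B x (lie_bracket y z))"

definition nondegenerate_on ::
    "('a::complex_lie_algebra \<Rightarrow> 'a \<Rightarrow> complex) \<Rightarrow> 'a set \<Rightarrow> bool"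
  where "nondegenerate_on B u \<longleftrightarrow> (\<forall>x\<in>u. (\<forall>y\<in>u. B x y = 0) \<longrightarrow> x = 0)"

definition orth_complement ::
    "('a::complex_lie_algebra \<Rightarrow> 'a \<Rightarrow> complex) \<Rightarrow> 'a set \<Rightarrow> 'a set"
  where "orth_complement B u = {x. \<forall>y\<in>u. B x y = 0}"

definition dual_basis_elem ::
    "('a::complex_lie_algebra \<Rightarrow> 'a \<Rightarrow> complex) \<Rightarrow> 'a set \<Rightarrow> 'a set \<Rightarrow> 'a \<Rightarrow> 'a"
  where "dual_basis_elem B u X x =
    (THE y. y \<in> u \<and> (\<forall>x'\<in>X. B x' y = (if x' = x then 1 else 0)))"

text \<open>The Casimir operator of \<open>u\<close> with respect to \<open>B\<close> restricted to \<open>u\<close>, acting through brackets.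
  When \<open>u\<close> is finite-dimensional and \<open>B\<close> is nondegenerate on \<open>u\<close>, it does not depend on the chosen
  basis.\<close>

definition casimir ::
    "('a::complex_lie_algebra \<Rightarrow> 'a \<Rightarrow> complex) \<Rightarrow> 'a set \<Rightarrow> 'a \<Rightarrow> 'a"
  where "casimir B u v =
    (let X = (SOME X. is_basis_of u X)
     in \<Sum>x\<in>X. lie_bracket x (lie_bracket (dual_basis_elem B u X x) v))"

text \<open>The index \<open>c\<close> is half of the eigenvalue.\<close>

definition casimir_eigenspace ::
    "('a::complex_lie_algebra \<Rightarrow> 'a \<Rightarrow> complex) \<Rightarrow> 'a set \<Rightarrow> complex \<Rightarrow> 'a set"
  where "casimir_eigenspace B u c = {v \<in> u. casimir B u v = cscale (2 * c) v}"

definition casimir_half_eigenvalues ::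
    "('a::complex_lie_algebra \<Rightarrow> 'a \<Rightarrow> complex) \<Rightarrow> 'a set \<Rightarrow> complex set"
  where "casimir_half_eigenvalues B u = {c. casimir_eigenspace B u c \<noteq> {0}}"


section \<open>Semisimple automorphisms and their eigenspaces\<close>

definition lie_automorphism :: "('a::complex_lie_algebra \<Rightarrow> 'a) \<Rightarrow> bool"
  where "lie_automorphism \<sigma> \<longleftrightarrow>
    Vector_Spaces.linear cscale cscale \<sigma> \<and> bij \<sigma> \<and>
    (\<forall>x y. \<sigma> (lie_bracket x y) = lie_bracket (\<sigma> x) (\<sigma> y))"

definition semisimple_operator :: "('a::complex_lie_algebra \<Rightarrow> 'a) \<Rightarrow> bool"
  where "semisimple_operator \<sigma> \<longleftrightarrow>
    (\<forall>u. csubspace u \<and> \<sigma> ` u \<subseteq> u \<longrightarrow> (\<exists>w. \<sigma> ` w \<subseteq> w \<and> is_direct_sum UNIV u w))"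

text \<open>For a real \<open>j\<close>, this only depends on the class of \<open>j\<close> modulo the integers.\<close>

definition sigma_part ::
    "('a::complex_lie_algebra \<Rightarrow> 'a) \<Rightarrow> 'a set \<Rightarrow> real \<Rightarrow> 'a set"
  where "sigma_part \<sigma> u j = {x \<in> u. \<sigma> x = cscale (cis (2 * pi * j)) x}"

text \<open>Sums over a real interval of indices are restricted to the finitely many indices with nonzero
  eigenspace, since an infinite index set would make the sum zero by convention.\<close>

definition z_sigma :: "('a::complex_lie_algebra \<Rightarrow> 'a) \<Rightarrow> 'a set \<Rightarrow> real"
  where "z_sigma \<sigma> u =
    (1/2) * (\<Sum>j | 0 \<le> j \<and> j < 1 \<and> sigma_part \<sigma> u j \<noteq> {0}.
               j * (1 - j) / 2 * real (cdim (sigma_part \<sigma> u j)))"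


section \<open>Weights, roots and Weyl vectors\<close>

text \<open>A linear functional on a subspace \<open>h\<close> is represented by the function that vanishes
  outside \<open>h\<close>.\<close>

definition dual_space :: "'a::complex_lie_algebra set \<Rightarrow> ('a \<Rightarrow> complex) set"
  where "dual_space h =
    {\<alpha>. (\<forall>s\<in>h. \<forall>t\<in>h. \<alpha> (s + t) = \<alpha> s + \<alpha> t) \<and> (\<forall>c. \<forall>t\<in>h. \<alpha> (cscale c t) = c * \<alpha> t) \<and>
         (\<forall>t. t \<notin> h \<longrightarrow> \<alpha> t = 0)}"

definition weight_space ::
    "'a::complex_lie_algebra set \<Rightarrow> 'a set \<Rightarrow> ('a \<Rightarrow> complex) \<Rightarrow> 'a set"
  where "weight_space u h \<alpha> = {x \<in> u. \<forall>t\<in>h. lie_bracket t x = cscale (\<alpha> t) x}"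

definition weights :: "'a::complex_lie_algebra set \<Rightarrow> 'a set \<Rightarrow> ('a \<Rightarrow> complex) set"
  where "weights u h = {\<alpha> \<in> dual_space h. weight_space u h \<alpha> \<noteq> {0}}"

definition roots :: "'a::complex_lie_algebra set \<Rightarrow> 'a set \<Rightarrow> ('a \<Rightarrow> complex) set"
  where "roots u h = weights u h - {\<lambda>_. 0}"

definition positive_roots ::
    "'a::complex_lie_algebra set \<Rightarrow> 'a set \<Rightarrow> ('a \<Rightarrow> complex) set \<Rightarrow> bool"
  where "positive_roots u h P \<longleftrightarrow>
    P \<subseteq> roots u h \<and>
    (\<forall>\<alpha>\<in>roots u h. (\<alpha> \<in> P) \<noteq> ((\<lambda>t. - \<alpha> t) \<in> P)) \<and>
    (\<forall>\<alpha>\<in>P. \<forall>\<beta>\<in>P. (\<lambda>t. \<alpha> t + \<beta> t) \<in> roots u h \<longrightarrow> (\<lambda>t. \<alpha> t + \<beta> t) \<in> P)"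

definition sum_of_root_spaces ::
    "'a::complex_lie_algebra set \<Rightarrow> 'a set \<Rightarrow> ('a \<Rightarrow> complex) set \<Rightarrow> 'a set"
  where "sum_of_root_spaces u h P = cspan (\<Union>\<alpha>\<in>P. weight_space u h \<alpha>)"

definition roots_in ::
    "'a::complex_lie_algebra set \<Rightarrow> 'a set \<Rightarrow> 'a set \<Rightarrow> ('a \<Rightarrow> complex) set"
  where "roots_in u h b = {\<alpha> \<in> roots u h. weight_space u h \<alpha> \<subseteq> b}"

definition half_sum_roots :: "('a \<Rightarrow> complex) set \<Rightarrow> 'a \<Rightarrow> complex"
  where "half_sum_roots P = (\<lambda>t. (1/2) * (\<Sum>\<alpha>\<in>P. \<alpha> t))"

definition half_sum_weights ::
    "'a::complex_lie_algebra set \<Rightarrow> 'a set \<Rightarrow> 'a \<Rightarrow> complex"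
  where "half_sum_weights u h =
    (\<lambda>t. (1/2) * (\<Sum>\<alpha>\<in>weights u h. of_nat (cdim (weight_space u h \<alpha>)) * \<alpha> t))"

definition rho_part ::
    "('a::complex_lie_algebra \<Rightarrow> 'a) \<Rightarrow> 'a set \<Rightarrow> 'a set \<Rightarrow> ('a \<Rightarrow> complex) set \<Rightarrow>
     real \<Rightarrow> 'a \<Rightarrow> complex"
  where "rho_part \<sigma> u h P j =
    (if j = 0 then half_sum_roots P else half_sum_weights (sigma_part \<sigma> u j) h)"

text \<open>The index \<open>j = 1/2\<close> has coefficient \<open>0\<close>, so it is immaterial whether it is included.\<close>

definition rho_sigma ::
    "('a::complex_lie_algebra \<Rightarrow> 'a) \<Rightarrow> 'a set \<Rightarrow> 'a set \<Rightarrow> ('a \<Rightarrow> complex) set \<Rightarrow>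
     'a \<Rightarrow> complex"
  where "rho_sigma \<sigma> u h P =
    (\<lambda>t. \<Sum>j | 0 \<le> j \<and> j \<le> 1/2 \<and> sigma_part \<sigma> u j \<noteq> {0}.
           complex_of_real (1 - 2 * j) * rho_part \<sigma> u h P j t)"

definition form_representative ::
    "('a::complex_lie_algebra \<Rightarrow> 'a \<Rightarrow> complex) \<Rightarrow> 'a set \<Rightarrow> ('a \<Rightarrow> complex) \<Rightarrow> 'a"
  where "form_representative B h \<alpha> = (THE s. s \<in> h \<and> (\<forall>t\<in>h. B s t = \<alpha> t))"

text \<open>The induced form on the dual of \<open>h\<close> is the complex bilinear one, not a hermitian form; the
  squared norm is its value on the diagonal and is a priori a complex number.\<close>

definition dual_form ::
    "('a::complex_lie_algebra \<Rightarrow> 'a \<Rightarrow> complex) \<Rightarrow> 'a set \<Rightarrow>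
     ('a \<Rightarrow> complex) \<Rightarrow> ('a \<Rightarrow> complex) \<Rightarrow> complex"
  where "dual_form B h \<alpha> \<beta> = B (form_representative B h \<alpha>) (form_representative B h \<beta>)"

definition dual_norm_sq ::
    "('a::complex_lie_algebra \<Rightarrow> 'a \<Rightarrow> complex) \<Rightarrow> 'a set \<Rightarrow> ('a \<Rightarrow> complex) \<Rightarrow> complex"
  where "dual_norm_sq B h \<alpha> = dual_form B h \<alpha> \<alpha>"

end

theory Submission
  imports Defs "HOL-Computational_Algebra.Fundamental_Theorem_Algebra"
begin

text \<open>Applied to \<open>\<gg>\<close> and to \<open>\<aa>\<close>, one identity gives the theorem as a difference: for a reductive \<open>u\<close>,
  \<open>\<parallel>\<rho>\<parallel>\<^sup>2 = 1/4 \<Sum>\<^sub>x B\<^sub>2(j\<^sub>x) C\<^sub>x\<close>, where \<open>x\<close> runs through a basis of joint eigenvectors of \<open>\<sigma>\<close>, the Cartan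
  subalgebra and the Casimir operator, \<open>C\<^sub>x\<close> is the Casimir eigenvalue and \<open>B\<^sub>2\<close> the Bernoulli polynomial
  \<open>j\<^sup>2 - j + 1/6\<close>. Let \<open>\<theta>\<^sub>x = j\<^sub>x\<close>, with positive and negative roots of the fixed point algebra counted as
  \<open>\<theta> = 0\<close> and \<open>\<theta> = 1\<close>, and \<open>b = \<theta> - 1/2\<close> (\<open>b = 0\<close> on the Cartan subalgebra). Then \<open>\<rho>\<close> is represented
  by \<open>- 1/2 \<Sum>\<^sub>x b\<^sub>x [x, x\<^sup>*]\<close>, so the Jacobi identity expresses both sides through the same symmetric
  array \<open>\<tau>(x, y, z)\<close>, minus the products of the structure constants of the basis and of its dual:
  \<open>\<parallel>\<rho>\<parallel>\<^sup>2 = - 1/2 \<Sum> b\<^sub>x b\<^sub>y \<tau>(x, y, z)\<close> and \<open>C\<^sub>x = \<Sum>\<^sub>y\<^sub>,\<^sub>z \<tau>(x, y, z)\<close>. After symmetrization the identity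
  holds term by term: \<open>\<tau>(x, y, z) \<noteq> 0\<close> forces the weights to add up to zero and
  \<open>\<theta>\<^sub>x + \<theta>\<^sub>y + \<theta>\<^sub>z\<close> to be \<open>1\<close> or \<open>2\<close>, since three positive roots never cancel; hence
  \<open>(b\<^sub>x + b\<^sub>y + b\<^sub>z)\<^sup>2 = 1/4\<close>, unless one of \<open>x, y, z\<close> lies in the Cartan subalgebra and the other two
  have opposite \<open>b\<close>.

  That the Cartan subalgebra acts diagonalizably rests on Cartan's criterion and on the inner
  derivations given by the semisimple parts of its elements.\<close>

section \<open>Operators on finite-dimensional complex vector spaces\<close>

text \<open>In the centred index the Bernoulli polynomial is \<open>b\<^sup>2\<close> - 1/12: for a
  triple, the three constants 1/12 add up to the 1/4 of the squared sum, and what remains of the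
  square are the mixed products that give the norm. The polynomial takes the same value at 0 and at
  1, so moving the roots of the fixed point algebra to the two ends changes nothing on the Casimir
  side, while for \<rho> it is exactly what produces the half sum of positive roots. Centring makes
  \<open>b\<close> odd under passage to the dual basis, so that exchanging a vector with its dual is
  an available symmetry. The obstacle is the definition of a Cartan subalgebra as a nilpotent,
  self-normalizing subalgebra: neither its commutativity nor its diagonal action is given, and both
  have to be extracted from Engel's theorem and the Killing form. A second obstacle is that
  positivity in \<aa> is inherited from \<nn> through root vectors; for this reason positivity
  enters the norm formula as a vanishing statement about triples of root vectors, which restricts to
  \<aa>.\<close>

locale complex_fdvs = finite_dimensional_vector_space scale Basis
  for scale :: "complex \<Rightarrow> 'b::ab_group_add \<Rightarrow> 'b" (infixr \<open>*s\<close> 75) and Basis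
begin

sublocale lp: vector_space_pair scale scale
  by unfold_locales

abbreviation endo :: "('b \<Rightarrow> 'b) \<Rightarrow> bool"
  where "endo f \<equiv> Vector_Spaces.linear scale scale f"

lemma endoI:
  assumes "\<And>x y. f (x + y) = f x + f y" and "\<And>c x. f (c *s x) = c *s f x"
  shows "endo f"
  using assms vector_space_axioms by (simp add: Vector_Spaces.linear_iff)

lemma endo_pow: "endo f \<Longrightarrow> endo (f ^^ n)"
proof (induction n)
  case 0
  show ?case by (rule endoI) simp_all
next
  case (Suc n)
  then show ?case
    by (intro endoI) (simp_all add: lp.linear_add lp.linear_scale)
qed

definition shift :: "('b \<Rightarrow> 'b) \<Rightarrow> complex \<Rightarrow> 'b \<Rightarrow> 'b"
  where "shift f c = (\<lambda>x. f x - c *s x)"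

lemma endo_shift: "endo f \<Longrightarrow> endo (shift f c)"
  by (rule endoI)
    (simp_all add: shift_def lp.linear_add lp.linear_scale scale_right_distrib scale_right_diff_distrib
      mult.commute)

lemma funpow_stable: "(\<And>v. v \<in> V \<Longrightarrow> f v \<in> V) \<Longrightarrow> v \<in> V \<Longrightarrow> (f ^^ n) v \<in> V"
  by (induction n) auto

lemma shift_stable:
  "subspace V \<Longrightarrow> (\<And>v. v \<in> V \<Longrightarrow> f v \<in> V) \<Longrightarrow> v \<in> V \<Longrightarrow> shift f c v \<in> V"
  by (simp add: shift_def subspace_diff subspace_scale)

section \<open>Polynomials in an operator, and eigenvectors modulo a subspace\<close>

definition papp :: "('b \<Rightarrow> 'b) \<Rightarrow> complex poly \<Rightarrow> 'b \<Rightarrow> 'b"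
  where "papp f p v = fold_coeffs (\<lambda>a w. a *s v + f w) p 0"

lemma papp_0 [simp]: "papp f 0 v = 0"
  by (simp add: papp_def)

lemma papp_pCons: "endo f \<Longrightarrow> papp f (pCons a p) v = a *s v + f (papp f p v)"
  by (cases "p = 0 \<and> a = 0") (auto simp: papp_def lp.linear_0)

lemma papp_add: "endo f \<Longrightarrow> papp f (p + q) v = papp f p v + papp f q v"
  by (induction p q rule: poly_induct2)
    (simp_all add: papp_pCons lp.linear_add scale_left_distrib)

lemma papp_smult: "endo f \<Longrightarrow> papp f (smult a p) v = a *s papp f p v"
  by (induction p) (simp_all add: papp_pCons lp.linear_scale scale_right_distrib)

lemma papp_monom: "endo f \<Longrightarrow> papp f (monom a n) v = a *s (f ^^ n) v"
  by (induction n) (simp_all add: papp_pCons monom_Suc monom_0 lp.linear_scale lp.linear_0)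

lemma papp_sum: "endo f \<Longrightarrow> papp f (sum p I) v = (\<Sum>i\<in>I. papp f (p i) v)"
  by (induction I rule: infinite_finite_induct) (simp_all add: papp_add)

lemma papp_linear_factor:
  assumes f: "endo f" shows "papp f ([:- z, 1:] * q) v = shift f z (papp f q v)"
proof -
  have "[:- z, 1:] * q = smult (- z) q + pCons 0 q" by simp
  then have "papp f ([:- z, 1:] * q) v = papp f (smult (- z) q) v + papp f (pCons 0 q) v"
    by (simp only: papp_add[OF f])
  also have "\<dots> = shift f z (papp f q v)"
    by (simp only: papp_smult[OF f] papp_pCons[OF f]) (simp add: shift_def)
  finally show ?thesis .
qed

lemma papp_in: "endo f \<Longrightarrow> subspace V \<Longrightarrow> (\<And>v. v \<in> V \<Longrightarrow> f v \<in> V) \<Longrightarrow> v \<in> V \<Longrightarrow> papp f p v \<in> V"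
  by (induction p) (simp_all add: papp_pCons subspace_0 subspace_add subspace_scale)

text \<open>Indexing by exponents instead of vectors matters because powers of an operator may
  repeat a vector; in that case the relation is the difference of two equal terms.\<close>

lemma sequence_dependent:
  fixes g :: "nat \<Rightarrow> 'b"
  obtains a n where "(\<Sum>i\<le>n. a i *s g i) = 0" and "\<exists>i\<le>n. a i \<noteq> 0"
proof -
  define n where "n = card Basis"
  show ?thesis
  proof (cases "inj_on g {..n}")
    case True
    then have "card (g ` {..n}) = Suc n" by (simp add: card_image)
    moreover have "card (g ` {..n}) \<le> n" if "independent (g ` {..n})"
      using independent_card_le_dim[of "g ` {..n}" UNIV] that by (simp add: n_def)
    ultimately have "dependent (g ` {..n})" by force
    then obtain r where r: "(\<Sum>v\<in>g ` {..n}. r v *s v) = 0" "\<exists>v\<in>g ` {..n}. r v \<noteq> 0"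
      by (auto simp: dependent_finite)
    then have "(\<Sum>i\<le>n. r (g i) *s g i) = 0"
      using True by (simp add: sum.reindex)
    with r show ?thesis using that[of "\<lambda>i. r (g i)" n] by auto
  next
    case False
    then obtain i j where ij: "i \<le> n" "j \<le> n" "i \<noteq> j" "g i = g j" by (auto simp: inj_on_def)
    define a :: "nat \<Rightarrow> complex" where "a k = (if k = i then 1 else if k = j then -1 else 0)" for k
    have "(\<Sum>k\<le>n. a k *s g k) = (\<Sum>k\<in>{i, j}. a k *s g k)"
      using ij by (intro sum.mono_neutral_right) (auto simp: a_def)
    also have "\<dots> = 0" using ij by (simp add: a_def)
    finally have "(\<Sum>k\<le>n. a k *s g k) = 0" .
    moreover have "a i \<noteq> 0" by (simp add: a_def)
    ultimately show ?thesis using that[of a n] ij(1) by metis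
  qed
qed

text \<open>Among the nonzero polynomials p with p(f) v in W take one of least degree. It is not
  constant, since v is outside W; a root z gives p = (X - z) q, and w = q(f) v is outside W by
  minimality.\<close>

lemma eigenvector_modulo:
  assumes f: "endo f" and V: "subspace V" "\<And>v. v \<in> V \<Longrightarrow> f v \<in> V"
    and W: "subspace W" and v: "v \<in> V" "v \<notin> W"
  obtains w z where "w \<in> V" "w \<notin> W" "shift f z w \<in> W"
proof -
  obtain a n where a: "(\<Sum>i\<le>n. a i *s (f ^^ i) v) = 0" "\<exists>i\<le>n. a i \<noteq> 0"
    using sequence_dependent[of "\<lambda>i. (f ^^ i) v"] .
  define p0 where "p0 = (\<Sum>i\<le>n. monom (a i) i)"
  have "coeff p0 i = a i" if "i \<le> n" for i
    using that by (simp add: p0_def coeff_sum)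
  with a(2) have "p0 \<noteq> 0" by force
  moreover have "papp f p0 v = 0"
    using a(1) by (simp add: p0_def papp_sum[OF f] papp_monom[OF f])
  ultimately have "\<exists>p. p \<noteq> 0 \<and> papp f p v \<in> W" using subspace_0[OF W] by metis
  then obtain p where p: "p \<noteq> 0" "papp f p v \<in> W"
    and min: "\<And>q. q \<noteq> 0 \<Longrightarrow> papp f q v \<in> W \<Longrightarrow> degree p \<le> degree q"
    using ex_has_least_nat[of "\<lambda>p. p \<noteq> 0 \<and> papp f p v \<in> W" _ degree] by metis
  have "degree p \<noteq> 0"
  proof
    assume "degree p = 0"
    then obtain c where c: "p = [:c:]" by (metis degree_eq_zeroE)
    with p have "c \<noteq> 0" "c *s v \<in> W" by (auto simp: papp_pCons[OF f] lp.linear_0[OF f])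
    then have "inverse c *s (c *s v) \<in> W" using W subspace_scale by blast
    with \<open>c \<noteq> 0\<close> v show False by simp
  qed
  then have "\<not> constant (poly p)" by (simp add: constant_degree)
  then obtain z where "poly p z = 0" using fundamental_theorem_of_algebra by blast
  then obtain q where q: "p = [:- z, 1:] * q" by (metis dvd_def poly_eq_0_iff_dvd)
  with p have "q \<noteq> 0" by auto
  then have "degree p = Suc (degree q)" using q by (simp add: degree_mult_eq del: mult_pCons_left)
  then have "papp f q v \<notin> W" using min[OF \<open>q \<noteq> 0\<close>] by auto
  moreover have "papp f q v \<in> V" using papp_in[OF f V(1) V(2)] v by blast
  moreover have "shift f z (papp f q v) \<in> W" using p q papp_linear_factor[OF f] by metis
  ultimately show ?thesis using that by blast
qed

section \<open>Generalized eigenspaces\<close>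

definition gen_eig :: "('b \<Rightarrow> 'b) \<Rightarrow> complex \<Rightarrow> 'b set"
  where "gen_eig f c = {v. \<exists>n. (shift f c ^^ n) v = 0}"

lemma funpow_mono_0: "endo f \<Longrightarrow> (f ^^ n) v = 0 \<Longrightarrow> n \<le> m \<Longrightarrow> (f ^^ m) v = 0"
  by (metis add.commute comp_apply endo_pow funpow_add le_add_diff_inverse lp.linear_0)

lemma subspace_gen_eig:
  assumes f: "endo f" shows "subspace (gen_eig f c)"
proof (rule subspaceI)
  show "0 \<in> gen_eig f c" by (auto simp: gen_eig_def intro: exI[of _ 0])
next
  fix x y assume "x \<in> gen_eig f c" "y \<in> gen_eig f c"
  then obtain m n where "(shift f c ^^ m) x = 0" "(shift f c ^^ n) y = 0" by (auto simp: gen_eig_def)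
  then have "(shift f c ^^ (max m n)) x = 0" "(shift f c ^^ (max m n)) y = 0"
    using funpow_mono_0[OF endo_shift[OF f]] by auto
  then have "(shift f c ^^ (max m n)) (x + y) = 0"
    by (simp add: lp.linear_add[OF endo_pow[OF endo_shift[OF f]]])
  then show "x + y \<in> gen_eig f c" by (auto simp: gen_eig_def)
next
  fix r x assume "x \<in> gen_eig f c"
  then show "r *s x \<in> gen_eig f c"
    by (auto simp: gen_eig_def lp.linear_scale[OF endo_pow[OF endo_shift[OF f]]])
qed

lemma eigenvector_gen_eig: "f v = c *s v \<Longrightarrow> v \<in> gen_eig f c"
  by (auto simp: gen_eig_def shift_def intro!: exI[of _ 1])

lemma shift_preimage_gen_eig: "shift f c v \<in> gen_eig f c \<Longrightarrow> v \<in> gen_eig f c"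
  by (auto simp: gen_eig_def funpow_swap1 simp del: funpow.simps intro: exI[of _ "Suc _"])
    (metis comp_apply funpow_Suc_right)

lemma gen_eig_stable:
  assumes "endo f" "v \<in> gen_eig f c" shows "f v \<in> gen_eig f c"
proof -
  obtain n where n: "(shift f c ^^ n) v = 0" using assms by (auto simp: gen_eig_def)
  have "(shift f c ^^ n) (shift f c v) = 0"
    using n by (metis assms(1) endo_shift funpow_swap1 lp.linear_0)
  then have "shift f c v \<in> gen_eig f c" by (auto simp: gen_eig_def)
  then have "shift f c v + c *s v \<in> gen_eig f c"
    using assms subspace_gen_eig subspace_add subspace_scale by metis
  then show ?thesis by (simp add: shift_def)
qed

text \<open>The orbit of w under f - c stays in V and in the generalized eigenspace, so the n-th
  power of g on w is \<open>k ^ n\<close> times that of f - c. Applied with k = 1 to nilpotent parts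
  and with k = \<open>cnj c\<close> in Cartan's criterion.\<close>

lemma gen_eig_proportional:
  assumes f: "endo f" and V: "subspace V" "\<And>v. v \<in> V \<Longrightarrow> f v \<in> V" and g: "endo g"
    and eq: "\<And>v. v \<in> V \<Longrightarrow> v \<in> gen_eig f c \<Longrightarrow> g v = k *s shift f c v"
    and w: "w \<in> V" "w \<in> gen_eig f c"
  shows "w \<in> gen_eig g 0"
proof -
  have st: "(shift f c ^^ n) w \<in> V \<inter> gen_eig f c" for n
  proof (rule funpow_stable)
    fix v assume "v \<in> V \<inter> gen_eig f c"
    then show "shift f c v \<in> V \<inter> gen_eig f c"
      using shift_stable[of V f v c, OF V]
        shift_stable[of "gen_eig f c" f v c, OF subspace_gen_eig[OF f] gen_eig_stable[OF f]] by blast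
  qed (use w in auto)
  have "(g ^^ n) w = k ^ n *s (shift f c ^^ n) w" for n
  proof (induction n)
    case (Suc n)
    then show ?case using eq st[of n] by (simp add: lp.linear_scale[OF g] mult.commute)
  qed simp
  moreover obtain n where "(shift f c ^^ n) w = 0" using w by (auto simp: gen_eig_def)
  ultimately have "(g ^^ n) w = 0" by simp
  then show ?thesis by (auto simp: gen_eig_def shift_def)
qed

lemma gen_eigenvectors_span:
  assumes f: "endo f" and V: "subspace V" "\<And>v. v \<in> V \<Longrightarrow> f v \<in> V"
  shows "V \<subseteq> span (\<Union>c. V \<inter> gen_eig f c)" (is "_ \<subseteq> ?G")
proof (rule ccontr)
  assume "\<not> V \<subseteq> ?G"
  then obtain v where v: "v \<in> V" "v \<notin> ?G" by auto
  obtain w z where w: "w \<in> V" "w \<notin> ?G" "shift f z w \<in> ?G"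
    using eigenvector_modulo[OF f V subspace_span v] .
  \<comment> \<open>Since \<open>f - z\<close> is onto the generalized eigenspaces for the other eigenvalues, \<open>w\<close> can be
    corrected by an element of \<open>?G\<close> to a generalized eigenvector for \<open>z\<close>.\<close>
  have onto: "\<exists>y\<in>?G. shift f z y = x" if "c \<noteq> z" "x \<in> V" "(shift f c ^^ n) x = 0" for c x n
    using that
  proof (induction n arbitrary: x)
    case 0
    then show ?case by (intro bexI[of _ 0]) (simp_all add: span_zero lp.linear_0[OF endo_shift[OF f]])
  next
    case (Suc n)
    have "shift f c x \<in> V" using Suc.prems V shift_stable by blast
    moreover have "(shift f c ^^ n) (shift f c x) = 0" using Suc.prems by (simp add: funpow_swap1)
    ultimately obtain y where y: "y \<in> ?G" "shift f z y = shift f c x" using Suc by blast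
    have x: "x \<in> ?G" using Suc.prems by (intro span_base) (auto simp: gen_eig_def simp del: funpow.simps)
    \<comment> \<open>The operators f - z and f - c differ by the scalar c - z, so dividing x - y by
      it inverts f - z at x.\<close>
    have "shift f z (inverse (c - z) *s (x - y)) = inverse (c - z) *s (shift f z x - shift f c x)"
      using y by (simp add: lp.linear_scale[OF endo_shift[OF f]] lp.linear_diff[OF endo_shift[OF f]])
    also have "\<dots> = inverse (c - z) *s ((c - z) *s x)"
      by (simp add: shift_def scale_left_diff_distrib)
    also have "\<dots> = x" using Suc.prems by simp
    finally show ?case using x y
      by (intro bexI[of _ "inverse (c - z) *s (x - y)"] span_scale span_diff)
  qed
  have "\<exists>y\<in>?G. shift f z y - x \<in> V \<inter> gen_eig f z" if "x \<in> ?G" for x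
    using that
  proof (induction rule: span_induct_alt)
    case base
    show ?case by (intro bexI[of _ 0])
        (simp_all add: span_zero lp.linear_0[OF endo_shift[OF f]] subspace_0 V subspace_gen_eig f)
  next
    case (step r x y)
    then obtain c n where x: "x \<in> V" "(shift f c ^^ n) x = 0" by (auto simp: gen_eig_def)
    have "\<exists>x'\<in>?G. shift f z x' - r *s x \<in> V \<inter> gen_eig f z"
    proof (cases "c = z")
      case True
      then have "- (r *s x) \<in> V \<inter> gen_eig f z"
        using x by (auto simp: gen_eig_def intro!: subspace_neg subspace_scale[of V] V
            subspace_scale[OF subspace_gen_eig[OF f], unfolded gen_eig_def, simplified]
            subspace_neg[OF subspace_gen_eig[OF f], unfolded gen_eig_def, simplified])
      then show ?thesis by (intro bexI[of _ 0]) (simp_all add: span_zero lp.linear_0[OF endo_shift[OF f]])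
    next
      case False
      then obtain y where "y \<in> ?G" "shift f z y = x" using onto x by blast
      then show ?thesis
        by (intro bexI[of _ "r *s y"])
          (simp_all add: span_scale lp.linear_scale[OF endo_shift[OF f]] subspace_0 V subspace_gen_eig f)
    qed
    then obtain x' where x': "x' \<in> ?G" "shift f z x' - r *s x \<in> V \<inter> gen_eig f z" by blast
    from step obtain y' where y': "y' \<in> ?G" "shift f z y' - y \<in> V \<inter> gen_eig f z" by blast
    have "shift f z (x' + y') - (r *s x + y) = (shift f z x' - r *s x) + (shift f z y' - y)"
      by (simp add: lp.linear_add[OF endo_shift[OF f]])
    also have "\<dots> \<in> V \<inter> gen_eig f z"
      using x' y' by (intro subspace_add[OF subspace_inter[OF V(1) subspace_gen_eig[OF f]]])
    finally show ?case using x' y' by (intro bexI[of _ "x' + y'"]) (auto intro: span_add)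
  qed
  from this[OF w(3)] obtain y where y: "y \<in> ?G" "shift f z y - shift f z w \<in> gen_eig f z" by blast
  have "?G \<subseteq> V" by (rule span_minimal) (auto simp: V)
  with y w have "y - w \<in> V" using V subspace_diff by blast
  moreover have "y - w \<in> gen_eig f z"
    using y(2) by (metis shift_preimage_gen_eig lp.linear_diff[OF endo_shift[OF f]])
  ultimately have "y - w \<in> ?G" by (intro span_base) auto
  with y(1) have "y - (y - w) \<in> ?G" using span_diff by blast
  with w show False by simp
qed

lemma shift_commute:
  assumes "endo f" shows "shift f c (shift f d v) = shift f d (shift f c v)"
  using assms by (simp add: shift_def lp.linear_diff lp.linear_scale scale_right_diff_distrib mult.commute)

lemma funpow_commute: "(\<And>v. f (g v) = g (f v)) \<Longrightarrow> (f ^^ m) ((g ^^ n) v) = (g ^^ n) ((f ^^ m) v)"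
proof (induction m)
  case (Suc m)
  have "f ((g ^^ n) w) = (g ^^ n) (f w)" for w
    by (induction n) (simp_all add: Suc.prems)
  with Suc show ?case by simp
qed simp

text \<open>By induction (f - c) v = 0, so f - d multiplies v by c - d and no power of it can kill v
  unless v = 0.\<close>

lemma gen_eig_disjoint:
  assumes f: "endo f" and "c \<noteq> d" "v \<in> gen_eig f c" "(shift f d ^^ m) v = 0"
  shows "v = 0"
proof -
  obtain n where "(shift f c ^^ n) v = 0" using assms by (auto simp: gen_eig_def)
  then show ?thesis using assms(4)
  proof (induction n arbitrary: v)
    case (Suc n)
    have "(shift f d ^^ m) (shift f c v) = shift f c ((shift f d ^^ m) v)"
      using funpow_commute[of "shift f d" "shift f c" m 1] shift_commute[OF f] by simp
    then have "(shift f d ^^ m) (shift f c v) = 0"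
      using Suc.prems by (simp add: lp.linear_0[OF endo_shift[OF f]])
    then have "shift f c v = 0"
      using Suc by (simp add: funpow_swap1)
    then have "shift f d v = (c - d) *s v" by (simp add: shift_def scale_left_diff_distrib)
    then have "(shift f d ^^ m) v = (c - d) ^ m *s v" for m
      by (induction m) (simp_all add: lp.linear_scale[OF endo_shift[OF f]] mult.commute)
    with Suc.prems \<open>c \<noteq> d\<close> show ?case by simp
  qed simp
qed

text \<open>A power of f - d removes the summand for d and keeps the others in their generalized
  eigenspaces; the induction hypothesis and \<open>gen_eig_disjoint\<close> then kill those.\<close>

lemma gen_eig_independent:
  assumes f: "endo f" and "finite C" and "\<And>c. c \<in> C \<Longrightarrow> w c \<in> gen_eig f c"
    and "(\<Sum>c\<in>C. w c) = 0" and "c \<in> C"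
  shows "w c = 0"
  using assms(2-)
proof (induction C arbitrary: w c rule: finite_induct)
  case (insert d C)
  obtain m where m: "(shift f d ^^ m) (w d) = 0" using insert.prems by (auto simp: gen_eig_def)
  let ?p = "shift f d ^^ m"
  have lin: "endo ?p" by (intro endo_pow endo_shift f)
  have "(\<Sum>c\<in>C. ?p (w c)) = ?p (\<Sum>c\<in>insert d C. w c)"
    using insert.hyps m by (simp add: lp.linear_sum[OF lin] lp.linear_add[OF lin])
  also have "\<dots> = 0" using insert.prems by (simp add: lp.linear_0[OF lin])
  finally have s: "(\<Sum>c\<in>C. ?p (w c)) = 0" .
  have st: "?p (w c) \<in> gen_eig f c" if "c \<in> C" for c
    using that insert.prems
    by (intro funpow_stable[where V = "gen_eig f c"] shift_stable subspace_gen_eig f gen_eig_stable) auto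
  have z: "w c = 0" if c: "c \<in> C" for c
  proof (rule gen_eig_disjoint[OF f])
    show "?p (w c) = 0" by (rule insert.IH[OF st s c])
    show "c \<noteq> d" using c insert.hyps by auto
    show "w c \<in> gen_eig f c" using c insert.prems by auto
  qed
  have "w d = (\<Sum>c\<in>insert d C. w c)" using insert.hyps z by simp
  then show ?case using z insert.prems by (cases "c = d") auto
qed simp

lemma span_representation_subset:
  assumes "independent X" "v \<in> span X" and "\<And>x. representation X v x \<noteq> 0 \<Longrightarrow> x \<in> Y"
  shows "v \<in> span Y"
proof -
  have "(\<Sum>b | representation X v b \<noteq> 0. representation X v b *s b) \<in> span Y"
    by (intro span_sum span_scale span_base) (use assms in auto)
  then show ?thesis by (simp add: sum_nonzero_representation_eq assms)
qed

text \<open>In the eigenbasis X the n-th power of f - c multiplies the coordinate at x by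
  \<open>(e x - c) ^ n\<close>. Later this reads off indices, weights and Casimir eigenvalues from
  the coordinates of a vector.\<close>

lemma eigen_representation:
  assumes f: "endo f" and X: "independent X" "\<And>x. x \<in> X \<Longrightarrow> f x = e x *s x"
    and v: "v \<in> span X" "(shift f c ^^ n) v = 0" and r: "representation X v x \<noteq> 0"
  shows "e x = c"
proof -
  have fin: "finite X" using X finiteI_independent by blast
  let ?p = "shift f c ^^ n"
  have lin: "endo ?p" by (intro endo_pow endo_shift f)
  have *: "?p x = (e x - c) ^ n *s x" if "x \<in> X" for x
    using X(2)[OF that]
    by (induction n) (simp_all add: lp.linear_scale[OF f] lp.linear_scale[OF endo_shift[OF f]] shift_def
        scale_left_diff_distrib scale_right_diff_distrib mult.commute left_diff_distrib right_diff_distrib)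
  have "0 = ?p (\<Sum>x\<in>X. representation X v x *s x)"
    using sum_representation_eq[OF X(1) v(1) fin] v(2) by simp
  also have "\<dots> = (\<Sum>x\<in>X. (representation X v x * (e x - c) ^ n) *s x)"
    by (simp add: lp.linear_sum[OF lin] lp.linear_scale[OF lin] *)
  finally have "representation X v x * (e x - c) ^ n = 0"
    using independentD[OF X(1) fin, of "\<lambda>x. representation X v x * (e x - c) ^ n" x]
      representation_ne_zero[OF r] by simp
  with r show ?thesis by auto
qed

section \<open>Simultaneous diagonalization\<close>

definition diag_on :: "('b \<Rightarrow> 'b) \<Rightarrow> 'b set \<Rightarrow> bool"
  where "diag_on f V \<longleftrightarrow> V \<subseteq> span {v \<in> V. \<exists>c. f v = c *s v}"

lemma diag_on_gen_eig:
  assumes f: "endo f" and V: "diag_on f V" and v: "v \<in> V" "v \<in> gen_eig f c"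
  shows "f v = c *s v"
proof -
  let ?S = "{v \<in> V. \<exists>c. f v = c *s v}"
  obtain X where X: "X \<subseteq> ?S" "independent X" "?S \<subseteq> span X"
    using maximal_independent_subset[of ?S] by blast
  define e where "e x = (SOME c. f x = c *s x)" for x
  have e: "f x = e x *s x" if "x \<in> X" for x
    using that X(1) unfolding e_def by (auto intro: someI2_ex)
  have vX: "v \<in> span X"
    using V v(1) span_mono[OF X(3)] by (auto simp: diag_on_def span_span)
  obtain n where n: "(shift f c ^^ n) v = 0" using v by (auto simp: gen_eig_def)
  have fin: "finite X" using X finiteI_independent by blast
  have "f v = f (\<Sum>x\<in>X. representation X v x *s x)"
    using sum_representation_eq[OF X(2) vX fin] by simp
  also have "\<dots> = (\<Sum>x\<in>X. representation X v x *s (e x *s x))"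
    by (simp add: lp.linear_sum[OF f] lp.linear_scale[OF f] e)
  also have "\<dots> = (\<Sum>x\<in>X. c *s (representation X v x *s x))"
    using eigen_representation[OF f X(2) e vX n]
    by (intro sum.cong) (auto simp: mult.commute)
  also have "\<dots> = c *s v"
    by (simp only: scale_sum_right[symmetric] sum_representation_eq[OF X(2) vX fin order_refl])
  finally show ?thesis .
qed

text \<open>W is spanned by the generalized eigenvectors it contains, and by
  \<open>diag_on_gen_eig\<close> these are eigenvectors.\<close>

lemma diag_on_subspace:
  assumes f: "endo f" and V: "diag_on f V" and W: "subspace W" "W \<subseteq> V" "\<And>v. v \<in> W \<Longrightarrow> f v \<in> W"
  shows "diag_on f W"
proof -
  have "(\<Union>c. W \<inter> gen_eig f c) \<subseteq> {v \<in> W. \<exists>c. f v = c *s v}"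
    using diag_on_gen_eig[OF f V] W(2) by blast
  with gen_eigenvectors_span[OF f W(1,3)] show ?thesis
    unfolding diag_on_def using span_mono by blast
qed

text \<open>The induction runs over the dimension of V, not over F, so that F may be infinite, such
  as the adjoint action of a whole Cartan subalgebra. If some f is not a scalar on V, each of its
  eigenspaces is a proper subspace, stable under F by commutation.\<close>

lemma joint_diag:
  assumes F: "\<And>f. f \<in> F \<Longrightarrow> endo f" and V: "subspace V"
    and st: "\<And>f v. f \<in> F \<Longrightarrow> v \<in> V \<Longrightarrow> f v \<in> V"
    and com: "\<And>f g v. f \<in> F \<Longrightarrow> g \<in> F \<Longrightarrow> v \<in> V \<Longrightarrow> f (g v) = g (f v)"
    and diag: "\<And>f. f \<in> F \<Longrightarrow> diag_on f V"
  shows "V \<subseteq> span {v \<in> V. \<forall>f\<in>F. \<exists>c. f v = c *s v}"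
  using V st com diag
proof (induction "dim V" arbitrary: V rule: less_induct)
  case less
  let ?J = "\<lambda>V. {v \<in> V. \<forall>f\<in>F. \<exists>c. f v = c *s v}"
  show ?case
  proof (cases "\<forall>f\<in>F. \<exists>c. \<forall>v\<in>V. f v = c *s v")
    case True
    then have "V = ?J V" by blast
    then show ?thesis using span_superset by metis
  next
    case False
    then obtain f where f: "f \<in> F" "\<And>c. \<exists>v\<in>V. f v \<noteq> c *s v" by blast
    have "{v \<in> V. \<exists>c. f v = c *s v} \<subseteq> span (?J V)"
    proof safe
      fix v c assume v: "v \<in> V" "f v = c *s v"
      define E where "E = {v \<in> V. f v = c *s v}"
      have lin: "endo f" using f F by blast
      have E: "subspace E"
        unfolding E_def using less.prems(1)
        by (intro subspaceI)
          (auto simp: lp.linear_add[OF lin] lp.linear_scale[OF lin] lp.linear_0[OF lin]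
            scale_right_distrib subspace_add subspace_scale subspace_0 mult.commute)
      have "E \<subset> V" using f(2)[of c] by (auto simp: E_def)
      then have "span E \<subset> span V" using E less.prems(1) by (metis span_eq_iff)
      then have "dim E < dim V" by (rule dim_psubset)
      moreover have stE: "g w \<in> E" if "g \<in> F" "w \<in> E" for g w
        using that less.prems(2,3) f(1) lp.linear_scale[OF F[OF that(1)]] by (auto simp: E_def) metis
      moreover have "diag_on g E" if "g \<in> F" for g
        using diag_on_subspace[OF F[OF that] less.prems(4)[OF that] E] stE that by (auto simp: E_def)
      ultimately have "E \<subseteq> span (?J E)"
        using E less.prems(3) by (intro less.hyps) (auto simp: E_def)
      also have "\<dots> \<subseteq> span (?J V)" by (rule span_mono) (auto simp: E_def)
      finally show "v \<in> span (?J V)" using v by (auto simp: E_def)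
    qed
    then have "span {v \<in> V. \<exists>c. f v = c *s v} \<subseteq> span (?J V)"
      by (rule span_minimal) simp
    then show ?thesis using less.prems(4)[OF f(1)] by (auto simp: diag_on_def)
  qed
qed

text \<open>Functional calculus for the semisimple part of f: \<phi> is applied to its eigenvalues.
  The instances used are the identity, conjugation, the squared modulus and inversion.\<close>

lemma gen_eig_operator:
  assumes f: "endo f" and V: "subspace V" "\<And>v. v \<in> V \<Longrightarrow> f v \<in> V"
  obtains D where "endo D" "\<And>c w. w \<in> V \<Longrightarrow> w \<in> gen_eig f c \<Longrightarrow> D w = \<phi> c *s w"
proof -
  let ?S = "\<Union>c. V \<inter> gen_eig f c"
  obtain X where X: "X \<subseteq> ?S" "independent X" "?S \<subseteq> span X"
    using maximal_independent_subset[of ?S] by blast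
  have VX: "V \<subseteq> span X"
    using gen_eigenvectors_span[OF f V] span_mono[OF X(3)] by (auto simp: span_span)
  define e where "e x = (SOME c. x \<in> gen_eig f c)" for x
  have e: "x \<in> gen_eig f (e x)" if "x \<in> X" for x
  proof -
    have "\<exists>c. x \<in> gen_eig f c" using that X(1) by blast
    then show ?thesis unfolding e_def by (rule someI_ex)
  qed
  define D where "D = lp.construct X (\<lambda>x. \<phi> (e x) *s x)"
  have D: "endo D" unfolding D_def by (rule lp.linear_construct[OF X(2)])
  have DX: "D x = \<phi> (e x) *s x" if "x \<in> X" for x
    unfolding D_def using lp.construct_basis[OF X(2) that] .
  have fin: "finite X" using X finiteI_independent by blast
  have "D w = \<phi> c *s w" if w: "w \<in> V" "w \<in> gen_eig f c" for c w
  proof -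
    define r where "r = representation X w"
    have wr: "(\<Sum>x\<in>X. r x *s x) = w"
      unfolding r_def using sum_representation_eq[OF X(2) _ fin] w VX by blast
    define p where "p d = (\<Sum>x\<in>{x\<in>X. e x = d}. r x *s x)" for d
    \<comment> \<open>The components p d of w are compared with the trivial decomposition that has w
      itself in place c; independence of the generalized eigenspaces makes the two agree.\<close>
    define q where "q d = p d - (if d = c then w else 0)" for d
    let ?C = "insert c (e ` X)"
    have psum: "(\<Sum>d\<in>?C. p d) = w"
      unfolding p_def wr[symmetric] using fin by (intro sum.group) auto
    have "p d \<in> gen_eig f d" for d
      unfolding p_def using e by (intro subspace_sum subspace_scale subspace_gen_eig f) auto
    then have qin: "q d \<in> gen_eig f d" for d
      unfolding q_def using w subspace_gen_eig[OF f] by (auto intro: subspace_diff)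
    have "(\<Sum>d\<in>?C. q d) = 0"
      unfolding q_def sum_subtractf psum using fin by (simp add: sum.delta)
    then have q: "q c = 0"
      using gen_eig_independent[OF f, of ?C q c] fin qin by blast
    then have wp: "w = p c" by (simp add: q_def)
    have "D (p c) = \<phi> c *s p c"
      unfolding p_def lp.linear_sum[OF D] scale_sum_right
      by (intro sum.cong) (auto simp: lp.linear_scale[OF D] DX mult.commute)
    with wp show ?thesis by simp
  qed
  with D show ?thesis using that by blast
qed

section \<open>Nilpotent operators\<close>

definition nil_on :: "('b \<Rightarrow> 'b) \<Rightarrow> 'b set \<Rightarrow> bool"
  where "nil_on f V \<longleftrightarrow> (\<forall>v\<in>V. \<exists>n. (f ^^ n) v = 0)"

lemma nil_escape:
  assumes "(f ^^ n) v \<in> W" "v \<notin> W"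
  obtains k where "(f ^^ k) v \<notin> W" "f ((f ^^ k) v) \<in> W"
proof -
  have "\<exists>k. (f ^^ k) v \<notin> W \<and> f ((f ^^ k) v) \<in> W"
    using assms
  proof (induction n)
    case (Suc n)
    then show ?case by (cases "(f ^^ n) v \<in> W") auto
  qed simp
  then show ?thesis using that by blast
qed

text \<open>A zero diagonal, weaker than strict triangularity, suffices for a vanishing trace and is
  easy to extend: if X does not span V, the orbit of a vector outside span X has a last member
  before it enters span X, and this member can be added to X.\<close>

lemma nil_basis:
  assumes f: "endo f" and V: "subspace V" "\<And>v. v \<in> V \<Longrightarrow> f v \<in> V" and nil: "nil_on f V"
  obtains X where "independent X" "span X = V" "\<And>x. x \<in> X \<Longrightarrow> f x \<in> span (X - {x})"
proof -
  define good where "good X \<longleftrightarrow> independent X \<and> X \<subseteq> V \<and> (\<forall>x\<in>X. f x \<in> span (X - {x}))" for X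
  have "good {}" by (simp add: good_def independent_empty)
  moreover have "\<forall>X. good X \<longrightarrow> card X < Suc (card Basis)"
    using independent_card_le_dim[of _ UNIV] by (auto simp: good_def less_Suc_eq_le)
  ultimately obtain X where X: "good X" and max: "\<And>Y. good Y \<Longrightarrow> card Y \<le> card X"
    using ex_has_greatest_nat[of good "{}" card "Suc (card Basis)"] by metis
  have iX: "independent X" "X \<subseteq> V" "\<And>x. x \<in> X \<Longrightarrow> f x \<in> span (X - {x})"
    using X by (auto simp: good_def)
  have "V \<subseteq> span X"
  proof (rule ccontr)
    assume "\<not> V \<subseteq> span X"
    then obtain v where v: "v \<in> V" "v \<notin> span X" by blast
    obtain n where "(f ^^ n) v = 0" using nil v by (auto simp: nil_on_def)
    then have "(f ^^ n) v \<in> span X" by (simp add: span_zero)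
    then obtain k where k: "(f ^^ k) v \<notin> span X" "f ((f ^^ k) v) \<in> span X"
      by (rule nil_escape[OF _ v(2)])
    let ?w = "(f ^^ k) v"
    have wV: "?w \<in> V" by (rule funpow_stable[OF V(2) v(1)])
    have wX: "?w \<notin> X" using k span_base by blast
    have "good (insert ?w X)"
      unfolding good_def
    proof (intro conjI ballI)
      show "independent (insert ?w X)" using iX(1) k(1) by (rule independent_insertI[rotated])
      show "insert ?w X \<subseteq> V" using wV iX by blast
      fix x assume "x \<in> insert ?w X"
      then show "f x \<in> span (insert ?w X - {x})"
      proof
        assume "x = ?w"
        then show ?thesis using k(2) wX by simp
      next
        assume x: "x \<in> X"
        then have "span (X - {x}) \<subseteq> span (insert ?w X - {x})" by (intro span_mono) auto
        then show ?thesis using iX(3)[OF x] by blast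
      qed
    qed
    moreover have "card (insert ?w X) = Suc (card X)"
      using wX finiteI_independent[OF iX(1)] by simp
    ultimately show False using max by force
  qed
  moreover have "span X \<subseteq> V" using iX V by (intro span_minimal)
  ultimately show ?thesis using that iX by blast
qed

end

section \<open>Engel's theorem\<close>

notation lie_bracket (infixl \<open>\<bullet>\<close> 70)

lemma bracket_0 [simp]: "0 \<bullet> x = 0" "x \<bullet> 0 = (0::'a::complex_lie_algebra)"
  using bracket_add_left[of 0 0 x] bracket_add_right[of x 0 0] by auto

lemma bracket_minus: "- x \<bullet> y = - (x \<bullet> y)" "x \<bullet> - y = - (x \<bullet> (y::'a::complex_lie_algebra))"
  using bracket_add_left[of "- x" x y] bracket_add_right[of x "- y" y]
  by (simp_all add: eq_neg_iff_add_eq_0)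

lemma bracket_diff: "(x - y) \<bullet> z = x \<bullet> z - y \<bullet> z"
    "x \<bullet> (y - z) = x \<bullet> y - x \<bullet> (z::'a::complex_lie_algebra)"
  using bracket_add_left[of x "- y" z] bracket_add_right[of x y "- z"] by (simp_all add: bracket_minus)

lemma bracket_swap: "x \<bullet> y = - (y \<bullet> (x::'a::complex_lie_algebra))"
proof -
  have "(x + y) \<bullet> (x + y) = x \<bullet> y + y \<bullet> x"
    by (simp only: bracket_add_left bracket_add_right bracket_self[of x] bracket_self[of y]) simp
  then show ?thesis by (simp add: eq_neg_iff_add_eq_0 bracket_self)
qed

lemma bracket_leibniz: "x \<bullet> (y \<bullet> z) = (x \<bullet> y) \<bullet> z + y \<bullet> (x \<bullet> (z::'a::complex_lie_algebra))"
  using jacobi[of x y z] bracket_swap[of z "x \<bullet> y"] bracket_swap[of z x]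
  by (simp add: bracket_minus eq_neg_iff_add_eq_0 algebra_simps)

lemmas bracket_bilinear = bracket_add_left bracket_add_right bracket_cscale_left bracket_cscale_right

lemma commutator_space_mono: "u \<subseteq> u' \<Longrightarrow> v \<subseteq> v' \<Longrightarrow> commutator_space u v \<subseteq> commutator_space u' v'"
  unfolding commutator_space_def by (rule cvs.span_mono) blast

lemma csubspace_commutator_space: "csubspace (commutator_space u v)"
  by (simp add: commutator_space_def)

lemma bracket_in_commutator_space: "x \<in> u \<Longrightarrow> y \<in> v \<Longrightarrow> x \<bullet> y \<in> commutator_space u v"
  unfolding commutator_space_def by (rule cvs.span_base) blast

lemma commutator_space_least:
  "csubspace w \<Longrightarrow> (\<And>x y. x \<in> u \<Longrightarrow> y \<in> v \<Longrightarrow> x \<bullet> y \<in> w) \<Longrightarrow> commutator_space u v \<subseteq> w"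
  unfolding commutator_space_def by (rule cvs.span_minimal) auto

lemma derived_series_Suc: "derived_series u (Suc n) = derived_series (commutator_space u u) n"
  by (induction n) simp_all

lemma solvable_commutator: "solvable (commutator_space u u) \<Longrightarrow> solvable u"
  unfolding solvable_def using derived_series_Suc by blast

lemma solvable_abelian:
  assumes "\<And>x y. x \<in> u \<Longrightarrow> y \<in> u \<Longrightarrow> x \<bullet> y = 0"
  shows "solvable u"
proof -
  have "commutator_space u u \<subseteq> {0}" using assms by (intro commutator_space_least) auto
  then have "commutator_space u u = {0}"
    using csubspace_commutator_space cvs.subspace_0 by blast
  then show ?thesis unfolding solvable_def by (intro exI[of _ 1]) simp
qed

locale fd_lie = complex_fdvs "cscale :: complex \<Rightarrow> 'a::complex_lie_algebra \<Rightarrow> 'a" Basis for Basis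
begin

lemma endo_bracket: "endo (lie_bracket x)"
  by (rule endoI) (simp_all add: bracket_bilinear)

text \<open>By the Leibniz rule ad x - (a + b) acts on the bracket of v and w as the sum of ad x - a
  on v and ad x - b on w. Each application lowers one of the two exponents, so the induction is on
  their sum.\<close>

lemma bracket_gen_eig:
  assumes "v \<in> gen_eig (lie_bracket x) a" "w \<in> gen_eig (lie_bracket x) b"
  shows "v \<bullet> w \<in> gen_eig (lie_bracket x) (a + b)"
proof -
  let ?s = "shift (lie_bracket x)"
  have lin: "endo (?s c ^^ n)" for c n by (intro endo_pow endo_shift endo_bracket)
  have "(?s (a + b) ^^ k) (v \<bullet> w) = 0"
    if "(?s a ^^ m) v = 0" "(?s b ^^ n) w = 0" "m + n = k" for k m n v w
    using that
  proof (induction k arbitrary: m n v w)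
    case (Suc k)
    show ?case
    proof (cases "m = 0 \<or> n = 0")
      case True
      then have "v \<bullet> w = 0" using Suc.prems by auto
      then show ?thesis using lp.linear_0[OF lin] by metis
    next
      case False
      then obtain m' n' where mn: "m = Suc m'" "n = Suc n'" by (meson not0_implies_Suc)
      have "(?s a ^^ m') (?s a v) = 0" "(?s b ^^ n') (?s b w) = 0"
        using Suc.prems mn by (simp_all add: funpow_swap1)
      then have "(?s (a + b) ^^ k) (?s a v \<bullet> w) = 0" "(?s (a + b) ^^ k) (v \<bullet> ?s b w) = 0"
        using Suc.IH Suc.prems mn by (metis add_Suc Suc_inject, metis add_Suc_right Suc_inject)
      moreover have "?s (a + b) (v \<bullet> w) = ?s a v \<bullet> w + v \<bullet> ?s b w"
        by (simp add: shift_def bracket_leibniz[of x v w] bracket_diff bracket_bilinear cscale_left_distrib)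
      ultimately show ?thesis
        by (simp add: funpow_swap1 lp.linear_add[OF lin])
    qed
  qed simp
  moreover obtain m n where "(?s a ^^ m) v = 0" "(?s b ^^ n) w = 0"
    using assms by (auto simp: gen_eig_def)
  ultimately have "(?s (a + b) ^^ (m + n)) (v \<bullet> w) = 0" by blast
  then show ?thesis unfolding gen_eig_def by blast
qed

text \<open>The statement on a quotient \<open>V / W\<close> makes the induction on the dimension of \<open>L\<close> self-contained:
  it is applied to \<open>L\<close> acting on \<open>V / W\<close> and to a maximal subalgebra \<open>M\<close> acting on \<open>L / M\<close>.\<close>

lemma engel:
  assumes L: "subalgebra L" and nil: "\<And>x. x \<in> L \<Longrightarrow> nil_on (lie_bracket x) L"
    and V: "subspace V" and W: "subspace W" "W \<subset> V"
    and st: "\<And>x v. x \<in> L \<Longrightarrow> v \<in> V \<Longrightarrow> x \<bullet> v \<in> V" "\<And>x v. x \<in> L \<Longrightarrow> v \<in> W \<Longrightarrow> x \<bullet> v \<in> W"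
    and nilV: "\<And>x v. x \<in> L \<Longrightarrow> v \<in> V \<Longrightarrow> \<exists>n. (lie_bracket x ^^ n) v \<in> W"
  obtains v where "v \<in> V" "v \<notin> W" "\<And>x. x \<in> L \<Longrightarrow> x \<bullet> v \<in> W"
proof -
  have "\<exists>v\<in>V. v \<notin> W \<and> (\<forall>x\<in>L. x \<bullet> v \<in> W)"
    using assms
  proof (induction "dim L" arbitrary: L V W rule: less_induct)
    case less
    have subL: "subspace L" and brL: "\<And>x y. x \<in> L \<Longrightarrow> y \<in> L \<Longrightarrow> x \<bullet> y \<in> L"
      using less.prems(1) by (auto simp: subalgebra_def)
    show ?case
    proof (cases "L \<subseteq> {0}")
      case True
      then have "x \<bullet> v = 0" if "x \<in> L" for x v using that by auto
      with \<open>W \<subset> V\<close> show ?thesis using subspace_0[OF \<open>subspace W\<close>] by fastforce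
    next
      case False
      define good where "good M \<longleftrightarrow> subalgebra M \<and> M \<subset> L" for M
      have "good {0}"
        using False subspace_0[OF subL] by (auto simp: good_def subalgebra_def)
      moreover have "\<forall>M. good M \<longrightarrow> dim M < Suc (dim L)"
        using dim_subset by (auto simp: good_def less_Suc_eq_le psubset_imp_subset)
      ultimately obtain M where M: "good M" and max: "\<And>N. good N \<Longrightarrow> dim N \<le> dim M"
        using ex_has_greatest_nat[of good "{0}" dim "Suc (dim L)"] by metis
      have subM: "subspace M" and brM: "\<And>x y. x \<in> M \<Longrightarrow> y \<in> M \<Longrightarrow> x \<bullet> y \<in> M"
        and ssM: "M \<subset> L" "subalgebra M"
        using M by (auto simp: good_def subalgebra_def)
      have dimM: "dim M < dim L"
        using dim_psubset[of M L] subM subL ssM by (metis span_eq_iff)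
      have nilM: "nil_on (lie_bracket x) N" if "x \<in> M" "N \<subseteq> L" for x N
        using less.prems(2)[of x] ssM that by (auto simp: nil_on_def)
      have "\<exists>y\<in>L. y \<notin> M \<and> (\<forall>x\<in>M. x \<bullet> y \<in> M)"
      proof (rule less.hyps[OF dimM ssM(2) _ subL subM ssM(1)])
        show "nil_on (lie_bracket x) M" if "x \<in> M" for x using nilM that ssM by auto
        show "x \<bullet> v \<in> L" if "x \<in> M" "v \<in> L" for x v using that ssM brL by auto
        show "\<exists>n. (lie_bracket x ^^ n) v \<in> M" if "x \<in> M" "v \<in> L" for x v
          using nilM[of x L] that subspace_0[OF subM] by (metis nil_on_def order_refl)
      qed (rule brM)
      then obtain y where y: "y \<in> L" "y \<notin> M" "\<And>x. x \<in> M \<Longrightarrow> x \<bullet> y \<in> M" by blast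
      have sp: "span (insert y M) \<subseteq> L" using y ssM subL by (intro span_minimal) auto
      have decomp: "\<exists>k. x - cscale k y \<in> M" if "x \<in> span (insert y M)" for x
        using that subM by (metis span_breakdown_eq span_eq_iff)
      \<comment> \<open>Brackets even land in M, since y normalizes M and brackets to 0 with itself.
        So M and y span a larger subalgebra, which by maximality of M is L.\<close>
      have "x \<bullet> x' \<in> span (insert y M)" if xx: "x \<in> span (insert y M)" "x' \<in> span (insert y M)" for x x'
      proof -
        obtain k k' where k: "x - cscale k y \<in> M" "x' - cscale k' y \<in> M" using decomp xx by blast
        define m m' where "m = x - cscale k y" and "m' = x' - cscale k' y"
        have "x \<bullet> x' = m \<bullet> m' + cscale k' (m \<bullet> y) - cscale k (m' \<bullet> y)"
          unfolding m_def m'_def using bracket_swap[of y x']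
          by (simp add: bracket_diff bracket_bilinear bracket_self algebra_simps cvs.scale_right_diff_distrib)
        also have "\<dots> \<in> M"
          using k y(3) brM by (auto simp: m_def m'_def intro!: subspace_diff subspace_add subspace_scale subM)
        finally show ?thesis using span_base by blast
      qed
      then have "subalgebra (span (insert y M))" by (auto simp: subalgebra_def)
      moreover have "M \<subset> span (insert y M)" using y span_superset[of "insert y M"] by blast
      then have "dim M < dim (span (insert y M))"
        using dim_psubset[of M "span (insert y M)"] subM by (metis span_eq_iff span_span)
      ultimately have Ly: "L = span (insert y M)" using max sp unfolding good_def by (metis leD psubsetI)
      \<comment> \<open>The vectors killed by M modulo W. Since y normalizes M, it preserves V'; the
        last power of y that leaves v outside W yields a vector that y kills modulo W as
        well.\<close>
      define V' where "V' = {v \<in> V. \<forall>x\<in>M. x \<bullet> v \<in> W}"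
      have subV: "subspace V" and subW: "subspace W" and WV: "W \<subset> V" using less.prems by auto
      have stV: "\<And>x v. x \<in> L \<Longrightarrow> v \<in> V \<Longrightarrow> x \<bullet> v \<in> V" and stW: "\<And>x v. x \<in> L \<Longrightarrow> v \<in> W \<Longrightarrow> x \<bullet> v \<in> W"
        and nilV: "\<And>x v. x \<in> L \<Longrightarrow> v \<in> V \<Longrightarrow> \<exists>n. (lie_bracket x ^^ n) v \<in> W"
        using less.prems by auto
      have "\<exists>v\<in>V. v \<notin> W \<and> (\<forall>x\<in>M. x \<bullet> v \<in> W)"
        by (rule less.hyps[OF dimM ssM(2) _ subV subW WV]) (use nilM stV stW nilV ssM in auto)
      then obtain v where v: "v \<in> V'" "v \<notin> W" by (auto simp: V'_def)
      have stV': "y \<bullet> w \<in> V'" if "w \<in> V'" for w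
        unfolding V'_def
      proof (intro CollectI conjI ballI)
        show "y \<bullet> w \<in> V" using that y stV by (auto simp: V'_def)
        fix x assume x: "x \<in> M"
        have "x \<bullet> (y \<bullet> w) = (x \<bullet> y) \<bullet> w + y \<bullet> (x \<bullet> w)" by (rule bracket_leibniz)
        also have "\<dots> \<in> W" using that x y stW by (auto simp: V'_def intro!: subspace_add subW)
        finally show "x \<bullet> (y \<bullet> w) \<in> W" .
      qed
      obtain n where "(lie_bracket y ^^ n) v \<in> W" using nilV[of y v] v y by (auto simp: V'_def)
      then obtain k where k: "(lie_bracket y ^^ k) v \<notin> W" "y \<bullet> ((lie_bracket y ^^ k) v) \<in> W"
        by (rule nil_escape[OF _ v(2)])
      define w where "w = (lie_bracket y ^^ k) v"
      have wV': "w \<in> V'" unfolding w_def by (rule funpow_stable[OF stV' v(1)])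
      have "x \<bullet> w \<in> W" if xL: "x \<in> L" for x
      proof -
        obtain r where r: "x - cscale r y \<in> M" using decomp xL Ly by blast
        have "x \<bullet> w = (x - cscale r y) \<bullet> w + cscale r (y \<bullet> w)"
          by (simp add: bracket_diff bracket_bilinear)
        also have "\<dots> \<in> W"
          using r wV' k by (auto simp: V'_def w_def[symmetric] intro!: subspace_add subspace_scale subW)
        finally show ?thesis .
      qed
      then show ?thesis using wV' k by (auto simp: V'_def w_def[symmetric])
    qed
  qed
  then show ?thesis using that by blast
qed

text \<open>For a maximal proper L-stable subspace W, Engel's theorem on L / W gives v with L v in
  W. Then W and v span L by maximality, so L acts by zero on L / W and all brackets lie in
  W.\<close>

lemma commutator_psubset:
  assumes L: "subalgebra L" "L \<noteq> {0}" and nil: "\<And>x. x \<in> L \<Longrightarrow> nil_on (lie_bracket x) L"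
  shows "commutator_space L L \<subset> L"
proof -
  have subL: "subspace L" and brL: "\<And>x y. x \<in> L \<Longrightarrow> y \<in> L \<Longrightarrow> x \<bullet> y \<in> L"
    using L by (auto simp: subalgebra_def)
  define good where "good W \<longleftrightarrow> subspace W \<and> W \<subset> L \<and> (\<forall>x\<in>L. \<forall>w\<in>W. x \<bullet> w \<in> W)" for W
  have "good {0}"
    using L subspace_0[OF subL] by (auto simp: good_def)
  moreover have "\<forall>W. good W \<longrightarrow> dim W < Suc (dim L)"
    using dim_subset by (auto simp: good_def less_Suc_eq_le psubset_imp_subset)
  ultimately obtain W where W: "good W" and max: "\<And>N. good N \<Longrightarrow> dim N \<le> dim W"
    using ex_has_greatest_nat[of good "{0}" dim "Suc (dim L)"] by metis
  have subW: "subspace W" "W \<subset> L" "\<And>x w. x \<in> L \<Longrightarrow> w \<in> W \<Longrightarrow> x \<bullet> w \<in> W"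
    using W by (auto simp: good_def)
  have "\<exists>n. (lie_bracket x ^^ n) v \<in> W" if "x \<in> L" "v \<in> L" for x v
    using nil that subspace_0[OF subW(1)] by (metis nil_on_def)
  then obtain v where v: "v \<in> L" "v \<notin> W" "\<And>x. x \<in> L \<Longrightarrow> x \<bullet> v \<in> W"
    using engel[OF L(1) nil subL subW(1,2) brL subW(3)] by blast
  have inW: "x \<bullet> w \<in> W" if xw: "x \<in> L" "w \<in> span (insert v W)" for x w
  proof -
    obtain k where k: "w - cscale k v \<in> W" using xw subW by (metis span_breakdown_eq span_eq_iff)
    have "x \<bullet> w = x \<bullet> (w - cscale k v) + cscale k (x \<bullet> v)" by (simp add: bracket_diff bracket_bilinear)
    also have "\<dots> \<in> W" using k v xw subW by (auto intro!: subspace_add subspace_scale)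
    finally show ?thesis .
  qed
  have sub: "W \<subset> span (insert v W)" using v span_superset[of "insert v W"] by blast
  then have "dim W < dim (span (insert v W))"
    using dim_psubset[of W "span (insert v W)"] subW by (metis span_eq_iff span_span)
  moreover have "span (insert v W) \<subseteq> L" using v subW subL by (intro span_minimal) auto
  moreover have "\<forall>x\<in>L. \<forall>w\<in>span (insert v W). x \<bullet> w \<in> span (insert v W)"
    using inW sub by blast
  ultimately have "L = span (insert v W)"
    using max unfolding good_def by (metis leD psubsetI subspace_span)
  then have "commutator_space L L \<subseteq> W"
    using inW subW by (intro commutator_space_least) auto
  with subW show ?thesis by blast
qed

lemma nil_solvable:
  assumes "subalgebra L" and "\<And>x. x \<in> L \<Longrightarrow> nil_on (lie_bracket x) L"
  shows "solvable L"
  using assms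
proof (induction "dim L" arbitrary: L rule: less_induct)
  case less
  show ?case
  proof (cases "L = {0}")
    case True
    then show ?thesis unfolding solvable_def by (intro exI[of _ 0]) simp
  next
    case False
    let ?D = "commutator_space L L"
    have D: "?D \<subset> L" using commutator_psubset less.prems False by blast
    then have "dim ?D < dim L"
      using dim_psubset[of ?D L] less.prems csubspace_commutator_space
      by (metis span_eq_iff subalgebra_def)
    moreover have "subalgebra ?D"
      unfolding subalgebra_def
      using D bracket_in_commutator_space csubspace_commutator_space by (meson psubsetD)
    moreover have "nil_on (lie_bracket x) ?D" if "x \<in> ?D" for x
      using less.prems(2) D that by (auto simp: nil_on_def)
    ultimately have "solvable ?D" using less.hyps by blast
    then show ?thesis by (rule solvable_commutator)
  qed
qed

end

section \<open>Dual bases, traces and the Casimir operator\<close>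

definition bilin :: "('a::complex_lie_algebra \<Rightarrow> 'a \<Rightarrow> complex) \<Rightarrow> bool"
  where "bilin F \<longleftrightarrow>
    (\<forall>x y z. F (x + y) z = F x z + F y z) \<and> (\<forall>x y z. F x (y + z) = F x y + F x z) \<and>
    (\<forall>c x y. F (cscale c x) y = c * F x y) \<and> (\<forall>c x y. F x (cscale c y) = c * F x y)"

lemma bilin_add: "bilin F \<Longrightarrow> F (x + y) z = F x z + F y z" "bilin F \<Longrightarrow> F x (y + z) = F x y + F x z"
  by (simp_all add: bilin_def)

lemma bilin_scale: "bilin F \<Longrightarrow> F (cscale c x) y = c * F x y" "bilin F \<Longrightarrow> F x (cscale c y) = c * F x y"
  by (simp_all add: bilin_def)

lemma bilin_0: assumes "bilin F" shows "F 0 x = 0" "F x 0 = 0"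
  using bilin_scale(1)[OF assms, of 0 0] bilin_scale(2)[OF assms, of x 0 0] by simp_all

lemma bilin_minus: assumes "bilin F" shows "F (- x) y = - F x y" "F x (- y) = - F x y"
  using bilin_add(1)[OF assms, of "- x" x y] bilin_add(2)[OF assms, of x "- y" y]
  by (simp_all add: bilin_0[OF assms] eq_neg_iff_add_eq_0)

lemma bilin_sum:
  assumes "bilin F"
  shows "F (sum f A) y = (\<Sum>i\<in>A. F (f i) y)" "F x (sum f A) = (\<Sum>i\<in>A. F x (f i))"
  by (induction A rule: infinite_finite_induct) (simp_all add: bilin_0[OF assms] bilin_add[OF assms])

text \<open>The algebra is a subset \<open>u\<close> of the type, so that the locale serves both for
  the whole algebra and for \<aa> with the same bracket and form. Operators are linear on the whole
  type, but identities are claimed on \<open>u\<close> only.\<close>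

locale form_lie = fd_lie Basis for Basis :: "'a::complex_lie_algebra set" +
  fixes B :: "'a \<Rightarrow> 'a \<Rightarrow> complex" and u :: "'a set"
  assumes symm: "symmetric_bilinear B" and inv: "invariant_form B"
    and subalg: "subalgebra u" and nondeg: "nondegenerate_on B u"
begin

lemma B_sym: "B x y = B y x"
  using symm by (simp add: symmetric_bilinear_def)

lemma bilin_B: "bilin B"
proof -
  have lin: "Vector_Spaces.linear cscale (*) (B x)" for x using symm by (simp add: symmetric_bilinear_def)
  have r: "B x (y + z) = B x y + B x z" "B x (cscale c y) = c * B x y" for x y z c
    using lin[of x] by (simp_all add: Vector_Spaces.linear_iff)
  then have "B (y + z) x = B y x + B z x" "B (cscale c y) x = c * B y x" for x y z c
    using B_sym by metis+
  with r show ?thesis by (simp add: bilin_def)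
qed

lemmas B_add = bilin_add[OF bilin_B] and B_scale = bilin_scale[OF bilin_B] and B_0 = bilin_0[OF bilin_B]
  and B_minus = bilin_minus[OF bilin_B] and B_sum = bilin_sum[OF bilin_B]

lemmas B_bilinear = B_add B_scale

lemma B_inv: "B (x \<bullet> y) z = B x (y \<bullet> z)"
  using inv by (simp add: invariant_form_def)

lemma B_skew: "B (x \<bullet> y) z = - B y (x \<bullet> z)"
  using bracket_swap[of x y] by (simp add: B_inv B_minus)

lemma B_diff: "B (x - y) z = B x z - B y z" "B z (x - y) = B z x - B z y"
  using B_add(1)[of x "- y" z] B_add(2)[of z x "- y"] by (simp_all add: B_minus)

lemma subspace_u: "subspace u" and bracket_u: "x \<in> u \<Longrightarrow> y \<in> u \<Longrightarrow> x \<bullet> y \<in> u"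
  using subalg by (auto simp: subalgebra_def)

lemma zero_u: "0 \<in> u"
  by (rule subspace_0[OF subspace_u])

lemma B_nondeg: "x \<in> u \<Longrightarrow> (\<And>y. y \<in> u \<Longrightarrow> B x y = 0) \<Longrightarrow> x = 0"
  using nondeg by (auto simp: nondegenerate_on_def)

lemma B_eqI: "x \<in> u \<Longrightarrow> x' \<in> u \<Longrightarrow> (\<And>y. y \<in> u \<Longrightarrow> B x y = B x' y) \<Longrightarrow> x = x'"
  using B_nondeg[of "x - x'"] by (simp add: subspace_diff[OF subspace_u] B_diff)

abbreviation basis :: "'a set \<Rightarrow> bool"
  where "basis X \<equiv> is_basis_of u X"

abbreviation dual :: "'a set \<Rightarrow> 'a \<Rightarrow> 'a"
  where "dual X \<equiv> dual_basis_elem B u X"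

lemma basisD:
  assumes "basis X"
  shows "finite X" "independent X" "span X = u" "x \<in> X \<Longrightarrow> x \<in> u"
  using assms finiteI_independent by (auto simp: is_basis_of_def)

lemma basisI: "independent X \<Longrightarrow> span X = u \<Longrightarrow> basis X"
  unfolding is_basis_of_def using span_superset by blast

lemma basis_exists_u: "\<exists>X. basis X"
  using basis_exists[of u] span_subspace[OF _ _ subspace_u] by (metis basisI)

text \<open>The map T, sending y to the sum of the \<open>B x y\<close> x, is injective on
  \<open>u\<close> by nondegeneracy, hence onto \<open>u\<close> by dimension. A preimage of x under
  T is the dual vector of x.\<close>

lemma dual:
  assumes X: "basis X" and x: "x \<in> X"
  shows dual_in: "dual X x \<in> u" and B_dual: "\<And>x'. x' \<in> X \<Longrightarrow> B x' (dual X x) = (if x' = x then 1 else 0)"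
proof -
  note X' = basisD[OF X]
  define T where "T y = (\<Sum>x\<in>X. cscale (B x y) x)" for y
  have T: "endo T"
    by (rule endoI) (simp_all add: T_def B_bilinear scale_left_distrib sum.distrib scale_sum_right)
  have T0: "B x' y = B x' z" if "T y = T z" "x' \<in> X" for x' y z
  proof -
    have "(\<Sum>x\<in>X. cscale (B x y - B x z) x) = 0"
      using that(1) by (simp add: T_def scale_left_diff_distrib sum_subtractf)
    then show ?thesis
      using independentD[OF X'(2,1), of "\<lambda>x. B x y - B x z" x'] that(2) by simp
  qed
  have inj: "y = z" if yz: "y \<in> u" "z \<in> u" "T y = T z" for y z
  proof (rule B_eqI[OF yz(1,2)])
    fix w assume "w \<in> u"
    then have "w \<in> span X" by (simp add: X')
    then have "B w y = B w z"
      by (induction rule: span_induct_alt) (simp_all add: B_0 B_bilinear T0[OF yz(3)])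
    then show "B y w = B z w" using B_sym by simp
  qed
  have injT: "inj_on T (span X)" unfolding X'(3) by (rule inj_onI) (rule inj)
  have injX: "inj_on T X" by (rule inj_on_subset[OF injT span_superset])
  have "independent (T ` X)" by (rule lp.linear_independent_injective_image[OF T X'(2) injT])
  moreover have "T y \<in> u" for y
    unfolding T_def by (rule subspace_sum[OF subspace_u subspace_scale[OF subspace_u basisD(4)[OF X]]])
  then have TX: "T ` X \<subseteq> u" by blast
  moreover have "dim u = card X" using X' by (metis dim_span_eq_card_independent)
  ultimately have "u \<subseteq> span (T ` X)" using TX
    by (intro card_ge_dim_independent) (simp_all add: card_image[OF injX])
  also have "span (T ` X) = T ` u" using lp.linear_span_image[OF T, of X] X' by simp
  finally obtain y where y: "y \<in> u" "x = T y" using X'(4)[OF x] by blast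
  have By: "B x' y = (if x' = x then 1 else 0)" if "x' \<in> X" for x'
  proof -
    have "(\<Sum>x'\<in>X. cscale (B x' y - (if x' = x then 1 else 0)) x') = 0"
    proof -
      have "(\<Sum>x'\<in>X. cscale (if x' = x then 1 else 0) x') = (\<Sum>x'\<in>X. if x' = x then x' else 0)"
        by (intro sum.cong) auto
      also have "\<dots> = x" using x X'(1) by simp
      finally show ?thesis using y(2) by (simp add: T_def scale_left_diff_distrib sum_subtractf)
    qed
    then show ?thesis
      using independentD[OF X'(2,1), of "\<lambda>x'. B x' y - (if x' = x then 1 else 0)" x'] that by simp
  qed
  have "\<exists>!y. y \<in> u \<and> (\<forall>x'\<in>X. B x' y = (if x' = x then 1 else 0))"
  proof (rule ex1I[of _ y])
    show "y \<in> u \<and> (\<forall>x'\<in>X. B x' y = (if x' = x then 1 else 0))" using y By by blast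
    fix z assume z: "z \<in> u \<and> (\<forall>x'\<in>X. B x' z = (if x' = x then 1 else 0))"
    then have "T z = T y" unfolding T_def using By by (intro sum.cong) auto
    then show "z = y" using z y inj[of z y] by simp
  qed
  from theI'[OF this] show "dual X x \<in> u" "\<And>x'. x' \<in> X \<Longrightarrow> B x' (dual X x) = (if x' = x then 1 else 0)"
    unfolding dual_basis_elem_def by blast+
qed

lemma representation_dual:
  assumes X: "basis X" and v: "v \<in> u" and x: "x \<in> X"
  shows "representation X v x = B v (dual X x)"
proof -
  note X' = basisD[OF X]
  have "v \<in> span X" using v X' by simp
  then have *: "(\<Sum>y\<in>X. cscale (representation X v y) y) = v"
    using sum_representation_eq X' by blast
  have "B v (dual X x) = (\<Sum>y\<in>X. representation X v y * B y (dual X x))"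
    by (subst *[symmetric]) (simp add: B_sum B_scale)
  also have "\<dots> = (\<Sum>y\<in>X. if y = x then representation X v y else 0)"
    using B_dual[OF X x] by (intro sum.cong) auto
  also have "\<dots> = representation X v x" using x X' by simp
  finally show ?thesis by (rule sym)
qed

lemma expand_dual:
  assumes X: "basis X" and v: "v \<in> u"
  shows "(\<Sum>x\<in>X. cscale (B v (dual X x)) x) = v"
proof -
  note X' = basisD[OF X]
  have "(\<Sum>x\<in>X. cscale (B v (dual X x)) x) = (\<Sum>x\<in>X. cscale (representation X v x) x)"
    by (simp add: representation_dual[OF X v])
  also have "\<dots> = v" using sum_representation_eq[of X v X] X' v by blast
  finally show ?thesis .
qed

lemma expand:
  assumes X: "basis X" and v: "v \<in> u"
  shows "(\<Sum>x\<in>X. cscale (B v x) (dual X x)) = v"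
proof (rule B_eqI[OF _ v])
  show "(\<Sum>x\<in>X. cscale (B v x) (dual X x)) \<in> u"
    using dual_in[OF X] by (intro subspace_sum subspace_scale subspace_u)
  fix y assume y: "y \<in> u"
  have "B v y = B v (\<Sum>x\<in>X. cscale (B y (dual X x)) x)" using expand_dual[OF X y] by simp
  also have "\<dots> = (\<Sum>x\<in>X. B y (dual X x) * B v x)" by (simp add: B_sum B_scale)
  finally show "B (\<Sum>x\<in>X. cscale (B v x) (dual X x)) y = B v y"
    by (simp add: B_sum B_scale B_sym[of y] mult.commute)
qed

lemma B_expand: "basis X \<Longrightarrow> v \<in> u \<Longrightarrow> B v w = (\<Sum>x\<in>X. B v x * B (dual X x) w)"
  using arg_cong[OF expand[of X v], of "\<lambda>v. B v w"] by (simp add: B_sum B_scale)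

text \<open>The canonical tensor, the sum of x and its dual over a basis, does not depend on the
  basis. Weights may be attached as long as they agree wherever the transition matrix has a nonzero
  entry.\<close>

lemma tensor_invariance:
  assumes X: "basis X" and Y: "basis Y" and F: "bilin F"
    and \<phi>: "\<And>x y. x \<in> X \<Longrightarrow> y \<in> Y \<Longrightarrow> B x (dual Y y) \<noteq> 0 \<Longrightarrow> \<phi> x = \<psi> y"
  shows "(\<Sum>x\<in>X. \<phi> x * F x (dual X x)) = (\<Sum>y\<in>Y. \<psi> y * F y (dual Y y))"
proof -
  have "(\<Sum>x\<in>X. \<phi> x * F x (dual X x))
      = (\<Sum>x\<in>X. \<phi> x * F (\<Sum>y\<in>Y. cscale (B x (dual Y y)) y) (dual X x))"
    using expand_dual[OF Y] basisD[OF X] by (intro sum.cong) auto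
  also have "\<dots> = (\<Sum>x\<in>X. \<Sum>y\<in>Y. \<psi> y * (B x (dual Y y) * F y (dual X x)))"
    unfolding bilin_sum[OF F] bilin_scale[OF F] sum_distrib_left
    using \<phi> by (intro sum.cong refl) force
  also have "\<dots> = (\<Sum>y\<in>Y. \<psi> y * F y (\<Sum>x\<in>X. cscale (B (dual Y y) x) (dual X x)))"
    unfolding bilin_sum[OF F] bilin_scale[OF F] sum_distrib_left
    by (subst sum.swap) (simp add: B_sym)
  also have "\<dots> = (\<Sum>y\<in>Y. \<psi> y * F y (dual Y y))"
    using expand[OF X] dual_in[OF Y] by (intro sum.cong) auto
  finally show ?thesis .
qed

text \<open>The canonical tensor is symmetric because B is. Dual vectors need not belong to X, so
  the weight that goes with the dual of x is described through the members of X that pair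
  nontrivially with x.\<close>

lemma tensor_swap:
  assumes X: "basis X" and F: "bilin F"
    and \<phi>: "\<And>x y. x \<in> X \<Longrightarrow> y \<in> X \<Longrightarrow> B x y \<noteq> 0 \<Longrightarrow> \<phi> x = \<psi> y"
  shows "(\<Sum>x\<in>X. \<phi> x * F x (dual X x)) = (\<Sum>x\<in>X. \<psi> x * F (dual X x) x)"
proof -
  have "(\<Sum>x\<in>X. \<phi> x * F x (dual X x))
      = (\<Sum>x\<in>X. \<phi> x * F (\<Sum>y\<in>X. cscale (B x y) (dual X y)) (dual X x))"
    using expand[OF X] basisD[OF X] by (intro sum.cong) auto
  also have "\<dots> = (\<Sum>x\<in>X. \<Sum>y\<in>X. \<psi> y * (B x y * F (dual X y) (dual X x)))"
    unfolding bilin_sum[OF F] bilin_scale[OF F] sum_distrib_left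
    using \<phi> by (intro sum.cong refl) force
  also have "\<dots> = (\<Sum>y\<in>X. \<psi> y * F (dual X y) (\<Sum>x\<in>X. cscale (B y x) (dual X x)))"
    unfolding bilin_sum[OF F] bilin_scale[OF F] sum_distrib_left
    by (subst sum.swap) (simp add: B_sym)
  also have "\<dots> = (\<Sum>y\<in>X. \<psi> y * F (dual X y) y)"
    using expand[OF X] basisD[OF X] by (intro sum.cong) auto
  finally show ?thesis .
qed

text \<open>The same choice as in \<open>casimir\<close>, which makes \<open>Cas_X0\<close> a mere
  unfolding; other bases are reached by \<open>tensor_invariance\<close>.\<close>

definition X\<^sub>0 :: "'a set"
  where "X\<^sub>0 = (SOME X. basis X)"

lemma basis_X0: "basis X\<^sub>0"
  unfolding X\<^sub>0_def using someI_ex[OF basis_exists_u] .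

section \<open>Traces and the Killing form of \<open>u\<close>\<close>

definition tr :: "('a \<Rightarrow> 'a) \<Rightarrow> complex"
  where "tr f = (\<Sum>x\<in>X\<^sub>0. B (f x) (dual X\<^sub>0 x))"

lemma bilin_endo: "endo f \<Longrightarrow> bilin (\<lambda>x y. B (f x) y)"
  by (simp add: bilin_def lp.linear_add lp.linear_scale B_bilinear)

lemma tr_basis:
  assumes X: "basis X" and f: "endo f"
  shows "tr f = (\<Sum>x\<in>X. B (f x) (dual X x))"
  using tensor_invariance[OF basis_X0 X bilin_endo[OF f], of "\<lambda>_. 1" "\<lambda>_. 1"]
  by (simp add: tr_def)

lemma tr_cong: "(\<And>x. x \<in> u \<Longrightarrow> f x = g x) \<Longrightarrow> tr f = tr g"
  unfolding tr_def using basisD[OF basis_X0] by (intro sum.cong) auto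

lemma tr_add: "tr (\<lambda>x. f x + g x) = tr f + tr g"
  by (simp add: tr_def B_add sum.distrib)

lemma tr_diff: "tr (\<lambda>x. f x - g x) = tr f - tr g"
  by (simp add: tr_def B_diff sum_subtractf)

lemma tr_scale: "tr (\<lambda>x. cscale c (f x)) = c * tr f"
  by (simp add: tr_def B_scale sum_distrib_left)

lemma tr_comm:
  assumes f: "endo f" "\<And>x. x \<in> u \<Longrightarrow> f x \<in> u" and g: "endo g" "\<And>x. x \<in> u \<Longrightarrow> g x \<in> u"
  shows "tr (\<lambda>x. f (g x)) = tr (\<lambda>x. g (f x))"
proof -
  note X = basis_X0
  let ?d = "dual X\<^sub>0"
  have *: "tr (\<lambda>x. f (g x)) = (\<Sum>x\<in>X\<^sub>0. \<Sum>y\<in>X\<^sub>0. B (g x) (?d y) * B (f y) (?d x))"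
    if f: "endo f" and g: "\<And>x. x \<in> u \<Longrightarrow> g x \<in> u" for f g
  proof -
    have "B (f (g x)) (?d x) = (\<Sum>y\<in>X\<^sub>0. B (g x) (?d y) * B (f y) (?d x))" if "x \<in> X\<^sub>0" for x
    proof -
      have "g x = (\<Sum>y\<in>X\<^sub>0. cscale (B (g x) (?d y)) y)"
        using expand_dual[OF X] g basisD[OF X] that by simp
      then have "f (g x) = (\<Sum>y\<in>X\<^sub>0. cscale (B (g x) (?d y)) (f y))"
        by (metis (no_types, lifting) lp.linear_scale[OF f] lp.linear_sum[OF f] sum.cong)
      then show ?thesis by (simp add: B_sum B_scale)
    qed
    then show ?thesis unfolding tr_def by (rule sum.cong[OF refl])
  qed
  have "tr (\<lambda>x. f (g x)) = (\<Sum>x\<in>X\<^sub>0. \<Sum>y\<in>X\<^sub>0. B (g x) (?d y) * B (f y) (?d x))"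
    by (rule *) (use f g in auto)
  also have "\<dots> = (\<Sum>x\<in>X\<^sub>0. \<Sum>y\<in>X\<^sub>0. B (f x) (?d y) * B (g y) (?d x))"
    by (subst sum.swap) (simp add: mult.commute)
  also have "\<dots> = tr (\<lambda>x. g (f x))"
    by (rule *[symmetric]) (use f g in auto)
  finally show ?thesis .
qed

lemma tr_nil:
  assumes f: "endo f" "\<And>x. x \<in> u \<Longrightarrow> f x \<in> u" and nil: "nil_on f u"
  shows "tr f = 0"
proof -
  obtain X where X: "independent X" "span X = u" "\<And>x. x \<in> X \<Longrightarrow> f x \<in> span (X - {x})"
    using nil_basis[OF f(1) subspace_u f(2) nil] by blast
  then have b: "basis X" by (intro basisI)
  have "B (f x) (dual X x) = 0" if x: "x \<in> X" for x
    using X(3)[OF x]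
    by (induction rule: span_induct_alt) (auto simp: B_0 B_bilinear B_dual[OF b x])
  then show ?thesis by (simp add: tr_basis[OF b f(1)])
qed

definition K :: "'a \<Rightarrow> 'a \<Rightarrow> complex"
  where "K x y = tr (\<lambda>z. x \<bullet> (y \<bullet> z))"

lemma bilin_K: "bilin K"
  by (simp add: bilin_def K_def bracket_bilinear tr_add tr_scale)

lemmas K_bilinear = bilin_add[OF bilin_K] bilin_scale[OF bilin_K]

lemma endo_compose: "endo f \<Longrightarrow> endo g \<Longrightarrow> endo (\<lambda>x. f (g x))"
  by (rule endoI) (simp_all add: lp.linear_add lp.linear_scale)

lemma K_sym: "x \<in> u \<Longrightarrow> y \<in> u \<Longrightarrow> K x y = K y x"
  unfolding K_def by (rule tr_comm) (simp_all add: endo_bracket bracket_u)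

lemma K_inv:
  assumes "x \<in> u" "y \<in> u" "z \<in> u"
  shows "K (x \<bullet> y) z = K x (y \<bullet> z)"
proof -
  have br: "(x \<bullet> y) \<bullet> v = x \<bullet> (y \<bullet> v) - y \<bullet> (x \<bullet> v)" for x y v :: 'a
    using bracket_leibniz[of x y v] by simp
  have "tr (\<lambda>v. y \<bullet> (x \<bullet> (z \<bullet> v))) = tr (\<lambda>v. x \<bullet> (z \<bullet> (y \<bullet> v)))"
    by (rule tr_comm[of "lie_bracket y" "\<lambda>v. x \<bullet> (z \<bullet> v)"])
      (simp_all add: endo_bracket endo_compose bracket_u assms)
  then show ?thesis
    by (simp add: K_def br bracket_diff tr_diff)
qed

section \<open>The Casimir operator\<close>

definition Cas :: "'a \<Rightarrow> 'a"
  where "Cas = casimir B u"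

lemma Cas_X0: "Cas v = (\<Sum>x\<in>X\<^sub>0. x \<bullet> (dual X\<^sub>0 x \<bullet> v))"
  by (simp add: Cas_def casimir_def X\<^sub>0_def Let_def)

lemma endo_Cas: "endo Cas"
  by (rule endoI) (simp_all add: Cas_X0 bracket_bilinear sum.distrib scale_sum_right)

lemma Cas_u: "v \<in> u \<Longrightarrow> Cas v \<in> u"
  unfolding Cas_X0 using basisD[OF basis_X0] dual_in[OF basis_X0]
  by (intro subspace_sum subspace_u bracket_u) auto

lemma B_Cas: "B (Cas v) w = (\<Sum>x\<in>X\<^sub>0. B (x \<bullet> (dual X\<^sub>0 x \<bullet> v)) w)"
  by (simp add: Cas_X0 B_sum)

lemma bilin_bracket2: "bilin (\<lambda>x y. B (x \<bullet> (y \<bullet> v)) w)"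
  by (simp add: bilin_def bracket_bilinear B_bilinear)

lemma B_Cas_basis:
  assumes X: "basis X"
  shows "B (Cas v) w = (\<Sum>x\<in>X. B (x \<bullet> (dual X x \<bullet> v)) w)"
  using tensor_invariance[OF basis_X0 X bilin_bracket2, of "\<lambda>_. 1" "\<lambda>_. 1"]
  by (simp add: B_Cas)

text \<open>Invariance moves all brackets onto one basis vector of the canonical tensor, which turns
  the Casimir sum into a trace. The lemma links the given form with the Killing form:
  \<open>K\<close> degenerates exactly as far as the Casimir operator does.\<close>

lemma K_Cas:
  assumes "x \<in> u" "y \<in> u"
  shows "K x y = B (Cas x) y"
proof -
  have "B (z \<bullet> (a \<bullet> x)) y = B (y \<bullet> (x \<bullet> a)) z" for z a
  proof -
    have "(a \<bullet> x) \<bullet> y = y \<bullet> (x \<bullet> a)"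
      using bracket_swap[of a x] bracket_swap[of "a \<bullet> x" y] by (simp add: bracket_minus)
    then show ?thesis by (simp only: B_inv[of z "a \<bullet> x" y] B_sym[of z])
  qed
  then have "B (Cas x) y = (\<Sum>z\<in>X\<^sub>0. B (y \<bullet> (x \<bullet> dual X\<^sub>0 z)) z)"
    by (simp add: B_Cas)
  also have "\<dots> = K y x"
    using tensor_swap[OF basis_X0 bilin_endo[OF endo_compose[OF endo_bracket endo_bracket]],
        of "\<lambda>_. 1" "\<lambda>_. 1" y x]
    by (simp add: K_def tr_def)
  finally show ?thesis using K_sym assms by simp
qed

text \<open>Follows from invariance of the Killing form through \<open>K_Cas\<close>, without any
  computation in bases.\<close>

lemma Cas_bracket:
  assumes "y \<in> u" "v \<in> u"
  shows "Cas (y \<bullet> v) = y \<bullet> Cas v"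
proof (rule B_eqI)
  show "Cas (y \<bullet> v) \<in> u" "y \<bullet> Cas v \<in> u" using assms by (simp_all add: Cas_u bracket_u)
  fix w assume w: "w \<in> u"
  have "B (Cas (y \<bullet> v)) w = K (y \<bullet> v) w" using assms w by (simp add: K_Cas bracket_u)
  also have "\<dots> = - K (v \<bullet> y) w"
    using bracket_swap[of y v] bilin_minus[OF bilin_K] by simp
  also have "\<dots> = - K v (y \<bullet> w)" using K_inv assms w by simp
  also have "\<dots> = - B (Cas v) (y \<bullet> w)" using assms w by (simp add: K_Cas bracket_u)
  also have "\<dots> = B (y \<bullet> Cas v) w" by (simp add: B_skew)
  finally show "B (Cas (y \<bullet> v)) w = B (y \<bullet> Cas v) w" .
qed

lemma B_Cas_sym: "v \<in> u \<Longrightarrow> w \<in> u \<Longrightarrow> B (Cas v) w = B v (Cas w)"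
  using K_Cas K_sym B_sym by metis

end

section \<open>Reductive Lie algebras: Cartan's criterion and inner derivations\<close>

lemma lie_idealI:
  "csubspace i \<Longrightarrow> i \<subseteq> u \<Longrightarrow> (\<And>x y. x \<in> u \<Longrightarrow> y \<in> i \<Longrightarrow> x \<bullet> y \<in> i) \<Longrightarrow> lie_ideal u i"
  by (simp add: lie_ideal_def)

context fd_lie
begin

lemma nil_on_gen_eig: "nil_on f V \<longleftrightarrow> V \<subseteq> gen_eig f 0"
  by (auto simp: nil_on_def gen_eig_def shift_def)

lemma span_gen_eig:
  assumes f: "endo f" and V: "subspace V" "\<And>v. v \<in> V \<Longrightarrow> f v \<in> V"
  shows "span (\<Union>c. V \<inter> gen_eig f c) = V"
  using gen_eigenvectors_span[OF f V] by (intro span_subspace) (auto simp: V)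

end

context form_lie
begin

text \<open>Eigenvalues of ad x add up under the bracket, so an additive function of the semisimple
  part of ad x satisfies the Leibniz rule. It is checked on generalized eigenvectors, which span
  \<open>u\<close>.\<close>

lemma semisimple_part_derivation:
  assumes x: "x \<in> u" and \<phi>: "\<And>a b. \<phi> (a + b) = \<phi> a + \<phi> b"
  obtains D where "endo D" "\<And>v. v \<in> u \<Longrightarrow> D v \<in> u"
    "\<And>v w. v \<in> u \<Longrightarrow> w \<in> u \<Longrightarrow> D (v \<bullet> w) = D v \<bullet> w + v \<bullet> D w"
    "\<And>c w. w \<in> u \<Longrightarrow> w \<in> gen_eig (lie_bracket x) c \<Longrightarrow> D w = cscale (\<phi> c) w"
proof -
  let ?f = "lie_bracket x"
  have st: "\<And>v. v \<in> u \<Longrightarrow> ?f v \<in> u" using bracket_u x by blast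
  obtain D where D: "endo D" "\<And>c w. w \<in> u \<Longrightarrow> w \<in> gen_eig ?f c \<Longrightarrow> D w = cscale (\<phi> c) w"
    using gen_eig_operator[OF endo_bracket subspace_u st] by metis
  let ?S = "\<Union>c. u \<inter> gen_eig ?f c"
  have S: "span ?S = u" by (rule span_gen_eig[OF endo_bracket subspace_u st])
  have inS: "v \<in> span ?S" if "v \<in> u" for v using that by (simp only: S)
  have Du: "D v \<in> u" if "v \<in> u" for v
    using inS[OF that]
  proof (induction rule: span_induct_alt)
    case (step r a b)
    then obtain c where "a \<in> u" "a \<in> gen_eig ?f c" by blast
    then have "D a \<in> u" using D(2)[of a c] subspace_scale[OF subspace_u] by simp
    with step show ?case
      by (simp add: lp.linear_add[OF D(1)] lp.linear_scale[OF D(1)] subspace_add subspace_scale subspace_u)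
  qed (simp add: lp.linear_0[OF D(1)] zero_u)
  have der: "D (v \<bullet> w) = D v \<bullet> w + v \<bullet> D w" if v: "v \<in> u" and w: "w \<in> u" for v w
    using inS[OF v]
  proof (induction rule: span_induct_alt)
    case (step r a b)
    have "D (a \<bullet> w) = D a \<bullet> w + a \<bullet> D w"
      using inS[OF w]
    proof (induction rule: span_induct_alt)
      case (step s p q)
      obtain c d where "a \<in> u" "a \<in> gen_eig ?f c" "p \<in> u" "p \<in> gen_eig ?f d"
        using \<open>a \<in> ?S\<close> step by blast
      then have "D (a \<bullet> p) = cscale (\<phi> (c + d)) (a \<bullet> p)" "D a = cscale (\<phi> c) a" "D p = cscale (\<phi> d) p"
        using D(2) bracket_u bracket_gen_eig by auto
      then show ?case
        by (simp add: bracket_bilinear lp.linear_add[OF D(1)] lp.linear_scale[OF D(1)] step.IH \<phi>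
            scale_left_distrib scale_right_distrib mult.commute)
    qed (simp add: lp.linear_0[OF D(1)])
    then show ?case
      by (simp add: bracket_bilinear lp.linear_add[OF D(1)] lp.linear_scale[OF D(1)] step.IH
          scale_right_distrib)
  qed (simp add: lp.linear_0[OF D(1)])
  show ?thesis using that[OF D(1) Du der D(2)] by blast
qed

text \<open>For a derivation the commutator of D and ad a is ad (D a); the claim is this fact
  together with cyclicity of the trace.\<close>

lemma tr_derivation_bracket:
  assumes D: "endo D" "\<And>v. v \<in> u \<Longrightarrow> D v \<in> u"
    and der: "\<And>v w. v \<in> u \<Longrightarrow> w \<in> u \<Longrightarrow> D (v \<bullet> w) = D v \<bullet> w + v \<bullet> D w"
    and a: "a \<in> u" and b: "b \<in> u"
  shows "tr (\<lambda>v. D ((a \<bullet> b) \<bullet> v)) = K (D a) b"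
proof -
  have "tr (\<lambda>v. a \<bullet> D (b \<bullet> v)) = tr (\<lambda>v. D (b \<bullet> (a \<bullet> v)))"
    by (rule tr_comm[of "lie_bracket a" "\<lambda>v. D (b \<bullet> v)"])
      (simp_all add: endo_bracket endo_compose D a b bracket_u)
  moreover have "tr (\<lambda>v. D ((a \<bullet> b) \<bullet> v)) = tr (\<lambda>v. D (a \<bullet> (b \<bullet> v)) - D (b \<bullet> (a \<bullet> v)))"
    by (rule tr_cong) (simp add: bracket_leibniz[of a b] lp.linear_add[OF D(1)])
  moreover have "K (D a) b = tr (\<lambda>v. D (a \<bullet> (b \<bullet> v)) - a \<bullet> D (b \<bullet> v))"
    unfolding K_def by (rule tr_cong) (simp add: der a b bracket_u)
  ultimately show ?thesis by (simp add: tr_diff)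
qed

section \<open>Cartan's criterion\<close>

definition K_kernel :: "'a set"
  where "K_kernel = {x \<in> u. \<forall>y\<in>u. K x y = 0}"

lemma K_kernel_ideal: "lie_ideal u K_kernel"
proof (rule lie_idealI)
  show "subspace K_kernel"
    unfolding K_kernel_def
    by (rule subspaceI)
      (auto simp: zero_u K_bilinear bilin_0[OF bilin_K] subspace_add subspace_scale subspace_u)
  fix x y assume x: "x \<in> u" and y: "y \<in> K_kernel"
  have "K (y \<bullet> x) z = 0" if "z \<in> u" for z
    using x y that by (simp add: K_inv K_kernel_def bracket_u)
  then have "K (x \<bullet> y) z = 0" if "z \<in> u" for z
    using that bracket_swap[of x y] by (simp add: bilin_minus[OF bilin_K])
  then show "x \<bullet> y \<in> K_kernel" using x y by (simp add: K_kernel_def bracket_u)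
qed (auto simp: K_kernel_def)

text \<open>The derivation acting on the generalized eigenspaces of \<open>ad x\<close> by the conjugate eigenvalues
  makes the trace a sum of squares \<open>\<bar>c\<bar>\<^sup>2\<close>, while invariance makes it vanish.\<close>

lemma K_kernel_commutator_nil:
  assumes x: "x \<in> commutator_space K_kernel K_kernel"
  shows "nil_on (lie_bracket x) u"
proof -
  have Ju: "K_kernel \<subseteq> u" by (auto simp: K_kernel_def)
  have xu: "x \<in> u"
    using x commutator_space_least[OF subspace_u, of K_kernel K_kernel] bracket_u Ju by blast
  let ?f = "lie_bracket x"
  have st: "\<And>v. v \<in> u \<Longrightarrow> ?f v \<in> u" using bracket_u xu by blast
  obtain D where D: "endo D" "\<And>v. v \<in> u \<Longrightarrow> D v \<in> u"
      "\<And>v w. v \<in> u \<Longrightarrow> w \<in> u \<Longrightarrow> D (v \<bullet> w) = D v \<bullet> w + v \<bullet> D w"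
      "\<And>c w. w \<in> u \<Longrightarrow> w \<in> gen_eig ?f c \<Longrightarrow> D w = cscale (cnj c) w"
    using semisimple_part_derivation[OF xu, of cnj] complex_cnj_add by blast
  obtain Q where Q: "endo Q" "\<And>c w. w \<in> u \<Longrightarrow> w \<in> gen_eig ?f c \<Longrightarrow> Q w = cscale (cnj c * c) w"
    using gen_eig_operator[OF endo_bracket subspace_u st, of "\<lambda>c. cnj c * c"] by metis
  have trD: "tr (\<lambda>v. D (x \<bullet> v)) = 0"
    using x unfolding commutator_space_def
  proof (induction rule: span_induct_alt)
    case (step c p q)
    then obtain a b where p: "p = a \<bullet> b" "a \<in> K_kernel" "b \<in> K_kernel" by blast
    then have "tr (\<lambda>v. D (p \<bullet> v)) = K (D a) b"
      using tr_derivation_bracket[OF D(1-3)] Ju by blast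
    also have "\<dots> = 0"
      using p D(2) K_sym by (auto simp: K_kernel_def)
    finally show ?case using step.IH
      by (simp add: bracket_bilinear lp.linear_add[OF D(1)] lp.linear_scale[OF D(1)] tr_add tr_scale)
  qed (simp add: tr_def B_0 lp.linear_0[OF D(1)])
  \<comment> \<open>On the generalized eigenspace for c, D is the scalar \<open>cnj c\<close> and Q
    the scalar \<open>cnj c * c\<close>, so E is \<open>cnj c\<close> times ad x - c and nilpotent.
    Hence Q has the same trace as D after ad x, which is 0.\<close>
  define E where "E v = D (x \<bullet> v) - Q v" for v
  have E: "endo E"
    unfolding E_def
    by (rule endoI) (simp_all add: bracket_bilinear lp.linear_add[OF D(1)] lp.linear_scale[OF D(1)]
        lp.linear_add[OF Q(1)] lp.linear_scale[OF Q(1)] scale_right_diff_distrib)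
  have Eg: "w \<in> gen_eig E 0" and Qu: "Q w \<in> u" if w: "w \<in> u" "w \<in> gen_eig ?f c" for w c
  proof -
    show "Q w \<in> u" using Q(2)[OF w] w by (simp add: subspace_scale subspace_u)
    have *: "E v = cscale (cnj c) (shift ?f c v)" if "v \<in> u" "v \<in> gen_eig ?f c" for v
      using that D(4)[OF st gen_eig_stable[OF endo_bracket]] Q(2)
      by (simp add: E_def shift_def scale_right_diff_distrib)
    show "w \<in> gen_eig E 0"
      by (rule gen_eig_proportional[OF endo_bracket subspace_u st E * w])
  qed
  let ?S = "\<Union>c. u \<inter> gen_eig ?f c"
  have S: "span ?S = u" by (rule span_gen_eig[OF endo_bracket subspace_u st])
  have "nil_on E u"
    unfolding nil_on_gen_eig using Eg
    by (subst S[symmetric]) (intro span_minimal subspace_gen_eig[OF E], blast)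
  moreover have "subspace {v. Q v \<in> u}" by (rule lp.linear_subspace_linear_preimage[OF Q(1) subspace_u])
  then have "span ?S \<subseteq> {v. Q v \<in> u}" using Qu by (intro span_minimal) blast
  then have Qu': "Q v \<in> u" if "v \<in> u" for v using that unfolding S by blast
  then have "E v \<in> u" if "v \<in> u" for v
    using that D(2) st by (simp add: E_def subspace_diff subspace_u)
  ultimately have "tr E = 0" using tr_nil[OF E] by blast
  with trD have trQ: "tr Q = 0" by (simp add: E_def[abs_def] tr_diff)
  obtain X where X: "X \<subseteq> ?S" "independent X" "?S \<subseteq> span X"
    using maximal_independent_subset[of ?S] by blast
  have "span X \<subseteq> span ?S" and "span ?S \<subseteq> span X"
    using span_mono[OF X(1)] span_minimal[OF X(3) subspace_span] by blast+
  then have "span X = u" unfolding S by blast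
  then have b: "basis X" using X basisI by blast
  have "\<forall>w\<in>X. \<exists>c. w \<in> gen_eig ?f c" using X(1) by blast
  then obtain e where e: "\<And>w. w \<in> X \<Longrightarrow> w \<in> gen_eig ?f (e w)" by metis
  have "tr Q = (\<Sum>w\<in>X. cnj (e w) * e w)"
    unfolding tr_basis[OF b Q(1)]
  proof (rule sum.cong[OF refl])
    fix w assume w: "w \<in> X"
    show "B (Q w) (dual X w) = cnj (e w) * e w"
      using Q(2)[OF basisD(4)[OF b w] e[OF w]] B_dual[OF b w w] by (simp add: B_scale)
  qed
  also have "\<dots> = complex_of_real (\<Sum>w\<in>X. (cmod (e w))\<^sup>2)"
    by (simp only: of_real_sum complex_norm_square mult.commute)
  finally have "(\<Sum>w\<in>X. (cmod (e w))\<^sup>2) = 0" using trQ by (metis of_real_eq_0_iff)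
  then have "e w = 0" if "w \<in> X" for w
    using that basisD(1)[OF b] by (simp add: sum_nonneg_eq_0_iff)
  then have "X \<subseteq> gen_eig ?f 0" using e by fastforce
  then have "span X \<subseteq> gen_eig ?f 0" by (intro span_minimal subspace_gen_eig endo_bracket)
  then show ?thesis using \<open>span X = u\<close> by (simp add: nil_on_gen_eig)
qed

lemma solvable_K_kernel: "solvable K_kernel"
proof -
  let ?I = "commutator_space K_kernel K_kernel"
  have J: "subspace K_kernel" "\<And>x y. x \<in> K_kernel \<Longrightarrow> y \<in> K_kernel \<Longrightarrow> x \<bullet> y \<in> K_kernel"
    using K_kernel_ideal by (auto simp: lie_ideal_def)
  then have IJ: "?I \<subseteq> K_kernel" by (rule commutator_space_least)
  then have Iu: "?I \<subseteq> u" by (auto simp: K_kernel_def)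
  have "solvable ?I"
  proof (rule nil_solvable)
    show "subalgebra ?I"
      unfolding subalgebra_def using IJ
      by (intro conjI ballI csubspace_commutator_space bracket_in_commutator_space) auto
    show "nil_on (lie_bracket x) ?I" if "x \<in> ?I" for x
      using K_kernel_commutator_nil[OF that] Iu unfolding nil_on_def by blast
  qed
  then show ?thesis by (rule solvable_commutator)
qed

end

text \<open>One condition for all the cases: solvable ideals vanish in a semisimple algebra,
  everything is central in an abelian one, and the radical of a reductive algebra is its
  center.\<close>

locale reductive_lie = form_lie +
  assumes solvable_central: "\<And>i. lie_ideal u i \<Longrightarrow> solvable i \<Longrightarrow> i \<subseteq> center u"
begin

section \<open>Center, Casimir operator and inner derivations of a reductive algebra\<close>

abbreviation Z :: "'a set"
  where "Z \<equiv> center u"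

lemma Z_u: "x \<in> Z \<Longrightarrow> x \<in> u" and Z_bracket: "x \<in> Z \<Longrightarrow> y \<in> u \<Longrightarrow> x \<bullet> y = 0"
  and bracket_Z: "x \<in> Z \<Longrightarrow> y \<in> u \<Longrightarrow> y \<bullet> x = 0"
  using bracket_swap[of y x] by (auto simp: center_def)

lemma ZI: "x \<in> u \<Longrightarrow> (\<And>y. y \<in> u \<Longrightarrow> x \<bullet> y = 0) \<Longrightarrow> x \<in> Z"
  by (simp add: center_def)

lemma subspace_Z: "subspace Z"
  unfolding center_def
  by (rule subspaceI) (auto simp: zero_u bracket_bilinear subspace_add subspace_scale subspace_u)

lemma Cas_Z: "x \<in> Z \<Longrightarrow> Cas x = 0"
  unfolding Cas_X0 using bracket_Z dual_in[OF basis_X0] by simp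

lemma K_kernel_Z: "x \<in> u \<Longrightarrow> (\<And>y. y \<in> u \<Longrightarrow> K x y = 0) \<Longrightarrow> x \<in> Z"
  using solvable_central[OF K_kernel_ideal solvable_K_kernel] by (auto simp: K_kernel_def)

lemma Cas_kernel_Z: "x \<in> u \<Longrightarrow> Cas x = 0 \<Longrightarrow> x \<in> Z"
  by (rule K_kernel_Z) (simp_all add: K_Cas B_0)

text \<open>The second center is an ideal whose brackets are central, so it is solvable and
  therefore itself central.\<close>

lemma second_center:
  assumes "v \<in> u" "\<And>y. y \<in> u \<Longrightarrow> y \<bullet> v \<in> Z"
  shows "v \<in> Z"
proof -
  let ?I = "{v \<in> u. \<forall>y\<in>u. y \<bullet> v \<in> Z}"
  have "lie_ideal u ?I"
  proof (rule lie_idealI)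
    show "subspace ?I"
      using subspace_Z subspace_u by (intro subspaceI)
        (auto simp: zero_u bracket_bilinear subspace_add subspace_scale subspace_0)
    fix x y assume "x \<in> u" "y \<in> ?I"
    moreover then have "x \<bullet> y \<in> Z" by simp
    ultimately show "x \<bullet> y \<in> ?I"
      using subspace_0[OF subspace_Z] by (simp add: bracket_u bracket_Z)
  qed auto
  moreover have "commutator_space ?I ?I \<subseteq> Z"
    by (intro commutator_space_least subspace_Z) auto
  then have "solvable ?I"
    using Z_bracket Z_u by (intro solvable_commutator[OF solvable_abelian]) blast
  ultimately show ?thesis using solvable_central assms by blast
qed

text \<open>For c = 0, Cas v is central, hence so are all brackets with v, and v lies in the second
  center. For c \<noteq> 0, the image of Cas - c on the kernel of its square is an abelian ideal, so
  it is central and Cas vanishes there; but Cas also acts there by the nonzero scalar c.\<close>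

lemma Cas_shift_square:
  assumes v: "v \<in> u" and N: "shift Cas c (shift Cas c v) = 0"
  shows "shift Cas c v = 0"
proof -
  let ?N = "shift Cas c"
  have Nlin: "endo ?N" by (intro endo_shift endo_Cas)
  have Nu: "?N w \<in> u" if "w \<in> u" for w using shift_stable[OF subspace_u Cas_u that] .
  have Nbr: "?N (y \<bullet> w) = y \<bullet> ?N w" if "y \<in> u" "w \<in> u" for y w
    using that by (simp add: shift_def Cas_bracket bracket_diff bracket_bilinear)
  show ?thesis
  proof (cases "c = 0")
    case True
    then have N0: "?N = Cas" by (simp add: shift_def[abs_def])
    have "Cas v \<in> Z" using N v by (intro Cas_kernel_Z Cas_u) (simp_all add: N0)
    then have "y \<bullet> v \<in> Z" if "y \<in> u" for y
      using that v by (intro Cas_kernel_Z) (simp_all add: bracket_u Cas_bracket bracket_Z)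
    then have "v \<in> Z" using second_center v by blast
    then show ?thesis by (simp add: N0 Cas_Z)
  next
    case False
    let ?I = "{?N v | v. v \<in> u \<and> ?N (?N v) = 0}"
    have "lie_ideal u ?I"
    proof (rule lie_idealI)
      have "subspace {v \<in> u. ?N (?N v) = 0}"
        by (rule subspaceI) (auto simp: lp.linear_0[OF Nlin] lp.linear_add[OF Nlin] lp.linear_scale[OF Nlin]
            zero_u subspace_add subspace_scale subspace_u)
      then have "subspace (?N ` {v \<in> u. ?N (?N v) = 0})" by (rule lp.linear_subspace_image[OF Nlin])
      also have "?N ` {v \<in> u. ?N (?N v) = 0} = ?I" by blast
      finally show "subspace ?I" .
      show "?I \<subseteq> u" using Nu by blast
      fix y x assume y: "y \<in> u" and "x \<in> ?I"
      then obtain v where v: "x = ?N v" "v \<in> u" "?N (?N v) = 0" by blast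
      then show "y \<bullet> x \<in> ?I"
        using y by (intro CollectI exI[of _ "y \<bullet> v"]) (simp add: Nbr Nu bracket_u)
    qed
    moreover have "x \<bullet> y = 0" if xy: "x \<in> ?I" "y \<in> ?I" for x y
    proof -
      obtain v w where v: "x = ?N v" "v \<in> u" "?N (?N v) = 0" and w: "y = ?N w" "w \<in> u"
        using xy by blast
      have "x \<bullet> y = ?N (?N v \<bullet> w)" using v w by (simp add: Nbr Nu)
      also have "?N v \<bullet> w = - ?N (w \<bullet> v)" using bracket_swap[of "?N v" w] v w by (simp add: Nbr)
      also have "?N \<dots> = - (w \<bullet> ?N (?N v))" using v w by (simp add: lp.linear_neg[OF Nlin] Nbr Nu)
      finally show ?thesis using v by simp
    qed
    then have "solvable ?I" by (rule solvable_abelian)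
    ultimately have "?I \<subseteq> Z" by (rule solvable_central)
    then have "?N v \<in> Z" using v N by blast
    then have "cscale c (?N v) = 0" using N by (simp add: shift_def Cas_Z)
    then show ?thesis using False by simp
  qed
qed

lemma diag_on_Cas: "diag_on Cas u"
proof -
  have "Cas v = cscale c v" if v: "v \<in> u" "(shift Cas c ^^ n) v = 0" for v c n
  proof -
    have "shift Cas c v = 0" using v
    proof (induction n arbitrary: v)
      case (Suc n)
      have "shift Cas c v \<in> u" using shift_stable[OF subspace_u Cas_u Suc.prems(1)] .
      with Suc have "shift Cas c (shift Cas c v) = 0" by (simp add: funpow_swap1)
      then show ?case using Cas_shift_square Suc.prems by blast
    qed (simp add: lp.linear_0[OF endo_shift[OF endo_Cas]])
    then show ?thesis by (simp add: shift_def)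
  qed
  then have "(\<Union>c. u \<inter> gen_eig Cas c) \<subseteq> {v \<in> u. \<exists>c. Cas v = cscale c v}"
    by (auto simp: gen_eig_def)
  then show ?thesis
    unfolding diag_on_def using gen_eigenvectors_span[OF endo_Cas subspace_u Cas_u] span_mono by blast
qed

text \<open>A form of the decomposition into the center and the derived algebra: a Casimir
  eigenvector is central if its eigenvalue is 0, and otherwise it is the image of a multiple of
  itself.\<close>

lemma Z_plus_Cas:
  assumes "v \<in> u" obtains a b where "a \<in> Z" "b \<in> u" "v = a + Cas b"
proof -
  have "v \<in> span {v \<in> u. \<exists>c. Cas v = cscale c v}" using diag_on_Cas assms by (auto simp: diag_on_def)
  then have "\<exists>a b. a \<in> Z \<and> b \<in> u \<and> v = a + Cas b"
  proof (induction rule: span_induct_alt)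
    case base
    show ?case
      by (intro exI[of _ 0]) (simp add: zero_u subspace_0[OF subspace_Z] lp.linear_0[OF endo_Cas])
  next
    case (step r p q)
    then obtain c where c: "p \<in> u" "Cas p = cscale c p" by blast
    have "\<exists>a b. a \<in> Z \<and> b \<in> u \<and> p = a + Cas b"
    proof (cases "c = 0")
      case True
      then show ?thesis
        using c Cas_kernel_Z[of p] by (intro exI[of _ p] exI[of _ 0]) (simp add: zero_u lp.linear_0[OF endo_Cas])
    next
      case False
      then show ?thesis
        using c by (intro exI[of _ 0] exI[of _ "cscale (inverse c) p"])
          (simp add: subspace_0[OF subspace_Z] subspace_scale subspace_u lp.linear_scale[OF endo_Cas])
    qed
    then obtain a b where ab: "a \<in> Z" "b \<in> u" "p = a + Cas b" by blast
    from step obtain a' b' where ab': "a' \<in> Z" "b' \<in> u" "q = a' + Cas b'" by blast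
    have "cscale r p + q = (cscale r a + a') + Cas (cscale r b + b')"
      using ab ab' by (simp add: lp.linear_add[OF endo_Cas] lp.linear_scale[OF endo_Cas] scale_right_distrib)
    moreover have "cscale r a + a' \<in> Z" "cscale r b + b' \<in> u"
      using ab ab' by (simp_all add: subspace_add subspace_scale subspace_Z subspace_u)
    ultimately show ?case by blast
  qed
  then show ?thesis using that by blast
qed

lemma Cas_commutator: "v \<in> u \<Longrightarrow> Cas v \<in> commutator_space u u"
  unfolding Cas_X0 using basisD[OF basis_X0] dual_in[OF basis_X0]
  by (intro subspace_sum csubspace_commutator_space bracket_in_commutator_space bracket_u) auto

text \<open>Such x is orthogonal to Z as an element of the derived algebra, and to the image of Cas
  as an element of its kernel; by \<open>Z_plus_Cas\<close> it is orthogonal to all of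
  \<open>u\<close>.\<close>

lemma Z_commutator:
  assumes x: "x \<in> Z" "x \<in> commutator_space u u"
  shows "x = 0"
proof (rule B_nondeg[OF Z_u[OF x(1)]])
  fix y assume "y \<in> u"
  then obtain a b where y: "a \<in> Z" "b \<in> u" "y = a + Cas b" by (rule Z_plus_Cas)
  have "B x a = 0"
    using x(2) unfolding commutator_space_def
    by (induction rule: span_induct_alt) (auto simp: B_0 B_bilinear B_inv bracket_Z y)
  moreover have "B x (Cas b) = 0" using B_Cas_sym[of x b] x y by (simp add: Cas_Z B_0 Z_u)
  ultimately show "B x y = 0" using y by (simp add: B_add)
qed

text \<open>Choose x whose inner derivation has the same traces against ad y as D. The difference E
  then maps into the radical of \<open>K\<close>, which is central, so E kills brackets; it kills Z
  as well, and these two span \<open>u\<close>.\<close>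

lemma inner_derivation:
  assumes D: "endo D" "\<And>v. v \<in> u \<Longrightarrow> D v \<in> u"
    and der: "\<And>v w. v \<in> u \<Longrightarrow> w \<in> u \<Longrightarrow> D (v \<bullet> w) = D v \<bullet> w + v \<bullet> D w"
    and DZ: "\<And>v. v \<in> Z \<Longrightarrow> D v = 0"
  obtains b where "b \<in> u" "\<And>v. v \<in> u \<Longrightarrow> D v = Cas b \<bullet> v"
proof -
  define \<psi> where "\<psi> y = tr (\<lambda>v. D (y \<bullet> v))" for y
  have \<psi>_add: "\<psi> (y + z) = \<psi> y + \<psi> z" and \<psi>_scale: "\<psi> (cscale c y) = c * \<psi> y" for y z c
    by (simp_all add: \<psi>_def bracket_bilinear lp.linear_add[OF D(1)] lp.linear_scale[OF D(1)] tr_add tr_scale)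
  have \<psi>_0: "\<psi> 0 = 0" using \<psi>_scale[of 0 0] by simp
  have \<psi>_sum: "\<psi> (sum f A) = (\<Sum>i\<in>A. \<psi> (f i))" for f and A :: "'a set"
    by (induction A rule: infinite_finite_induct) (simp_all add: \<psi>_add \<psi>_0)
  \<comment> \<open>The Killing form is degenerate on Z, so \<psi> is represented by B first; by
    \<open>K_Cas\<close> it remains to find a preimage of v0 under Cas.\<close>
  define v0 where "v0 = (\<Sum>x\<in>X\<^sub>0. cscale (\<psi> x) (dual X\<^sub>0 x))"
  have v0u: "v0 \<in> u"
    unfolding v0_def using dual_in[OF basis_X0] by (intro subspace_sum subspace_scale subspace_u)
  have v0: "B v0 y = \<psi> y" if "y \<in> u" for y
  proof -
    have "\<psi> y = \<psi> (\<Sum>x\<in>X\<^sub>0. cscale (B y (dual X\<^sub>0 x)) x)" using expand_dual[OF basis_X0 that] by simp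
    then show ?thesis by (simp add: v0_def B_sum B_scale \<psi>_sum \<psi>_scale B_sym[of y] mult.commute)
  qed
  obtain a b where ab: "a \<in> Z" "b \<in> u" "v0 = a + Cas b" using Z_plus_Cas[OF v0u] .
  \<comment> \<open>Both \<psi> and the image of Cas vanish against Z, so the central component of
    v0 is orthogonal to \<open>u\<close>.\<close>
  have "a = 0"
  proof (rule B_nondeg[OF Z_u[OF ab(1)]])
    fix y assume "y \<in> u"
    then obtain p q where y: "p \<in> Z" "q \<in> u" "y = p + Cas q" by (rule Z_plus_Cas)
    have "\<psi> p = tr (\<lambda>v. 0)"
      unfolding \<psi>_def using y by (intro tr_cong) (simp add: Z_bracket lp.linear_0[OF D(1)])
    also have "\<dots> = 0" by (simp add: tr_def B_0)
    finally have "\<psi> p = 0" .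
    moreover have "B (Cas b) p = 0" using B_Cas_sym[of b p] ab y by (simp add: Cas_Z B_0 Z_u)
    ultimately have "B a p = 0" using v0[OF Z_u[OF y(1)]] ab by (simp add: B_add)
    moreover have "B a (Cas q) = 0" using B_Cas_sym[of a q] ab y by (simp add: Cas_Z B_0 Z_u)
    ultimately show "B a y = 0" using y by (simp add: B_add)
  qed
  \<comment> \<open>Dropping the central component of b does not change Cas b. The implementing
    element then lies in the derived algebra, where by \<open>Z_commutator\<close> it is determined
    by its action.\<close>
  obtain a' b' where ab': "a' \<in> Z" "b' \<in> u" "b = a' + Cas b'" using Z_plus_Cas[OF ab(2)] .
  let ?x = "Cas b'"
  have xu: "?x \<in> u" using ab' Cas_u by blast
  have "Cas ?x = v0"
    using ab ab' \<open>a = 0\<close> by (simp add: lp.linear_add[OF endo_Cas] Cas_Z)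
  then have Kx: "K ?x y = \<psi> y" if "y \<in> u" for y using v0[OF that] K_Cas[OF xu that] by simp
  define E where "E v = D v - ?x \<bullet> v" for v
  have E: "endo E"
    unfolding E_def by (rule endoI)
      (simp_all add: bracket_bilinear lp.linear_add[OF D(1)] lp.linear_scale[OF D(1)] scale_right_diff_distrib)
  have Eu: "E v \<in> u" if "v \<in> u" for v
    using that D(2) xu by (simp add: E_def subspace_diff subspace_u bracket_u)
  have Eder: "E (v \<bullet> w) = E v \<bullet> w + v \<bullet> E w" if "v \<in> u" "w \<in> u" for v w
    using that by (simp add: E_def der bracket_leibniz[of ?x v w] bracket_diff)
  have trE: "tr (\<lambda>v. E (y \<bullet> v)) = 0" if "y \<in> u" for y
    using Kx[OF that] by (simp add: E_def[abs_def] tr_diff \<psi>_def K_def)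
  have EZ: "E y \<in> Z" if y: "y \<in> u" for y
  proof (rule K_kernel_Z[OF Eu[OF y]])
    fix w assume w: "w \<in> u"
    show "K (E y) w = 0"
      using tr_derivation_bracket[OF E Eu Eder y w] trE[OF bracket_u[OF y w]] by simp
  qed
  have "E v = 0" if "v \<in> commutator_space u u" for v
    using that unfolding commutator_space_def
  proof (induction rule: span_induct_alt)
    case (step r p q)
    then obtain s t where st: "p = s \<bullet> t" "s \<in> u" "t \<in> u" by blast
    then have "E p = 0" using EZ by (simp add: Eder Z_bracket bracket_Z)
    with step show ?case by (simp add: lp.linear_add[OF E] lp.linear_scale[OF E])
  qed (simp add: lp.linear_0[OF E])
  moreover have "E v = 0" if "v \<in> Z" for v using that xu DZ by (simp add: E_def bracket_Z)
  ultimately have "E v = 0" if "v \<in> u" for v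
    using Z_plus_Cas[OF that] Cas_commutator by (metis E add.left_neutral lp.linear_add)
  then have "D v = ?x \<bullet> v" if "v \<in> u" for v using that by (simp add: E_def)
  then show ?thesis using that ab' by blast
qed

end

section \<open>Cartan subalgebras of the fixed point algebra\<close>

locale twisted_lie = reductive_lie +
  fixes \<sigma> :: "'a \<Rightarrow> 'a" and h :: "'a set"
  assumes endo_\<sigma>: "endo \<sigma>" and \<sigma>_bracket: "\<And>x y. \<sigma> (x \<bullet> y) = \<sigma> x \<bullet> \<sigma> y"
    and B_\<sigma>: "\<And>x y. B (\<sigma> x) (\<sigma> y) = B x y"
    and \<sigma>_u: "\<And>x. x \<in> u \<Longrightarrow> \<sigma> x \<in> u" and diag_\<sigma>: "diag_on \<sigma> u"
    and \<sigma>_unimodular: "\<And>c x. x \<noteq> 0 \<Longrightarrow> \<sigma> x = cscale c x \<Longrightarrow> cmod c = 1"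
    and cartan: "cartan_subalgebra (sigma_part \<sigma> u 0) h"
begin

abbreviation u\<^sub>0 :: "'a set"
  where "u\<^sub>0 \<equiv> sigma_part \<sigma> u 0"

lemma u0_iff: "x \<in> u\<^sub>0 \<longleftrightarrow> x \<in> u \<and> \<sigma> x = x"
  by (simp add: sigma_part_def)

lemma subspace_h: "subspace h" and h_bracket: "x \<in> h \<Longrightarrow> y \<in> h \<Longrightarrow> x \<bullet> y \<in> h"
  and h_u0: "x \<in> h \<Longrightarrow> x \<in> u\<^sub>0" and h_u: "x \<in> h \<Longrightarrow> x \<in> u" and \<sigma>_h: "x \<in> h \<Longrightarrow> \<sigma> x = x"
  and nilpotent_h: "nilpotent h"
  using cartan by (auto simp: cartan_subalgebra_def subalgebra_def u0_iff)

lemma zero_h: "0 \<in> h"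
  by (rule subspace_0[OF subspace_h])

lemma h_normalizer: "x \<in> u\<^sub>0 \<Longrightarrow> (\<And>y. y \<in> h \<Longrightarrow> x \<bullet> y \<in> h) \<Longrightarrow> x \<in> h"
  using cartan by (auto simp: cartan_subalgebra_def)

lemma eigen_agree:
  assumes "endo f" "endo g" and "\<And>v c. v \<in> u \<Longrightarrow> \<sigma> v = cscale c v \<Longrightarrow> f v = g v" and "v \<in> u"
  shows "f v = g v"
proof (rule lp.linear_eq_on[OF assms(1,2)])
  show "v \<in> span {v \<in> u. \<exists>c. \<sigma> v = cscale c v}" using diag_\<sigma> assms(4) by (auto simp: diag_on_def)
qed (use assms(3) in blast)

text \<open>Built on \<open>u\<close> by inverting eigenvalues, which are nonzero because they have
  modulus 1; this also shows that the inverse preserves \<open>u\<close>.\<close>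

lemma \<sigma>_inverse:
  obtains \<tau> where "endo \<tau>" "\<And>v. v \<in> u \<Longrightarrow> \<tau> v \<in> u" "\<And>v. v \<in> u \<Longrightarrow> \<tau> (\<sigma> v) = v" "\<And>v. v \<in> u \<Longrightarrow> \<sigma> (\<tau> v) = v"
proof -
  obtain \<tau> where \<tau>: "endo \<tau>" "\<And>c w. w \<in> u \<Longrightarrow> w \<in> gen_eig \<sigma> c \<Longrightarrow> \<tau> w = cscale (inverse c) w"
    using gen_eig_operator[OF endo_\<sigma> subspace_u \<sigma>_u, of inverse] by metis
  have \<tau>e: "\<tau> v = cscale (inverse c) v" if "v \<in> u" "\<sigma> v = cscale c v" for v c
    using \<tau>(2) that eigenvector_gen_eig by blast
  have c0: "v = 0 \<or> c \<noteq> 0" if "\<sigma> v = cscale c v" for v c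
    using \<sigma>_unimodular[OF _ that] by fastforce
  have 1: "\<tau> (\<sigma> v) = v" if "v \<in> u" for v
  proof (rule eigen_agree[OF endo_compose[OF \<tau>(1) endo_\<sigma>] endoI _ that])
    fix v c assume v: "v \<in> u" "\<sigma> v = cscale c v"
    show "\<tau> (\<sigma> v) = v"
      using c0[OF v(2)] \<tau>e[OF v] v(2) by (auto simp: lp.linear_scale[OF \<tau>(1)] lp.linear_0[OF \<tau>(1)])
  qed auto
  have 2: "\<sigma> (\<tau> v) = v" if "v \<in> u" for v
  proof (rule eigen_agree[OF endo_compose[OF endo_\<sigma> \<tau>(1)] endoI _ that])
    fix v c assume v: "v \<in> u" "\<sigma> v = cscale c v"
    show "\<sigma> (\<tau> v) = v"
      using c0[OF v(2)] \<tau>e[OF v] v(2) by (auto simp: lp.linear_scale[OF endo_\<sigma>] lp.linear_0[OF endo_\<sigma>])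
  qed auto
  have "\<tau> v \<in> u" if "v \<in> u" for v
  proof -
    have "v \<in> span {v \<in> u. \<exists>c. \<sigma> v = cscale c v}" using diag_\<sigma> that by (auto simp: diag_on_def)
    then show ?thesis
    proof (induction rule: span_induct_alt)
      case (step r p q)
      then obtain c where "p \<in> u" "\<sigma> p = cscale c p" by blast
      then have "\<tau> p \<in> u" using \<tau>e[of p c] by (simp add: subspace_scale subspace_u)
      with step show ?case
        by (simp add: lp.linear_add[OF \<tau>(1)] lp.linear_scale[OF \<tau>(1)] subspace_add subspace_scale subspace_u)
    qed (simp add: lp.linear_0[OF \<tau>(1)] zero_u)
  qed
  then show ?thesis using that \<tau>(1) 1 2 by blast
qed

lemma K_\<sigma>:
  assumes x: "x \<in> u" and y: "y \<in> u"
  shows "K (\<sigma> x) (\<sigma> y) = K x y"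
proof -
  obtain \<tau> where \<tau>: "endo \<tau>" "\<And>v. v \<in> u \<Longrightarrow> \<tau> v \<in> u" "\<And>v. v \<in> u \<Longrightarrow> \<tau> (\<sigma> v) = v"
      "\<And>v. v \<in> u \<Longrightarrow> \<sigma> (\<tau> v) = v" using \<sigma>_inverse by metis
  have "K (\<sigma> x) (\<sigma> y) = tr (\<lambda>z. \<sigma> (x \<bullet> (y \<bullet> \<tau> z)))"
    unfolding K_def by (rule tr_cong) (simp add: \<sigma>_bracket \<tau>)
  also have "\<dots> = tr (\<lambda>z. x \<bullet> (y \<bullet> \<tau> (\<sigma> z)))"
    by (rule tr_comm[of \<sigma> "\<lambda>z. x \<bullet> (y \<bullet> \<tau> z)", OF endo_\<sigma> \<sigma>_u
          endo_compose[OF endo_bracket endo_compose[OF endo_bracket \<tau>(1)]]])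
      (simp_all add: \<tau> bracket_u x y)
  also have "\<dots> = K x y"
    unfolding K_def by (rule tr_cong) (simp add: \<tau>)
  finally show ?thesis .
qed

lemma Cas_\<sigma>:
  assumes v: "v \<in> u" shows "Cas (\<sigma> v) = \<sigma> (Cas v)"
proof -
  obtain \<tau> where \<tau>: "\<And>v. v \<in> u \<Longrightarrow> \<tau> v \<in> u" "\<And>v. v \<in> u \<Longrightarrow> \<sigma> (\<tau> v) = v" using \<sigma>_inverse by metis
  show ?thesis
  proof (rule B_eqI)
    show "Cas (\<sigma> v) \<in> u" "\<sigma> (Cas v) \<in> u" using v by (simp_all add: Cas_u \<sigma>_u)
    fix w assume w: "w \<in> u"
    have "B (Cas (\<sigma> v)) (\<sigma> (\<tau> w)) = B (Cas v) (\<tau> w)"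
      using K_\<sigma>[OF v \<tau>(1)[OF w]] v \<tau>(1)[OF w] by (simp add: K_Cas \<sigma>_u)
    also have "\<dots> = B (\<sigma> (Cas v)) (\<sigma> (\<tau> w))" by (simp add: B_\<sigma>)
    finally show "B (Cas (\<sigma> v)) w = B (\<sigma> (Cas v)) w" using \<tau> w by simp
  qed
qed

lemma lower_central_series_h: "t \<in> h \<Longrightarrow> y \<in> h \<Longrightarrow> (lie_bracket t ^^ n) y \<in> lower_central_series h n"
  by (induction n) (simp_all add: bracket_in_commutator_space)

lemma nil_h: "t \<in> h \<Longrightarrow> nil_on (lie_bracket t) h"
  using nilpotent_h lower_central_series_h unfolding nilpotent_def nil_on_def by blast

text \<open>The semisimple part of ad t is a derivation that kills Z, hence inner, given by some s
  in the derived algebra. It commutes with \<sigma> because \<sigma> fixes t, so \<sigma> s - s is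
  central and in the derived algebra, that is 0. As ad t is nilpotent on h, s commutes with h, and
  self-normalization puts s into h.\<close>

lemma semisimple_part:
  assumes t: "t \<in> h"
  obtains s where "s \<in> h" "\<And>y. y \<in> h \<Longrightarrow> s \<bullet> y = 0"
    "\<And>c w. w \<in> u \<Longrightarrow> w \<in> gen_eig (lie_bracket t) c \<Longrightarrow> s \<bullet> w = cscale c w"
proof -
  have tu: "t \<in> u" using t h_u by blast
  let ?f = "lie_bracket t"
  have st: "\<And>v. v \<in> u \<Longrightarrow> ?f v \<in> u" using bracket_u tu by blast
  obtain D where D: "endo D" "\<And>v. v \<in> u \<Longrightarrow> D v \<in> u"
      "\<And>v w. v \<in> u \<Longrightarrow> w \<in> u \<Longrightarrow> D (v \<bullet> w) = D v \<bullet> w + v \<bullet> D w"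
      "\<And>c w. w \<in> u \<Longrightarrow> w \<in> gen_eig ?f c \<Longrightarrow> D w = cscale c w"
    using semisimple_part_derivation[OF tu, of "\<lambda>c. c"] by metis
  have "D v = 0" if "v \<in> Z" for v
    using D(4)[OF Z_u[OF that] eigenvector_gen_eig[of ?f v 0]] that tu by (simp add: bracket_Z)
  then obtain b where b: "b \<in> u" "\<And>v. v \<in> u \<Longrightarrow> D v = Cas b \<bullet> v"
    using inner_derivation[OF D(1-3)] by blast
  let ?s = "Cas b"
  have su: "?s \<in> u" using b Cas_u by blast
  obtain \<tau> where \<tau>: "\<And>v. v \<in> u \<Longrightarrow> \<tau> v \<in> u" "\<And>v. v \<in> u \<Longrightarrow> \<sigma> (\<tau> v) = v" using \<sigma>_inverse by metis
  have D\<sigma>: "D (\<sigma> v) = \<sigma> (D v)" if "v \<in> u" for v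
  proof (rule lp.linear_eq_on[OF endo_compose[OF D(1) endo_\<sigma>] endo_compose[OF endo_\<sigma> D(1)]])
    show "v \<in> span (\<Union>c. u \<inter> gen_eig ?f c)"
      using that gen_eigenvectors_span[OF endo_bracket subspace_u st] by blast
    fix w assume "w \<in> (\<Union>c. u \<inter> gen_eig ?f c)"
    then obtain c n where w: "w \<in> u" "w \<in> gen_eig ?f c" "(shift ?f c ^^ n) w = 0" by (auto simp: gen_eig_def)
    have "shift ?f c (\<sigma> v) = \<sigma> (shift ?f c v)" for v
      using \<sigma>_h[OF t] by (simp add: shift_def lp.linear_diff[OF endo_\<sigma>] lp.linear_scale[OF endo_\<sigma>] \<sigma>_bracket)
    then have "(shift ?f c ^^ n) (\<sigma> v) = \<sigma> ((shift ?f c ^^ n) v)" for v by (induction n) simp_all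
    then have "\<sigma> w \<in> gen_eig ?f c" using w by (auto simp: gen_eig_def lp.linear_0[OF endo_\<sigma>] intro!: exI[of _ n])
    then show "D (\<sigma> w) = \<sigma> (D w)" using w D(4) \<sigma>_u by (simp add: lp.linear_scale[OF endo_\<sigma>])
  qed
  have "\<sigma> ?s - ?s = 0"
  proof (rule Z_commutator)
    show "\<sigma> ?s - ?s \<in> Z"
    proof (rule ZI)
      show "\<sigma> ?s - ?s \<in> u" using su \<sigma>_u subspace_diff[OF subspace_u] by blast
      fix v assume v: "v \<in> u"
      have "\<sigma> ?s \<bullet> \<sigma> (\<tau> v) = \<sigma> (?s \<bullet> \<tau> v)" by (simp add: \<sigma>_bracket)
      also have "\<dots> = D (\<sigma> (\<tau> v))" by (metis D\<sigma> b(2) \<tau>(1) v)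
      finally show "(\<sigma> ?s - ?s) \<bullet> v = 0" using \<tau> v b by (simp add: bracket_diff)
    qed
    show "\<sigma> ?s - ?s \<in> commutator_space u u"
      using b Cas_commutator by (simp add: Cas_\<sigma>[symmetric] subspace_diff csubspace_commutator_space \<sigma>_u)
  qed
  then have s0: "?s \<in> u\<^sub>0" using su by (simp add: u0_iff)
  have sh: "?s \<bullet> y = 0" if "y \<in> h" for y
  proof -
    have "y \<in> gen_eig ?f 0" using nil_h[OF t] that by (auto simp: nil_on_gen_eig)
    then show ?thesis using D(4)[of y 0] b(2)[of y] h_u[OF that] by simp
  qed
  then have "?s \<in> h" using h_normalizer[OF s0] zero_h by simp
  then show ?thesis using that[of ?s] sh D(4) b(2) by metis
qed

section \<open>Commutativity and diagonal action of the Cartan subalgebra\<close>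

definition ss :: "'a \<Rightarrow> 'a"
  where "ss t = (SOME s. s \<in> h \<and> (\<forall>y\<in>h. s \<bullet> y = 0) \<and>
    (\<forall>c. \<forall>w\<in>u. w \<in> gen_eig (lie_bracket t) c \<longrightarrow> s \<bullet> w = cscale c w))"

lemma ss:
  assumes "t \<in> h"
  shows ss_h: "ss t \<in> h" and ss_bracket: "\<And>y. y \<in> h \<Longrightarrow> ss t \<bullet> y = 0"
    and ss_gen_eig: "\<And>c w. w \<in> u \<Longrightarrow> w \<in> gen_eig (lie_bracket t) c \<Longrightarrow> ss t \<bullet> w = cscale c w"
proof -
  have "\<exists>s. s \<in> h \<and> (\<forall>y\<in>h. s \<bullet> y = 0) \<and>
      (\<forall>c. \<forall>w\<in>u. w \<in> gen_eig (lie_bracket t) c \<longrightarrow> s \<bullet> w = cscale c w)"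
    using semisimple_part[OF assms] by metis
  from someI_ex[OF this, folded ss_def]
  show "ss t \<in> h" "\<And>y. y \<in> h \<Longrightarrow> ss t \<bullet> y = 0"
    "\<And>c w. w \<in> u \<Longrightarrow> w \<in> gen_eig (lie_bracket t) c \<Longrightarrow> ss t \<bullet> w = cscale c w" by blast+
qed

lemma bracket_ss: "t \<in> h \<Longrightarrow> y \<in> h \<Longrightarrow> y \<bullet> ss t = 0"
  using ss_bracket[of t y] bracket_swap[of y "ss t"] by simp

lemma gens_ad: "t \<in> h \<Longrightarrow> span (\<Union>c. u \<inter> gen_eig (lie_bracket t) c) = u"
  by (rule span_gen_eig[OF endo_bracket subspace_u]) (simp add: bracket_u h_u)

lemma nil_part:
  assumes t: "t \<in> h" shows "nil_on (lie_bracket (t - ss t)) u"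
proof -
  let ?f = "lie_bracket t" and ?n = "lie_bracket (t - ss t)"
  have "(\<Union>c. u \<inter> gen_eig ?f c) \<subseteq> gen_eig ?n 0"
  proof safe
    fix w c assume w: "w \<in> u" "w \<in> gen_eig ?f c"
    have st: "\<And>v. v \<in> u \<Longrightarrow> ?f v \<in> u" using bracket_u h_u t by blast
    have eq: "?n v = cscale 1 (shift ?f c v)" if "v \<in> u" "v \<in> gen_eig ?f c" for v
      using ss_gen_eig[OF t that] by (simp add: bracket_diff shift_def)
    show "w \<in> gen_eig ?n 0"
      by (rule gen_eig_proportional[of ?f u ?n c 1 w]) (fact endo_bracket subspace_u st eq w)+
  qed
  then have "span (\<Union>c. u \<inter> gen_eig ?f c) \<subseteq> gen_eig ?n 0"
    by (intro span_minimal subspace_gen_eig endo_bracket)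
  then show ?thesis using gens_ad[OF t] by (simp add: nil_on_gen_eig)
qed

text \<open>The two adjoint operators commute, so their product is nilpotent along with ad a and has
  trace 0.\<close>

lemma K_commuting_nil:
  assumes a: "a \<in> u" and b: "b \<in> u" and ab: "a \<bullet> b = 0" and nil: "nil_on (lie_bracket a) u"
  shows "K a b = 0"
proof -
  have com: "a \<bullet> (b \<bullet> z) = b \<bullet> (a \<bullet> z)" for z
    using bracket_leibniz[of a b z] ab by simp
  have com': "a \<bullet> (lie_bracket b ^^ n) z = (lie_bracket b ^^ n) (a \<bullet> z)" for n z
    by (induction n) (simp_all add: com)
  have pow: "((\<lambda>z. a \<bullet> (b \<bullet> z)) ^^ n) z = (lie_bracket b ^^ n) ((lie_bracket a ^^ n) z)" for n z
    by (induction n) (simp_all add: com com')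
  have "nil_on (\<lambda>z. a \<bullet> (b \<bullet> z)) u"
    using nil unfolding nil_on_def pow by (metis lp.linear_0[OF endo_pow[OF endo_bracket]])
  then show ?thesis
    unfolding K_def using a b
    by (intro tr_nil[OF endo_compose[OF endo_bracket endo_bracket]]) (simp_all add: bracket_u)
qed

lemma diag_on_ss:
  assumes t: "t \<in> h" shows "diag_on (lie_bracket (ss t)) u"
proof -
  have "(\<Union>c. u \<inter> gen_eig (lie_bracket t) c) \<subseteq> {v \<in> u. \<exists>c. ss t \<bullet> v = cscale c v}"
    using ss_gen_eig[OF t] by blast
  from span_mono[OF this] show ?thesis unfolding diag_on_def gens_ad[OF t] .
qed

text \<open>On the centralizer V of all \<open>ss t\<close> in the fixed point algebra, t acts as
  its nilpotent part. If V were larger than h, Engel's theorem on V / h would give a vector outside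
  h that normalizes h.\<close>

lemma ss_centralizer:
  assumes v: "v \<in> u\<^sub>0" "\<And>t. t \<in> h \<Longrightarrow> ss t \<bullet> v = 0"
  shows "v \<in> h"
proof (rule ccontr)
  assume vh: "v \<notin> h"
  let ?V = "{v \<in> u\<^sub>0. \<forall>t\<in>h. ss t \<bullet> v = 0}"
  have V: "subspace ?V"
    by (rule subspaceI) (auto simp: u0_iff zero_u bracket_bilinear lp.linear_0[OF endo_\<sigma>]
        lp.linear_add[OF endo_\<sigma>] lp.linear_scale[OF endo_\<sigma>] subspace_add subspace_scale subspace_u)
  have hV: "h \<subset> ?V"
    using h_u0 ss_bracket vh v by blast
  have st: "t \<bullet> w \<in> ?V" if "t \<in> h" "w \<in> ?V" for t w
  proof -
    have "ss t' \<bullet> (t \<bullet> w) = 0" if "t' \<in> h" for t'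
      using bracket_leibniz[of "ss t'" t w] ss_bracket that \<open>t \<in> h\<close> \<open>w \<in> ?V\<close> by simp
    then show ?thesis using that by (simp add: u0_iff bracket_u h_u \<sigma>_bracket \<sigma>_h)
  qed
  have nil: "\<exists>n. (lie_bracket t ^^ n) w \<in> h" if t: "t \<in> h" and w: "w \<in> ?V" for t w
  proof -
    have "(lie_bracket t ^^ n) w = (lie_bracket (t - ss t) ^^ n) w \<and> (lie_bracket t ^^ n) w \<in> ?V" for n
    proof (induction n)
      case (Suc n)
      let ?x = "(lie_bracket t ^^ n) w"
      from Suc have x: "?x \<in> ?V" and "(lie_bracket (t - ss t) ^^ n) w = ?x" by metis+
      then have "(lie_bracket (t - ss t) ^^ Suc n) w = t \<bullet> ?x - ss t \<bullet> ?x"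
        by (simp only: funpow.simps comp_apply bracket_diff)
      moreover have "ss t \<bullet> ?x = 0" using x t by blast
      moreover have "t \<bullet> ?x \<in> ?V" by (rule st[OF t x])
      ultimately show ?case by (simp only: funpow.simps comp_apply diff_zero simp_thms)
    qed (use w in simp)
    moreover obtain n where "(lie_bracket (t - ss t) ^^ n) w = 0"
      using nil_part[OF t] w by (auto simp: nil_on_def u0_iff)
    ultimately show ?thesis using zero_h by metis
  qed
  have "subalgebra h" using subspace_h h_bracket by (simp add: subalgebra_def)
  from engel[OF this nil_h V subspace_h hV st h_bracket nil]
  obtain w where w: "w \<in> ?V" "w \<notin> h" "\<And>x. x \<in> h \<Longrightarrow> x \<bullet> w \<in> h" by blast
  have "w \<bullet> y \<in> h" if "y \<in> h" for y
    using w(3)[OF that] bracket_swap[of w y] subspace_neg[OF subspace_h] by metis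
  then show False using h_normalizer[of w] w by blast
qed

lemma ss_joint_span:
  "u \<subseteq> span {v \<in> u. (\<exists>c. \<sigma> v = cscale c v) \<and> (\<forall>t\<in>h. \<exists>c. ss t \<bullet> v = cscale c v)}"
proof -
  let ?F = "insert \<sigma> ((\<lambda>t. lie_bracket (ss t)) ` h)"
  have "u \<subseteq> span {v \<in> u. \<forall>f\<in>?F. \<exists>c. f v = cscale c v}"
  proof (rule joint_diag[OF _ subspace_u])
    fix f g v assume fg: "f \<in> ?F" "g \<in> ?F"
    have "ss t \<bullet> (ss t' \<bullet> v) = ss t' \<bullet> (ss t \<bullet> v)" if "t \<in> h" "t' \<in> h" for t t'
      using bracket_leibniz[of "ss t" "ss t'" v] that ss_bracket ss_h by simp
    then show "f (g v) = g (f v)"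
      using fg ss_h by (auto simp: \<sigma>_bracket \<sigma>_h)
  qed (auto simp: endo_\<sigma> endo_bracket \<sigma>_u bracket_u h_u ss_h diag_\<sigma> diag_on_ss)
  then show ?thesis by simp
qed

text \<open>A joint eigenvector with trivial eigenvalues lies in h by \<open>ss_centralizer\<close>.
  Any other is \<open>K\<close>-orthogonal to c, by invariance under \<sigma> or under some
  \<open>ss t\<close>. So c lies in the radical of the Killing form.\<close>

lemma K_h_Z:
  assumes c: "c \<in> h" and Kc: "\<And>y. y \<in> h \<Longrightarrow> K c y = 0"
  shows "c \<in> Z"
proof (rule K_kernel_Z[OF h_u[OF c]])
  fix y assume "y \<in> u"
  then have "y \<in> span {v \<in> u. (\<exists>c. \<sigma> v = cscale c v) \<and> (\<forall>t\<in>h. \<exists>c. ss t \<bullet> v = cscale c v)}"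
    using ss_joint_span by blast
  then show "K c y = 0"
  proof (induction rule: span_induct_alt)
    case (step r w q)
    then obtain e where w: "w \<in> u" "\<sigma> w = cscale e w" "\<And>t. t \<in> h \<Longrightarrow> \<exists>c. ss t \<bullet> w = cscale c w" by blast
    have "K c w = 0"
    proof (cases "e = 1 \<and> (\<forall>t\<in>h. ss t \<bullet> w = 0)")
      case True
      then have "w \<in> h" using w by (intro ss_centralizer) (auto simp: u0_iff)
      then show ?thesis by (rule Kc)
    next
      case False
      then consider "e \<noteq> 1" | t \<mu> where "t \<in> h" "ss t \<bullet> w = cscale \<mu> w" "\<mu> \<noteq> 0"
        using w(3) by fastforce
      then show ?thesis
      proof cases
        case 1
        have "K c w = e * K c w"
          using K_\<sigma>[OF h_u[OF c] w(1)] \<sigma>_h[OF c] w(2) by (simp add: K_bilinear)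
        with 1 show ?thesis by simp
      next
        case 2
        have "\<mu> * K c w = K c (ss t \<bullet> w)" using 2 by (simp add: K_bilinear)
        also have "\<dots> = K (c \<bullet> ss t) w" using K_inv c 2 w ss_h h_u by simp
        also have "\<dots> = 0" using bracket_ss[OF 2(1) c] bilin_0[OF bilin_K] by simp
        finally show ?thesis using 2 by simp
      qed
    qed
    with step show ?case by (simp add: K_bilinear)
  qed (simp add: bilin_0[OF bilin_K])
qed

lemma K_diff: "K (x - y) z = K x z - K y z" "K z (x - y) = K z x - K z y"
  by (simp_all add: K_def bracket_diff tr_diff)

text \<open>Dropping nilpotent parts gives K c y = K (ss c) (ss y) = K c (ss y). This is 0 because c
  is a sum of brackets in h and \<open>ss y\<close> commutes with h. So c is central in
  \<open>u\<close> and in its derived algebra.\<close>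

lemma h_center_commutator:
  assumes c: "c \<in> h" "\<And>y. y \<in> h \<Longrightarrow> c \<bullet> y = 0" and cc: "c \<in> commutator_space h h"
  shows "c = 0"
proof (rule Z_commutator)
  have hd: "t - ss t \<in> h" if "t \<in> h" for t using that ss_h subspace_diff[OF subspace_h] by blast
  have n0: "K (t - ss t) y = 0" if "t \<in> h" "y \<in> h" "t \<bullet> y = 0" for t y
    using that by (intro K_commuting_nil nil_part) (simp_all add: h_u hd bracket_diff ss_bracket)
  show "c \<in> Z"
  proof (rule K_h_Z[OF c(1)])
    fix y assume y: "y \<in> h"
    have sy: "K c (ss y) = 0"
      using cc unfolding commutator_space_def
    proof (induction rule: span_induct_alt)
      case (step r p q)
      then obtain a b where "p = a \<bullet> b" "a \<in> h" "b \<in> h" by blast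
      then have "K p (ss y) = 0"
        using K_inv[of a b "ss y"] y by (simp add: h_u ss_h bracket_ss bilin_0[OF bilin_K])
      with step show ?case by (simp add: K_bilinear)
    qed (simp add: bilin_0[OF bilin_K])
    have "K c y = K (ss c) y" using n0[OF c(1) y c(2)[OF y]] by (simp add: K_diff)
    also have "\<dots> = K (ss c) (ss y)"
      using n0[OF y ss_h[OF c(1)]] bracket_ss[OF c(1) y] K_sym[of "ss c" "y - ss y"] c(1) y hd
      by (simp add: K_diff h_u ss_h)
    also have "\<dots> = K c (ss y)" using n0[OF c(1) ss_h[OF y] c(2)] y ss_h by (simp add: K_diff)
    finally show "K c y = 0" using sy by simp
  qed
  show "c \<in> commutator_space u u" using cc commutator_space_mono[of h u h u] h_u by blast
qed

lemma lower_central_h: "lower_central_series h n \<subseteq> h"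
proof (induction n)
  case (Suc n)
  then have "commutator_space h (lower_central_series h n) \<subseteq> h"
    by (intro commutator_space_least subspace_h h_bracket) auto
  then show ?case by simp
qed simp

lemma abelian_h:
  assumes "x \<in> h" "y \<in> h" shows "x \<bullet> y = 0"
proof -
  \<comment> \<open>Descends from a vanishing term: if the next term is zero, the present one is
    central in h and consists of commutators, so it is zero too.\<close>
  have "lower_central_series h (Suc 0) \<subseteq> {0}" if "lower_central_series h (Suc n) \<subseteq> {0}" for n
    using that
  proof (induction n)
    case (Suc n)
    have "c = 0" if c: "c \<in> lower_central_series h (Suc n)" for c
    proof (rule h_center_commutator)
      show "c \<in> h" using c lower_central_h by blast
      show "c \<in> commutator_space h h"
        using c commutator_space_mono[OF order_refl lower_central_h[of n]] by auto
      fix y assume "y \<in> h"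
      then have "y \<bullet> c \<in> lower_central_series h (Suc (Suc n))"
        using c by (simp add: bracket_in_commutator_space)
      then have "y \<bullet> c = 0" using Suc.prems by blast
      then show "c \<bullet> y = 0" using bracket_swap[of c y] by simp
    qed
    then show ?case using Suc.IH by blast
  qed
  moreover obtain n where n: "lower_central_series h n = {0}"
    using nilpotent_h by (auto simp: nilpotent_def)
  have "lower_central_series h (Suc n) \<subseteq> {0}"
    using n commutator_space_least[of "{0}" h "{0}"] by simp
  ultimately have "lower_central_series h (Suc 0) \<subseteq> {0}" by blast
  then show ?thesis using bracket_in_commutator_space[OF assms] by auto
qed

text \<open>With h abelian, nilpotent parts are \<open>K\<close>-orthogonal to h and hence central:
  t acts on \<open>u\<close> exactly as its semisimple part.\<close>

lemma nil_part_Z: "t \<in> h \<Longrightarrow> t - ss t \<in> Z"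
  using ss_h subspace_diff[OF subspace_h]
  by (intro K_h_Z K_commuting_nil nil_part) (simp_all add: h_u abelian_h)

lemma bracket_ss_eq: "t \<in> h \<Longrightarrow> v \<in> u \<Longrightarrow> ss t \<bullet> v = t \<bullet> v"
  using Z_bracket[OF nil_part_Z, of t v] by (simp add: bracket_diff)

lemma diag_on_h: "t \<in> h \<Longrightarrow> diag_on (lie_bracket t) u"
  using diag_on_ss[of t] by (simp add: diag_on_def bracket_ss_eq cong: conj_cong)

lemma h_centralizer: "v \<in> u\<^sub>0 \<Longrightarrow> (\<And>t. t \<in> h \<Longrightarrow> t \<bullet> v = 0) \<Longrightarrow> v \<in> h"
  by (rule ss_centralizer) (simp_all add: bracket_ss_eq u0_iff)

lemma joint_span:
  "u \<subseteq> span {v \<in> u. (\<exists>c. \<sigma> v = cscale c v) \<and> (\<exists>c. Cas v = cscale c v) \<and> (\<forall>t\<in>h. \<exists>c. t \<bullet> v = cscale c v)}"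
proof -
  let ?F = "insert \<sigma> (insert Cas (lie_bracket ` h))"
  have "u \<subseteq> span {v \<in> u. \<forall>f\<in>?F. \<exists>c. f v = cscale c v}"
  proof (rule joint_diag[OF _ subspace_u])
    fix f g v assume fg: "f \<in> ?F" "g \<in> ?F" "v \<in> u"
    have "t \<bullet> (t' \<bullet> v) = t' \<bullet> (t \<bullet> v)" if "t \<in> h" "t' \<in> h" for t t'
      using bracket_leibniz[of t t' v] that by (simp add: abelian_h)
    then show "f (g v) = g (f v)"
      using fg by (auto simp: \<sigma>_bracket \<sigma>_h Cas_\<sigma> Cas_bracket h_u)
  qed (auto simp: endo_\<sigma> endo_Cas endo_bracket \<sigma>_u Cas_u bracket_u h_u diag_\<sigma> diag_on_Cas diag_on_h)
  then show ?thesis by simp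
qed

end

section \<open>A basis of joint eigenvectors\<close>

lemma cis_eq_1_Ints:
  assumes "cis (2 * pi * r) = 1" shows "r \<in> \<int>"
proof -
  have "cos (2 * pi * r) = 1" using assms by (metis cis.sel(1) one_complex.sel(1))
  then obtain n :: int where "2 * pi * r = real_of_int n * 2 * pi" using cos_one_2pi_int by auto
  then have "r = real_of_int n" by simp
  then show ?thesis by simp
qed

lemma cis_eq_unique:
  assumes "cis (2 * pi * r) = cis (2 * pi * s)" "0 \<le> r" "r < 1" "0 \<le> s" "s < 1"
  shows "r = s"
proof -
  have "cis (2 * pi * (r - s)) = cis (2 * pi * r) / cis (2 * pi * s)"
    by (simp add: cis_divide right_diff_distrib)
  then have "r - s \<in> \<int>" using assms by (intro cis_eq_1_Ints) simp
  then obtain n :: int where "r - s = of_int n" by (auto elim: Ints_cases)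
  with assms have "-1 < real_of_int n" "real_of_int n < 1" by linarith+
  then have "n = 0" by linarith
  then show ?thesis using \<open>r - s = of_int n\<close> by simp
qed

lemma unit_cis:
  assumes "cmod c = 1" shows "\<exists>j. 0 \<le> j \<and> j < 1 \<and> c = cis (2 * pi * j)"
proof -
  define \<theta> where "\<theta> = Arg c"
  have \<theta>: "c = cis \<theta>" using rcis_cmod_Arg[of c] assms by (simp add: rcis_def \<theta>_def)
  show ?thesis
  proof (intro exI[of _ "frac (\<theta> / (2 * pi))"] conjI)
    show "c = cis (2 * pi * frac (\<theta> / (2 * pi)))"
      unfolding \<theta> frac_def using cis_multiple_2pi[of "of_int \<lfloor>\<theta> / (2 * pi)\<rfloor>"]
      by (simp add: right_diff_distrib flip: cis_divide)
  qed (simp_all add: frac_lt_1)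
qed

context twisted_lie
begin

definition X :: "'a set"
  where "X = (SOME X. basis X \<and> X \<subseteq> {v \<in> u. (\<exists>c. \<sigma> v = cscale c v) \<and> (\<exists>c. Cas v = cscale c v)
    \<and> (\<forall>t\<in>h. \<exists>c. t \<bullet> v = cscale c v)})"

lemma X: "basis X" "X \<subseteq> {v \<in> u. (\<exists>c. \<sigma> v = cscale c v) \<and> (\<exists>c. Cas v = cscale c v)
    \<and> (\<forall>t\<in>h. \<exists>c. t \<bullet> v = cscale c v)}"
proof -
  let ?S = "{v \<in> u. (\<exists>c. \<sigma> v = cscale c v) \<and> (\<exists>c. Cas v = cscale c v)
    \<and> (\<forall>t\<in>h. \<exists>c. t \<bullet> v = cscale c v)}"
  obtain Y where Y: "Y \<subseteq> ?S" "independent Y" "?S \<subseteq> span Y"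
    using maximal_independent_subset[of ?S] by blast
  have "u \<subseteq> span Y" using joint_span span_minimal[OF Y(3) subspace_span] by blast
  then have "span Y = u" using Y(1) by (intro span_subspace subspace_u) auto
  with Y have "basis Y \<and> Y \<subseteq> ?S" using basisI by blast
  from someI[of "\<lambda>X. basis X \<and> X \<subseteq> ?S", OF this]
  show "basis X" "X \<subseteq> ?S" unfolding X_def by blast+
qed

lemmas finite_X = basisD(1)[OF X(1)] and independent_X = basisD(2)[OF X(1)]
  and span_X = basisD(3)[OF X(1)] and X_u = basisD(4)[OF X(1)]

lemma X_nonzero: "x \<in> X \<Longrightarrow> x \<noteq> 0"
  using independent_X dependent_zero by blast

abbreviation d :: "'a \<Rightarrow> 'a"
  where "d \<equiv> dual X"

lemmas d_u = dual_in[OF X(1)] and B_d = B_dual[OF X(1)]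

definition jj :: "'a \<Rightarrow> real"
  where "jj x = (SOME j. 0 \<le> j \<and> j < 1 \<and> \<sigma> x = cscale (cis (2 * pi * j)) x)"

text \<open>Zero outside h, so that \<open>lam x\<close> belongs to \<open>dual_space h\<close> as
  it stands and weights can be compared as functions.\<close>

definition lam :: "'a \<Rightarrow> 'a \<Rightarrow> complex"
  where "lam x t = (if t \<in> h then SOME c. t \<bullet> x = cscale c x else 0)"

definition cc :: "'a \<Rightarrow> complex"
  where "cc x = (SOME c. Cas x = cscale (2 * c) x)"

lemma jj:
  assumes "x \<in> X" shows "0 \<le> jj x" "jj x < 1" "\<sigma> x = cscale (cis (2 * pi * jj x)) x"
proof -
  obtain c where c: "\<sigma> x = cscale c x" using X(2) assms by blast
  then have "cmod c = 1" using \<sigma>_unimodular X_nonzero[OF assms] by blast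
  then have "\<exists>j. 0 \<le> j \<and> j < 1 \<and> \<sigma> x = cscale (cis (2 * pi * j)) x" using unit_cis c by metis
  from someI_ex[OF this, folded jj_def]
  show "0 \<le> jj x" "jj x < 1" "\<sigma> x = cscale (cis (2 * pi * jj x)) x" by auto
qed

lemma lam: "x \<in> X \<Longrightarrow> t \<in> h \<Longrightarrow> t \<bullet> x = cscale (lam x t) x"
proof -
  assume "x \<in> X" "t \<in> h"
  then have "\<exists>c. t \<bullet> x = cscale c x" using X(2) by blast
  from someI_ex[OF this] show ?thesis using \<open>t \<in> h\<close> by (simp add: lam_def)
qed

lemma lam_outside: "t \<notin> h \<Longrightarrow> lam x t = 0"
  by (simp add: lam_def)

lemma cc: "x \<in> X \<Longrightarrow> Cas x = cscale (2 * cc x) x"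
proof -
  assume "x \<in> X"
  then obtain c where "Cas x = cscale c x" using X(2) by blast
  then have "Cas x = cscale (2 * (c / 2)) x" by simp
  then show ?thesis unfolding cc_def by (rule someI)
qed

lemma X_eqI: "v \<in> u \<Longrightarrow> w \<in> u \<Longrightarrow> (\<And>x. x \<in> X \<Longrightarrow> B x v = B x w) \<Longrightarrow> v = w"
proof (rule B_eqI)
  fix y assume *: "\<And>x. x \<in> X \<Longrightarrow> B x v = B x w" and "y \<in> u"
  then have "y \<in> span X" by (simp add: span_X)
  then have "B y v = B y w"
    by (induction rule: span_induct_alt) (simp_all add: B_0 B_bilinear *)
  then show "B v y = B w y" by (simp add: B_sym)
qed

lemma lam_dual_space: assumes "x \<in> X" shows "lam x \<in> dual_space h"
  unfolding dual_space_def
proof (intro CollectI conjI ballI allI impI)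
  fix s t assume st: "s \<in> h" "t \<in> h"
  have "cscale (lam x (s + t)) x = cscale (lam x s + lam x t) x"
    using lam[OF assms] st by (metis bracket_add_left scale_left_distrib subspace_add subspace_h)
  then show "lam x (s + t) = lam x s + lam x t" using X_nonzero[OF assms] by simp
next
  fix c t assume t: "t \<in> h"
  have "cscale (lam x (cscale c t)) x = cscale (c * lam x t) x"
    using lam[OF assms] t by (metis bracket_cscale_left scale_scale subspace_scale subspace_h)
  then show "lam x (cscale c t) = c * lam x t" using X_nonzero[OF assms] by simp
qed (rule lam_outside)

lemma d_bracket: assumes x: "x \<in> X" and t: "t \<in> h" shows "t \<bullet> d x = cscale (- lam x t) (d x)"
proof (rule X_eqI)
  show "t \<bullet> d x \<in> u" "cscale (- lam x t) (d x) \<in> u"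
    by (rule bracket_u[OF h_u[OF t] d_u[OF x]], rule subspace_scale[OF subspace_u d_u[OF x]])
  fix x' assume x': "x' \<in> X"
  have "B x' (t \<bullet> d x) = - B (t \<bullet> x') (d x)" by (simp add: B_skew)
  also have "\<dots> = - lam x' t * B x' (d x)" using lam[OF x' t] by (simp add: B_scale)
  also have "\<dots> = - lam x t * B x' (d x)" using B_d[OF x x'] by simp
  finally show "B x' (t \<bullet> d x) = B x' (cscale (- lam x t) (d x))" by (simp only: B_scale)
qed

lemma d_\<sigma>: assumes x: "x \<in> X" and j: "jj x = 0" shows "\<sigma> (d x) = d x"
proof (rule X_eqI)
  show "\<sigma> (d x) \<in> u" "d x \<in> u" using d_u[OF x] by (simp_all add: \<sigma>_u)
  fix x' assume x': "x' \<in> X"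
  have *: "cis (2 * pi * jj x') * B x' (\<sigma> (d x)) = B x' (d x)"
    using B_\<sigma>[of x' "d x"] jj(3)[OF x'] by (simp add: B_scale)
  show "B x' (\<sigma> (d x)) = B x' (d x)"
  proof (cases "x' = x")
    case True
    then show ?thesis using * j by simp
  next
    case False
    then show ?thesis using * B_d[OF x x'] by simp
  qed
qed

lemma weight_sum_0:
  assumes "x \<in> X" "y \<in> X" "B x y \<noteq> 0"
  shows "lam y = (\<lambda>t. - lam x t)" and "jj x = 0 \<and> jj y = 0 \<or> jj x + jj y = 1"
proof -
  show "lam y = (\<lambda>t. - lam x t)"
  proof
    fix t
    show "lam y t = - lam x t"
    proof (cases "t \<in> h")
      case True
      have "lam x t * B x y = - lam y t * B x y"
        using B_skew[of t x y] lam[OF _ True] assms by (simp add: B_scale)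
      then have "(lam y t + lam x t) * B x y = 0" by (simp add: distrib_right)
      then show ?thesis using assms by (simp add: eq_neg_iff_add_eq_0)
    qed (simp add: lam_outside)
  qed
  have "cis (2 * pi * (jj x + jj y)) * B x y = B x y"
    using B_\<sigma>[of x y] jj(3)[OF assms(1)] jj(3)[OF assms(2)]
    by (simp add: B_scale distrib_left cis_mult[symmetric] mult.assoc mult.left_commute)
  then have "jj x + jj y \<in> \<int>" using assms by (intro cis_eq_1_Ints) simp
  then obtain n :: int where n: "jj x + jj y = of_int n" by (auto elim: Ints_cases)
  with jj[OF assms(1)] jj[OF assms(2)] have "-1 < real_of_int n" "real_of_int n < 2" by linarith+
  then have "n = 0 \<or> n = 1" by linarith
  then show "jj x = 0 \<and> jj y = 0 \<or> jj x + jj y = 1"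
    using n jj[OF assms(1)] jj[OF assms(2)] by auto
qed

lemma weight_sum3_Ints:
  assumes "x \<in> X" "y \<in> X" "z \<in> X" "B (x \<bullet> y) z \<noteq> 0"
  shows "jj x + jj y + jj z \<in> \<int>"
proof -
  have "cis (2 * pi * (jj x + jj y + jj z)) * B (x \<bullet> y) z = B (\<sigma> x \<bullet> \<sigma> y) (\<sigma> z)"
    using jj(3)[OF assms(1)] jj(3)[OF assms(2)] jj(3)[OF assms(3)]
    by (simp add: B_scale bracket_bilinear distrib_left cis_mult[symmetric] mult.assoc mult.left_commute)
  also have "\<dots> = B (x \<bullet> y) z" by (simp add: B_\<sigma> flip: \<sigma>_bracket)
  finally show ?thesis using assms(4) by (intro cis_eq_1_Ints) simp
qed

section \<open>Eigenspaces counted by basis vectors\<close>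

lemma rep_eigen:
  assumes "endo f" "\<And>x. x \<in> X \<Longrightarrow> f x = cscale (e x) x" and "v \<in> u" "f v = cscale c v"
    and "representation X v x \<noteq> 0"
  shows "e x = c"
  by (rule eigen_representation[OF assms(1) independent_X assms(2), where n = 1])
    (use assms(3-) in \<open>simp_all add: span_X shift_def\<close>)

lemma rep_X: "representation X v x \<noteq> 0 \<Longrightarrow> x \<in> X"
  by (rule representation_ne_zero)

lemma rep_jj:
  assumes "v \<in> u" "\<sigma> v = cscale (cis (2 * pi * j)) v" "0 \<le> j" "j < 1" "representation X v x \<noteq> 0"
  shows "jj x = j"
proof -
  have "cis (2 * pi * jj x) = cis (2 * pi * j)"
    by (rule rep_eigen[OF endo_\<sigma> jj(3) assms(1,2,5)])
  then show ?thesis using cis_eq_unique jj rep_X assms by blast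
qed

lemma rep_lam:
  assumes "v \<in> u" "t \<in> h" "t \<bullet> v = cscale a v" "representation X v x \<noteq> 0"
  shows "lam x t = a"
  by (rule rep_eigen[where f = "lie_bracket t" and e = "\<lambda>x. lam x t", OF endo_bracket lam assms(1,3,4)])
    (use assms in auto)

lemma rep_cc:
  assumes "v \<in> u" "Cas v = cscale (2 * c) v" "representation X v x \<noteq> 0"
  shows "cc x = c"
  using rep_eigen[OF endo_Cas cc assms] by simp

lemma rep_nonzero: "v \<in> u \<Longrightarrow> v \<noteq> 0 \<Longrightarrow> \<exists>x\<in>X. representation X v x \<noteq> 0"
  using span_representation_subset[OF independent_X, of v "{}"] rep_X[of v]
  unfolding span_X span_empty by blast

text \<open>If the vectors of W have coordinates only at basis vectors with property Q, and these
  lie in W, they form a basis of W. Thus dimensions and nonvanishing of all eigenspaces become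
  statements about X.\<close>

lemma dim_eigen:
  assumes "\<And>x. x \<in> X \<Longrightarrow> Q x \<Longrightarrow> x \<in> W" and "W \<subseteq> u" "0 \<in> W"
    and "\<And>v x. v \<in> W \<Longrightarrow> representation X v x \<noteq> 0 \<Longrightarrow> Q x"
  shows "dim W = card {x \<in> X. Q x}" and "W \<noteq> {0} \<longleftrightarrow> (\<exists>x\<in>X. Q x)"
proof -
  have W: "W \<subseteq> span {x \<in> X. Q x}"
    using assms(2,4) span_representation_subset[OF independent_X] rep_X by (auto simp: span_X)
  then show "dim W = card {x \<in> X. Q x}"
    using assms(1) independent_mono[OF independent_X] by (intro dim_unique[of "{x \<in> X. Q x}"]) auto
  show "W \<noteq> {0} \<longleftrightarrow> (\<exists>x\<in>X. Q x)"
  proof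
    assume "W \<noteq> {0}"
    with assms(3) obtain v where "v \<in> W" "v \<noteq> 0" by blast
    then show "\<exists>x\<in>X. Q x" using rep_nonzero assms(2,4) by blast
  next
    assume "\<exists>x\<in>X. Q x"
    then show "W \<noteq> {0}" using assms(1) X_nonzero by blast
  qed
qed

lemma sigma_part_X:
  assumes "0 \<le> j" "j < 1"
  shows "sigma_part \<sigma> u j \<noteq> {0} \<longleftrightarrow> (\<exists>x\<in>X. jj x = j)"
proof -
  have 1: "x \<in> sigma_part \<sigma> u j" if "x \<in> X" "jj x = j" for x
    using that jj(3)[of x] X_u by (simp add: sigma_part_def)
  have 2: "jj x = j" if "v \<in> sigma_part \<sigma> u j" "representation X v x \<noteq> 0" for v x
    using that rep_jj[OF _ _ assms] unfolding sigma_part_def by blast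
  have 3: "sigma_part \<sigma> u j \<subseteq> u" "0 \<in> sigma_part \<sigma> u j"
    using zero_u by (auto simp: sigma_part_def lp.linear_0[OF endo_\<sigma>])
  show ?thesis by (rule dim_eigen(2)) (rule 1 3 2; assumption)+
qed

lemma weight_space_X:
  assumes "0 \<le> j" "j < 1" "\<alpha> \<in> dual_space h"
  shows "dim (weight_space (sigma_part \<sigma> u j) h \<alpha>) = card {x \<in> X. jj x = j \<and> lam x = \<alpha>}"
    and "weight_space (sigma_part \<sigma> u j) h \<alpha> \<noteq> {0} \<longleftrightarrow> (\<exists>x\<in>X. jj x = j \<and> lam x = \<alpha>)"
proof -
  let ?W = "weight_space (sigma_part \<sigma> u j) h \<alpha>"
  have 1: "x \<in> ?W" if "x \<in> X" "jj x = j \<and> lam x = \<alpha>" for x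
    using that jj(3)[of x] lam X_u by (auto simp: weight_space_def sigma_part_def)
  have 2: "jj x = j \<and> lam x = \<alpha>" if v: "v \<in> ?W" "representation X v x \<noteq> 0" for v x
  proof
    show "jj x = j" using rep_jj assms v by (auto simp: weight_space_def sigma_part_def)
    show "lam x = \<alpha>"
    proof
      fix t show "lam x t = \<alpha> t"
        using rep_lam[of v t "\<alpha> t" x] v assms(3) lam_outside
        by (cases "t \<in> h") (auto simp: weight_space_def sigma_part_def dual_space_def)
    qed
  qed
  have 3: "?W \<subseteq> u" "0 \<in> ?W"
    using zero_u by (auto simp: weight_space_def sigma_part_def lp.linear_0[OF endo_\<sigma>])
  show "dim ?W = card {x \<in> X. jj x = j \<and> lam x = \<alpha>}" "?W \<noteq> {0} \<longleftrightarrow> (\<exists>x\<in>X. jj x = j \<and> lam x = \<alpha>)"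
    by ((rule dim_eigen(1) dim_eigen(2)), (rule 1 3 2; assumption)+)+
qed

lemma weights_X: "0 \<le> j \<Longrightarrow> j < 1 \<Longrightarrow> weights (sigma_part \<sigma> u j) h = lam ` {x \<in> X. jj x = j}"
  using weight_space_X(2)[of j] lam_dual_space unfolding weights_def by blast

lemma X_h_iff: assumes "x \<in> X" shows "x \<in> h \<longleftrightarrow> jj x = 0 \<and> lam x = (\<lambda>t. 0)"
proof
  assume xh: "x \<in> h"
  have "jj x = 0"
    using cis_eq_unique[of "jj x" 0] jj[OF assms] \<sigma>_h[OF xh] X_nonzero[OF assms]
    by (metis cis_zero mult_zero_right order_refl scale_one scale_right_imp_eq zero_less_one scale_cancel_right)
  moreover have "lam x t = 0" for t
    using lam[OF assms, of t] abelian_h[OF _ xh, of t] X_nonzero[OF assms] lam_outside[of t x] by force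
  ultimately show "jj x = 0 \<and> lam x = (\<lambda>t. 0)" by auto
next
  assume *: "jj x = 0 \<and> lam x = (\<lambda>t. 0)"
  then show "x \<in> h"
    using lam[OF assms] jj(3)[OF assms] X_u[OF assms] by (intro h_centralizer) (simp_all add: u0_iff)
qed

lemma casimir_eigenspace_X:
  "dim (casimir_eigenspace B u c) = card {x \<in> X. cc x = c}"
  "casimir_eigenspace B u c \<noteq> {0} \<longleftrightarrow> (\<exists>x\<in>X. cc x = c)"
proof -
  let ?W = "casimir_eigenspace B u c"
  have W: "v \<in> ?W \<longleftrightarrow> v \<in> u \<and> Cas v = cscale (2 * c) v" for v
    by (simp add: casimir_eigenspace_def Cas_def)
  have 1: "x \<in> ?W" if "x \<in> X" "cc x = c" for x
    using that cc[of x] X_u by (simp add: W)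
  have 2: "cc x = c" if "v \<in> ?W" "representation X v x \<noteq> 0" for v x
    using that rep_cc unfolding W by blast
  have 3: "?W \<subseteq> u" "0 \<in> ?W"
    using zero_u by (auto simp: W lp.linear_0[OF endo_Cas])
  show "dim ?W = card {x \<in> X. cc x = c}" "?W \<noteq> {0} \<longleftrightarrow> (\<exists>x\<in>X. cc x = c)"
    by ((rule dim_eigen(1) dim_eigen(2)), (rule 1 3 2; assumption)+)+
qed

lemma sigma_casimir_X:
  assumes "0 \<le> j" "j < 1"
  shows "dim (sigma_part \<sigma> (casimir_eigenspace B u c) j) = card {x \<in> X. cc x = c \<and> jj x = j}"
    and "sigma_part \<sigma> (casimir_eigenspace B u c) j \<noteq> {0} \<longleftrightarrow> (\<exists>x\<in>X. cc x = c \<and> jj x = j)"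
proof -
  let ?W = "sigma_part \<sigma> (casimir_eigenspace B u c) j"
  have W: "v \<in> ?W \<longleftrightarrow> v \<in> u \<and> Cas v = cscale (2 * c) v \<and> \<sigma> v = cscale (cis (2 * pi * j)) v" for v
    by (simp add: casimir_eigenspace_def Cas_def sigma_part_def)
  have 1: "x \<in> ?W" if "x \<in> X" "cc x = c \<and> jj x = j" for x
    using that cc[of x] jj(3)[of x] X_u by (simp add: W)
  have 2: "cc x = c \<and> jj x = j" if "v \<in> ?W" "representation X v x \<noteq> 0" for v x
    using that rep_cc rep_jj[OF _ _ assms] unfolding W by blast
  have 3: "?W \<subseteq> u" "0 \<in> ?W"
    using zero_u by (auto simp: W lp.linear_0[OF endo_Cas] lp.linear_0[OF endo_\<sigma>])
  show "dim ?W = card {x \<in> X. cc x = c \<and> jj x = j}" "?W \<noteq> {0} \<longleftrightarrow> (\<exists>x\<in>X. cc x = c \<and> jj x = j)"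
    by ((rule dim_eigen(1) dim_eigen(2)), (rule 1 3 2; assumption)+)+
qed

lemma casimir_half_eigenvalues_X: "casimir_half_eigenvalues B u = cc ` X"
  unfolding casimir_half_eigenvalues_def casimir_eigenspace_X(2) by blast

lemma z_sigma_X:
  "z_sigma \<sigma> (casimir_eigenspace B u c) = (1/2) * (\<Sum>x\<in>{x \<in> X. cc x = c}. jj x * (1 - jj x) / 2)"
proof -
  let ?Y = "{x \<in> X. cc x = c}"
  have J: "{j. 0 \<le> j \<and> j < 1 \<and> sigma_part \<sigma> (casimir_eigenspace B u c) j \<noteq> {0}} = jj ` ?Y"
    using sigma_casimir_X(2) jj by auto
  have "(\<Sum>x\<in>?Y. jj x * (1 - jj x) / 2) = (\<Sum>j\<in>jj ` ?Y. \<Sum>x\<in>{x \<in> ?Y. jj x = j}. jj x * (1 - jj x) / 2)"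
    using finite_X by (intro sum.image_gen) simp
  also have "\<dots> = (\<Sum>j\<in>jj ` ?Y. j * (1 - j) / 2 * real (dim (sigma_part \<sigma> (casimir_eigenspace B u c) j)))"
  proof (rule sum.cong[OF refl])
    fix j assume "j \<in> jj ` ?Y"
    then have j: "0 \<le> j" "j < 1" using jj by auto
    have "{x \<in> ?Y. jj x = j} = {x \<in> X. cc x = c \<and> jj x = j}" by blast
    then show "(\<Sum>x\<in>{x \<in> ?Y. jj x = j}. jj x * (1 - jj x) / 2)
        = j * (1 - j) / 2 * real (dim (sigma_part \<sigma> (casimir_eigenspace B u c) j))"
      by (simp add: sigma_casimir_X(1)[OF j])
  qed
  finally show ?thesis by (simp add: z_sigma_def J)
qed

text \<open>The weight \<open>c/12 - c j(1 - j)/2\<close> is \<open>c/2\<close> times the Bernoulli polynomial \<open>j\<^sup>2 - j + 1/6\<close>.\<close>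

lemma casimir_sum_X:
  "(\<Sum>c\<in>casimir_half_eigenvalues B u. c / 12 * of_nat (dim (casimir_eigenspace B u c))
      - 2 * c * complex_of_real (z_sigma \<sigma> (casimir_eigenspace B u c)))
   = (1/4) * (\<Sum>x\<in>X. complex_of_real ((jj x)\<^sup>2 - jj x + 1/6) * (2 * cc x))"
proof -
  have "(\<Sum>x\<in>X. complex_of_real ((jj x)\<^sup>2 - jj x + 1/6) * (2 * cc x))
      = (\<Sum>c\<in>cc ` X. \<Sum>x\<in>{x \<in> X. cc x = c}. complex_of_real ((jj x)\<^sup>2 - jj x + 1/6) * (2 * cc x))"
    by (rule sum.image_gen[OF finite_X])
  also have "\<dots> = (\<Sum>c\<in>cc ` X. 4 * (c / 12 * of_nat (dim (casimir_eigenspace B u c))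
      - 2 * c * complex_of_real (z_sigma \<sigma> (casimir_eigenspace B u c))))"
  proof (rule sum.cong[OF refl])
    fix c
    let ?Y = "{x \<in> X. cc x = c}"
    have "(\<Sum>x\<in>?Y. complex_of_real ((jj x)\<^sup>2 - jj x + 1/6) * (2 * cc x))
        = (\<Sum>x\<in>?Y. c / 3 - 2 * c * complex_of_real (jj x * (1 - jj x)))"
      by (rule sum.cong[OF refl]) (auto simp: field_simps power2_eq_square)
    also have "\<dots> = c / 3 * of_nat (card ?Y) - 2 * c * complex_of_real (\<Sum>x\<in>?Y. jj x * (1 - jj x))"
      by (simp add: sum_subtractf sum_distrib_left)
    also have "(\<Sum>x\<in>?Y. jj x * (1 - jj x)) = 2 * (\<Sum>x\<in>?Y. jj x * (1 - jj x) / 2)"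
      by (simp add: sum_divide_distrib[symmetric])
    also have "\<dots> = 4 * z_sigma \<sigma> (casimir_eigenspace B u c)" by (simp add: z_sigma_X)
    finally show "(\<Sum>x\<in>?Y. complex_of_real ((jj x)\<^sup>2 - jj x + 1/6) * (2 * cc x))
        = 4 * (c / 12 * of_nat (dim (casimir_eigenspace B u c))
          - 2 * c * complex_of_real (z_sigma \<sigma> (casimir_eigenspace B u c)))"
      by (simp add: casimir_eigenspace_X(1) algebra_simps)
  qed
  also have "\<dots> = 4 * (\<Sum>c\<in>cc ` X. c / 12 * of_nat (dim (casimir_eigenspace B u c))
      - 2 * c * complex_of_real (z_sigma \<sigma> (casimir_eigenspace B u c)))"
    by (rule sum_distrib_left[symmetric])
  finally have T: "(\<Sum>x\<in>X. complex_of_real ((jj x)\<^sup>2 - jj x + 1/6) * (2 * cc x))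
      = 4 * (\<Sum>c\<in>cc ` X. c / 12 * of_nat (dim (casimir_eigenspace B u c))
        - 2 * c * complex_of_real (z_sigma \<sigma> (casimir_eigenspace B u c)))" .
  have quarter: "s = (1/4) * t" if "t = 4 * s" for s t :: complex using that by simp
  show ?thesis unfolding casimir_half_eigenvalues_X by (rule quarter[OF T])
qed

text \<open>A basis vector outside h has a nonzero index or a nonzero weight and is orthogonal to h
  by invariance under \<sigma> or under h, so nondegeneracy passes from \<open>u\<close> to
  h.\<close>

lemma B_h_nondeg:
  assumes t: "t \<in> h" and "\<And>y. y \<in> h \<Longrightarrow> B t y = 0"
  shows "t = 0"
proof (rule X_eqI[OF h_u[OF t] zero_u])
  fix x assume x: "x \<in> X"
  have "B t x = 0"
  proof (cases "x \<in> h")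
    case False
    then consider "jj x \<noteq> 0" | s where "s \<in> h" "lam x s \<noteq> 0"
      using X_h_iff[OF x] lam_outside by blast
    then show ?thesis
    proof cases
      case 1
      have "cis (2 * pi * jj x) * B t x = B t x"
        using B_\<sigma>[of t x] \<sigma>_h[OF t] jj(3)[OF x] by (simp add: B_scale)
      moreover have "cis (2 * pi * jj x) \<noteq> 1"
        using cis_eq_unique[of "jj x" 0] jj[OF x] 1 by auto
      ultimately show ?thesis by simp
    next
      case 2
      have "lam x s * B t x = B t (s \<bullet> x)" using lam[OF x 2(1)] by (simp add: B_scale)
      also have "\<dots> = B (t \<bullet> s) x" by (simp add: B_inv)
      also have "\<dots> = 0" using abelian_h[OF t 2(1)] by (simp add: B_0)
      finally show ?thesis using 2 by simp
    qed
  qed (rule assms(2))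
  then show "B x t = B x 0" by (simp add: B_sym B_0)
qed

lemma bracket_d_h: assumes "x \<in> X" shows "x \<bullet> d x \<in> h"
proof (rule h_centralizer)
  have "B x' (\<sigma> (d x)) = B x' (cscale (cis (- (2 * pi * jj x))) (d x))" if x': "x' \<in> X" for x'
  proof -
    have "cis (2 * pi * jj x') * B x' (\<sigma> (d x)) = B x' (d x)"
      using B_\<sigma>[of x' "d x"] jj(3)[OF x'] by (simp add: B_scale)
    then have "B x' (\<sigma> (d x)) = inverse (cis (2 * pi * jj x')) * B x' (d x)"
      by (simp add: field_simps)
    then show ?thesis using B_d[OF assms x'] by (auto simp: B_scale)
  qed
  then have "\<sigma> (d x) = cscale (cis (- (2 * pi * jj x))) (d x)"
    using d_u[OF assms] by (intro X_eqI) (simp_all add: \<sigma>_u subspace_scale subspace_u)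
  then show "x \<bullet> d x \<in> u\<^sub>0"
    using jj(3)[OF assms] X_u[OF assms] d_u[OF assms]
    by (simp add: u0_iff bracket_u \<sigma>_bracket bracket_bilinear cis_mult)
  fix t assume t: "t \<in> h"
  show "t \<bullet> (x \<bullet> d x) = 0"
    using bracket_leibniz[of t x "d x"] lam[OF assms t] d_bracket[OF assms t]
    by (simp add: bracket_bilinear scale_left_distrib[symmetric] bracket_minus)
qed

text \<open>Identifies \<open>x \<bullet> d x\<close> as the vector of h representing the weight of
  x, which turns sums of weights into sums of brackets.\<close>

lemma B_bracket_d: assumes "x \<in> X" "t \<in> h" shows "B (x \<bullet> d x) t = lam x t"
proof -
  have "B (x \<bullet> d x) t = B x (d x \<bullet> t)" by (rule B_inv)
  also have "\<dots> = lam x t"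
    using bracket_swap[of "d x" t] d_bracket[OF assms] B_d[OF assms(1) assms(1)]
    by (simp add: B_minus B_scale)
  finally show ?thesis .
qed

end

section \<open>Roots of the fixed point algebra\<close>

context twisted_lie
begin

lemma bracket_weight:
  "t \<bullet> y = cscale b y \<Longrightarrow> t \<bullet> v = cscale a v \<Longrightarrow> t \<bullet> (y \<bullet> v) = cscale (b + a) (y \<bullet> v)"
  by (simp only: bracket_leibniz[of t y v] bracket_cscale_left bracket_cscale_right cscale_left_distrib)

lemma no_infinite_weights:
  assumes t: "t \<in> h" and b: "b \<noteq> 0" and w: "\<And>n. w n \<in> u" "\<And>n. w n \<noteq> 0"
    and ww: "\<And>n. t \<bullet> w n = cscale (a + of_nat n * b) (w n)"
  shows False
proof -
  have "a + of_nat n * b \<in> (\<lambda>x. lam x t) ` X" for n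
  proof -
    obtain x where x: "x \<in> X" "representation X (w n) x \<noteq> 0" using rep_nonzero[OF w] by blast
    then have "lam x t = a + of_nat n * b" using rep_lam[OF w(1) t ww] by blast
    then show ?thesis using x(1) by (metis image_eqI)
  qed
  then have "range (\<lambda>n. a + of_nat n * b) \<subseteq> (\<lambda>x. lam x t) ` X" by blast
  then have fin: "finite (range (\<lambda>n. a + of_nat n * b))"
    using finite_X finite_subset by blast
  have "inj (\<lambda>n. a + of_nat n * b)" using b by (auto simp: inj_def)
  then show False using finite_imageD[OF fin] infinite_UNIV_nat by blast
qed

text \<open>Starting from a vector killed by \<open>x\<close>, the powers of \<open>ad y\<close> would produce infinitely many
  weights: \<open>x\<close> maps \<open>y\<^sup>n v\<close> back to a nonzero multiple of \<open>y\<^sup>n\<^sup>-\<^sup>1 v\<close>.\<close>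

lemma no_infinite_string:
  assumes x: "\<And>t. t \<in> h \<Longrightarrow> t \<bullet> y = cscale (- \<alpha> t) y" and yu: "y \<in> u" and v: "v \<in> u" "v \<noteq> 0"
    and xy: "x \<bullet> y \<in> h" and xv: "x \<bullet> v = 0" and \<mu>: "\<And>t. t \<in> h \<Longrightarrow> t \<bullet> v = cscale (\<mu> t) v"
    and t0: "t0 \<in> h" "\<alpha> t0 \<noteq> 0"
    and nz: "\<And>n. of_nat (Suc n) * \<mu> (x \<bullet> y) - of_nat (n * Suc n) / 2 * \<alpha> (x \<bullet> y) \<noteq> 0"
  shows False
proof -
  define w where "w n = (lie_bracket y ^^ n) v" for n
  have w_Suc: "w (Suc n) = y \<bullet> w n" for n by (simp add: w_def)
  have wu: "w n \<in> u" for n by (induction n) (simp_all add: w_Suc bracket_u yu, simp add: w_def v)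
  have ww: "t \<bullet> w n = cscale (\<mu> t - of_nat n * \<alpha> t) (w n)" if t: "t \<in> h" for t n
  proof (induction n)
    case 0
    then show ?case using \<mu>[OF t] by (simp add: w_def)
  next
    case (Suc n)
    have "- \<alpha> t + (\<mu> t - of_nat n * \<alpha> t) = \<mu> t - of_nat (Suc n) * \<alpha> t"
      by (simp add: algebra_simps)
    then show ?case using bracket_weight[OF x[OF t] Suc] by (simp only: w_Suc)
  qed
  \<comment> \<open>The sum of (\<mu> - i \<alpha>) at \<open>x \<bullet> y\<close> over i = 0, ...,
    n, collected when x is moved past the n + 1 factors y.\<close>
  let ?k = "\<lambda>n. of_nat (Suc n) * \<mu> (x \<bullet> y) - of_nat (n * Suc n) / 2 * \<alpha> (x \<bullet> y)"
  have lower: "x \<bullet> w (Suc n) = cscale (?k n) (w n)" for n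
  proof (induction n)
    case 0
    have "x \<bullet> w (Suc 0) = (x \<bullet> y) \<bullet> v + y \<bullet> (x \<bullet> v)"
      using bracket_leibniz[of x y v] by (simp add: w_def)
    then show ?case using \<mu>[OF xy] xv by (simp add: w_def)
  next
    case (Suc n)
    have "x \<bullet> w (Suc (Suc n)) = (x \<bullet> y) \<bullet> w (Suc n) + y \<bullet> (x \<bullet> w (Suc n))"
      using bracket_leibniz[of x y "w (Suc n)"] by (simp only: w_Suc[of "Suc n"])
    also have "\<dots> = cscale (\<mu> (x \<bullet> y) - of_nat (Suc n) * \<alpha> (x \<bullet> y)) (w (Suc n)) + cscale (?k n) (w (Suc n))"
      unfolding ww[OF xy] Suc by (simp only: bracket_cscale_right w_Suc)
    also have "\<dots> = cscale (\<mu> (x \<bullet> y) - of_nat (Suc n) * \<alpha> (x \<bullet> y) + ?k n) (w (Suc n))"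
      by (simp only: scale_left_distrib)
    also have "\<mu> (x \<bullet> y) - of_nat (Suc n) * \<alpha> (x \<bullet> y) + ?k n = ?k (Suc n)"
      by (simp add: field_simps)
    finally show ?case .
  qed
  have wnz: "w n \<noteq> 0" for n
  proof (induction n)
    case (Suc n)
    show ?case
    proof
      assume "w (Suc n) = 0"
      then have "cscale (?k n) (w n) = 0" using lower[of n] by simp
      then show False using nz[of n] Suc by simp
    qed
  qed (simp add: w_def v)
  show False
    using no_infinite_weights[OF t0(1), of "- \<alpha> t0" w "\<mu> t0"] t0 wu wnz ww[OF t0(1)] by simp
qed

section \<open>Root spaces of the fixed point algebra are lines\<close>

lemma zero_not_root: "(\<lambda>t. 0) \<notin> roots v h"
  by (simp add: roots_def)

lemma roots_X: "\<alpha> \<in> roots u\<^sub>0 h \<longleftrightarrow> \<alpha> \<noteq> (\<lambda>t. 0) \<and> (\<exists>x\<in>X. jj x = 0 \<and> lam x = \<alpha>)"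
  using weights_X[of 0] by (auto simp: roots_def)

text \<open>Half sums of roots ignore multiplicity while X counts it; this lemma reconciles them at
  index 0. For two vectors with root \<alpha>, y = \<open>d x1\<close> kills x2, and raising x2 by
  x1 would never end: y undoes each step up to the factor -(n + 1)(n + 2)/2
  \<alpha>(\<tau>).\<close>

lemma root_space_unique:
  assumes x1: "x1 \<in> X" "jj x1 = 0" and x2: "x2 \<in> X" "jj x2 = 0"
    and eq: "lam x1 = lam x2" and nz: "lam x1 \<noteq> (\<lambda>t. 0)"
  shows "x1 = x2"
proof (rule ccontr)
  assume ne: "x1 \<noteq> x2"
  define \<alpha> where "\<alpha> = lam x1"
  define y where "y = d x1"
  define \<tau> where "\<tau> = x1 \<bullet> y"
  obtain t0 where t0: "t0 \<in> h" "\<alpha> t0 \<noteq> 0" using nz lam_outside unfolding \<alpha>_def by blast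
  have yu: "y \<in> u" and x1u: "x1 \<in> u" and x2u: "x2 \<in> u" using d_u x1 x2 X_u by (auto simp: y_def)
  have y\<sigma>: "\<sigma> y = y" using d_\<sigma> x1 by (simp add: y_def)
  have yw: "t \<bullet> y = cscale (- \<alpha> t) y" if "t \<in> h" for t using d_bracket[OF x1(1) that] by (simp add: y_def \<alpha>_def)
  have By: "B x1 y = 1" "B x2 y = 0" using B_d x1 x2 ne by (auto simp: y_def)
  have \<tau>h: "\<tau> \<in> h" unfolding \<tau>_def y_def by (rule bracket_d_h[OF x1(1)])
  have B\<tau>: "B \<tau> t = \<alpha> t" if "t \<in> h" for t
    unfolding \<tau>_def y_def \<alpha>_def by (rule B_bracket_d[OF x1(1) that])
  have x2w: "t \<bullet> x2 = cscale (\<alpha> t) x2" if "t \<in> h" for t using lam[OF x2(1) that] eq by (simp add: \<alpha>_def)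
  have x1w: "t \<bullet> x1 = cscale (\<alpha> t) x1" if "t \<in> h" for t using lam[OF x1(1) that] by (simp add: \<alpha>_def)
  have x2yh: "x2 \<bullet> y \<in> h"
  proof (rule h_centralizer)
    show "x2 \<bullet> y \<in> u\<^sub>0" using jj(3)[OF x2(1)] x2 x2u yu y\<sigma> by (simp add: u0_iff bracket_u \<sigma>_bracket)
    fix t assume t: "t \<in> h"
    show "t \<bullet> (x2 \<bullet> y) = 0"
      using bracket_leibniz[of t x2 y] x2w[OF t] yw[OF t] by (simp add: bracket_bilinear bracket_minus)
  qed
  \<comment> \<open>Paired with t, this element of h gives \<alpha>(t) times B x2 y, which is 0
    since y is dual to x1.\<close>
  have "x2 \<bullet> y = 0"
  proof (rule B_h_nondeg[OF x2yh])
    fix t assume t: "t \<in> h"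
    have "B (x2 \<bullet> y) t = - B x2 (t \<bullet> y)" using bracket_swap[of y t] by (simp add: B_inv B_minus)
    then show "B (x2 \<bullet> y) t = 0" using yw[OF t] By by (simp add: B_scale B_minus)
  qed
  then have yx2: "y \<bullet> x2 = 0" using bracket_swap[of y x2] by simp
  have neg\<alpha>: "t \<bullet> x1 = cscale (- (- \<alpha> t)) x1" if "t \<in> h" for t using x1w[OF that] by simp
  \<comment> \<open>Otherwise \<tau> would act as zero on \<open>u\<close>; being a bracket, it
    would vanish, although it represents \<alpha>.\<close>
  have \<alpha>\<tau>: "\<alpha> \<tau> \<noteq> 0"
  proof
    assume 0: "\<alpha> \<tau> = 0"
    have lam0: "lam w \<tau> = 0" if w: "w \<in> X" for w
    proof (rule ccontr)
      assume lw: "lam w \<tau> \<noteq> 0"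
      \<comment> \<open>\<open>x1\<close>, \<open>y\<close> act on the string through \<open>w\<close> as a Heisenberg pair.\<close>
      define v where "v n = (lie_bracket x1 ^^ n) w" for n
      have vu: "v n \<in> u" for n by (induction n) (simp_all add: v_def bracket_u x1u X_u w)
      have vw: "t \<bullet> v n = cscale (lam w t + of_nat n * \<alpha> t) (v n)" if t: "t \<in> h" for t n
      proof (induction n)
        case 0
        then show ?case using lam[OF w t] by (simp add: v_def)
      next
        case (Suc n)
        have "\<alpha> t + (lam w t + of_nat n * \<alpha> t) = lam w t + of_nat (Suc n) * \<alpha> t"
          by (simp add: algebra_simps)
        then show ?case using bracket_weight[OF x1w[OF t] Suc] by (simp only: v_def funpow.simps comp_apply)
      qed
      have "\<exists>n. v n = 0"
      proof (rule ccontr)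
        assume "\<nexists>n. v n = 0"
        then show False using no_infinite_weights[OF t0(1,2) vu _ vw[OF t0(1)]] by blast
      qed
      then obtain n where "(lie_bracket x1 ^^ n) w \<in> {0}" by (auto simp: v_def)
      then obtain k where k: "v k \<noteq> 0" "x1 \<bullet> v k = 0"
        using nil_escape[of n "lie_bracket x1" w "{0}"] X_nonzero[OF w] unfolding v_def by blast
      \<comment> \<open>With \<alpha>(\<tau>) = 0 the coefficients of the string reduce to (n + 1)
        times \<open>lam w \<tau>\<close> and never vanish.\<close>
      show False
      proof (rule no_infinite_string[of y \<alpha> "v k" x1 "\<lambda>t. lam w t + of_nat k * \<alpha> t" t0])
        fix n
        show "of_nat (Suc n) * (lam w (x1 \<bullet> y) + of_nat k * \<alpha> (x1 \<bullet> y))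
            - of_nat (n * Suc n) / 2 * \<alpha> (x1 \<bullet> y) \<noteq> 0"
          using lw 0 by (simp add: \<tau>_def[symmetric] del: of_nat_Suc)
      qed (use yw yu vu k vw t0 \<tau>h in \<open>simp_all add: \<tau>_def\<close>)
    qed
    have "\<tau> = 0"
    proof (rule Z_commutator)
      show "\<tau> \<in> commutator_space u u" unfolding \<tau>_def by (rule bracket_in_commutator_space[OF x1u yu])
      show "\<tau> \<in> Z"
      proof (rule ZI[OF h_u[OF \<tau>h]])
        fix v assume "v \<in> u"
        then have "v \<in> span X" by (simp add: span_X)
        then show "\<tau> \<bullet> v = 0"
          by (induction rule: span_induct_alt) (simp_all add: bracket_bilinear lam[OF _ \<tau>h] lam0)
      qed
    qed
    then show False using B\<tau>[OF t0(1)] t0 by (simp add: B_0)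
  qed
  have y1: "y \<bullet> x1 = - \<tau>" using bracket_swap[of y x1] by (simp add: \<tau>_def)
  have \<alpha>neg: "\<alpha> (- \<tau>) = - \<alpha> \<tau>"
    using B\<tau>[of "- \<tau>"] B\<tau>[OF \<tau>h] subspace_neg[OF subspace_h \<tau>h] by (simp add: B_minus)
  show False
  proof (rule no_infinite_string[of x1 "\<lambda>t. - \<alpha> t" x2 y \<alpha> t0])
    fix n
    have "of_nat (Suc n) * \<alpha> (y \<bullet> x1) - of_nat (n * Suc n) / 2 * - \<alpha> (y \<bullet> x1)
        = - (of_nat (2 * Suc n + n * Suc n) / 2) * \<alpha> \<tau>"
      by (simp add: y1 \<alpha>neg field_simps)
    also have "\<dots> \<noteq> 0" using \<alpha>\<tau> of_nat_eq_0_iff[of "2 * Suc n + n * Suc n", where ?'a = complex] by simp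
    finally show "of_nat (Suc n) * \<alpha> (y \<bullet> x1) - of_nat (n * Suc n) / 2 * - \<alpha> (y \<bullet> x1) \<noteq> 0" .
  next
    show "y \<bullet> x1 \<in> h" using subspace_neg[OF subspace_h \<tau>h] by (simp add: y1)
  qed (use neg\<alpha> x1u x2u X_nonzero[OF x2(1)] yx2 x2w t0 in auto)
qed

lemma weight_space_X_mem: "x \<in> X \<Longrightarrow> jj x = 0 \<Longrightarrow> x \<in> weight_space u\<^sub>0 h (lam x)"
  using jj(3)[of x] X_u lam by (simp add: weight_space_def u0_iff)

lemma weight_space_d_mem: "x \<in> X \<Longrightarrow> jj x = 0 \<Longrightarrow> d x \<in> weight_space u\<^sub>0 h (\<lambda>t. - lam x t)"
  using d_\<sigma>[of x] d_u d_bracket by (simp add: weight_space_def u0_iff)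

end

section \<open>The norm formula for one algebra\<close>

lemma sum_rotate:
  "(\<Sum>x\<in>A. \<Sum>y\<in>B. \<Sum>z\<in>C. F x y z) = (\<Sum>y\<in>B. \<Sum>z\<in>C. \<Sum>x\<in>A. F x y z)"
proof -
  have "(\<Sum>x\<in>A. \<Sum>y\<in>B. \<Sum>z\<in>C. F x y z) = (\<Sum>y\<in>B. \<Sum>x\<in>A. \<Sum>z\<in>C. F x y z)" by (rule sum.swap)
  also have "\<dots> = (\<Sum>y\<in>B. \<Sum>z\<in>C. \<Sum>x\<in>A. F x y z)" by (rule sum.cong[OF refl], rule sum.swap)
  finally show ?thesis .
qed

text \<open>Additivity of positive roots appears only as \<open>P_triple\<close>, a condition on
  root vectors. In this form it passes to a subalgebra whose positive root vectors are sums of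
  ambient positive root vectors.\<close>

locale positive_lie = twisted_lie +
  fixes P :: "('a \<Rightarrow> complex) set"
  assumes P_roots: "P \<subseteq> roots u\<^sub>0 h"
    and P_sign: "\<And>\<alpha>. \<alpha> \<in> roots u\<^sub>0 h \<Longrightarrow> (\<alpha> \<in> P) \<noteq> ((\<lambda>t. - \<alpha> t) \<in> P)"
    and P_triple: "\<And>\<alpha> \<beta> \<gamma> x y z. \<alpha> \<in> P \<Longrightarrow> \<beta> \<in> P \<Longrightarrow> \<gamma> \<in> P \<Longrightarrow> x \<in> weight_space u\<^sub>0 h \<alpha> \<Longrightarrow>
      y \<in> weight_space u\<^sub>0 h \<beta> \<Longrightarrow> z \<in> weight_space u\<^sub>0 h \<gamma> \<Longrightarrow> B (x \<bullet> y) z = 0"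
begin

text \<open>\<open>b + 1/2\<close> is the index \<open>j\<close>, except that positive roots of \<open>u\<^sub>0\<close> count as \<open>j = 0\<close> and negative
  ones as \<open>j = 1\<close>: this is the limit of a small perturbation of \<open>\<sigma>\<close> along \<open>h\<close>.\<close>

definition b :: "'a \<Rightarrow> real"
  where "b x = (if jj x \<noteq> 0 then jj x - 1/2 else if lam x \<in> P then - 1/2 else if x \<in> h then 0 else 1/2)"

lemma not_P_h: "x \<in> X \<Longrightarrow> x \<in> h \<Longrightarrow> lam x \<notin> P"
  using P_roots zero_not_root X_h_iff by auto

lemma b_h: "x \<in> X \<Longrightarrow> x \<in> h \<Longrightarrow> b x = 0"
  using not_P_h X_h_iff by (simp add: b_def)

lemma negative_root: "x \<in> X \<Longrightarrow> jj x = 0 \<Longrightarrow> x \<notin> h \<Longrightarrow> (lam x \<in> P) \<noteq> ((\<lambda>t. - lam x t) \<in> P)"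
  using P_sign roots_X X_h_iff by blast

lemma b_neg:
  assumes xy: "x \<in> X" "y \<in> X" "B x y \<noteq> 0"
  shows "b x = - b y"
proof (cases "jj x = 0")
  case False
  then have "jj x + jj y = 1" using weight_sum_0(2)[OF xy] by simp
  moreover have "jj y \<noteq> 0" using calculation jj(2)[OF xy(1)] by auto
  ultimately show ?thesis using False by (simp add: b_def)
next
  case True
  then have y0: "jj y = 0" using weight_sum_0(2)[OF xy] jj(2)[OF xy(2)] by auto
  have ly: "lam y = (\<lambda>t. - lam x t)" by (rule weight_sum_0(1)[OF xy])
  have hh: "x \<in> h \<longleftrightarrow> y \<in> h" using X_h_iff xy True y0 ly by (auto simp: fun_eq_iff)
  show ?thesis
  proof (cases "x \<in> h")
    case True
    then show ?thesis using b_h hh xy by simp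
  next
    case False
    then show ?thesis using negative_root[OF xy(1) True False] hh True y0 ly by (auto simp: b_def)
  qed
qed

text \<open>The coefficient of \<open>lam x\<close> in \<open>rho_sigma\<close>: half of 1 - 2j,
  restricted at j = 0 to positive roots.\<close>

definition \<psi> :: "'a \<Rightarrow> real"
  where "\<psi> x = (if jj x = 0 then (if lam x \<in> P then 1/2 else 0)
    else if jj x \<le> 1/2 then (1 - 2 * jj x) / 2 else 0)"

text \<open>The value of \<open>\<psi>\<close> transported to the dual vector, which has index 1 - j
  (or 0) and the opposite weight.\<close>

definition \<psi>' :: "'a \<Rightarrow> real"
  where "\<psi>' x = (if jj x = 0 then (if (\<lambda>t. - lam x t) \<in> P then 1/2 else 0)
    else if 1/2 \<le> jj x then (2 * jj x - 1) / 2 else 0)"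

lemma \<psi>_dual:
  assumes xy: "x \<in> X" "y \<in> X" "B x y \<noteq> 0"
  shows "\<psi> x = \<psi>' y"
proof -
  have "lam y = (\<lambda>t. - lam x t)" by (rule weight_sum_0(1)[OF xy])
  then have "(\<lambda>t. - lam y t) = lam x" by auto
  then show ?thesis
    using weight_sum_0(2)[OF xy] jj(1,2)[OF xy(1)] jj(1,2)[OF xy(2)]
    by (auto simp: \<psi>_def \<psi>'_def field_simps)
qed

text \<open>Antisymmetrizing removes the cutoff at j = 1/2: both halves of the range give the same
  linear function 1/2 - j.\<close>

lemma \<psi>_diff: assumes "x \<in> X" shows "\<psi> x - \<psi>' x = - b x"
proof (cases "x \<in> h")
  case True
  then show ?thesis
    using X_h_iff[OF assms] not_P_h[OF assms] by (simp add: \<psi>_def \<psi>'_def b_def)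
next
  case False
  then show ?thesis using negative_root[OF assms] by (auto simp: \<psi>_def \<psi>'_def b_def field_simps)
qed

section \<open>The Weyl vector in the joint eigenbasis\<close>

lemma half_sum_roots_X:
  "half_sum_roots P t = (\<Sum>x\<in>{x \<in> X. jj x = 0}. (if lam x \<in> P then 1/2 else 0) * lam x t)"
proof -
  let ?Y = "{x \<in> X. jj x = 0 \<and> lam x \<in> P}"
  have inj: "inj_on lam ?Y"
  proof (rule inj_onI)
    fix x y assume x: "x \<in> ?Y" and y: "y \<in> ?Y" and eq: "lam x = lam y"
    have "lam x \<noteq> (\<lambda>t. 0)" using x P_roots zero_not_root by auto
    then show "x = y" using root_space_unique[of x y] x y eq by blast
  qed
  have img: "lam ` ?Y = P"
  proof
    show "P \<subseteq> lam ` ?Y"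
    proof
      fix \<alpha> assume \<alpha>: "\<alpha> \<in> P"
      then obtain x where "x \<in> X" "jj x = 0" "lam x = \<alpha>" using P_roots roots_X by blast
      then show "\<alpha> \<in> lam ` ?Y" using \<alpha> by (intro image_eqI[of _ _ x]) auto
    qed
  qed blast
  have *: "(\<Sum>\<alpha>\<in>P. \<alpha> t) = (\<Sum>x\<in>?Y. lam x t)"
    using sum.reindex[OF inj, of "\<lambda>\<alpha>. \<alpha> t"] unfolding img by (simp only: o_def)
  have "half_sum_roots P t = (\<Sum>x\<in>?Y. (if lam x \<in> P then 1/2 else 0) * lam x t)"
    unfolding half_sum_roots_def * by (simp add: sum_distrib_left)
  also have "\<dots> = (\<Sum>x\<in>{x \<in> X. jj x = 0}. (if lam x \<in> P then 1/2 else 0) * lam x t)"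
  proof (rule sum.mono_neutral_left)
    show "finite {x \<in> X. jj x = 0}" using finite_X by simp
    show "\<forall>x\<in>{x \<in> X. jj x = 0} - ?Y. (if lam x \<in> P then 1/2 else 0) * lam x t = 0" by simp
  qed blast
  finally show ?thesis .
qed

lemma half_sum_weights_X:
  assumes j: "0 \<le> j" "j < 1"
  shows "half_sum_weights (sigma_part \<sigma> u j) h t = (\<Sum>x\<in>{x \<in> X. jj x = j}. (1/2) * lam x t)"
proof -
  let ?Y = "{x \<in> X. jj x = j}"
  have "(\<Sum>\<alpha>\<in>weights (sigma_part \<sigma> u j) h. of_nat (dim (weight_space (sigma_part \<sigma> u j) h \<alpha>)) * \<alpha> t)
      = (\<Sum>\<alpha>\<in>lam ` ?Y. \<Sum>x\<in>{x \<in> ?Y. lam x = \<alpha>}. lam x t)"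
    unfolding weights_X[OF j]
  proof (rule sum.cong[OF refl])
    fix \<alpha> assume "\<alpha> \<in> lam ` ?Y"
    then have "\<alpha> \<in> dual_space h" using lam_dual_space by auto
    then have "dim (weight_space (sigma_part \<sigma> u j) h \<alpha>) = card {x \<in> X. jj x = j \<and> lam x = \<alpha>}"
      by (rule weight_space_X(1)[OF j])
    also have "{x \<in> X. jj x = j \<and> lam x = \<alpha>} = {x \<in> ?Y. lam x = \<alpha>}" by blast
    finally show "of_nat (dim (weight_space (sigma_part \<sigma> u j) h \<alpha>)) * \<alpha> t = (\<Sum>x\<in>{x \<in> ?Y. lam x = \<alpha>}. lam x t)"
      by simp
  qed
  also have "\<dots> = (\<Sum>x\<in>?Y. lam x t)"
    using finite_X by (intro sum.image_gen[symmetric]) simp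
  finally have *: "(\<Sum>\<alpha>\<in>weights (sigma_part \<sigma> u j) h.
      of_nat (dim (weight_space (sigma_part \<sigma> u j) h \<alpha>)) * \<alpha> t) = (\<Sum>x\<in>?Y. lam x t)" .
  show ?thesis unfolding half_sum_weights_def * by (rule sum_distrib_left)
qed

lemma rho_sigma_\<psi>: "rho_sigma \<sigma> u h P t = (\<Sum>x\<in>X. complex_of_real (\<psi> x) * lam x t)"
proof -
  let ?Y = "{x \<in> X. jj x \<le> 1/2}"
  have J: "{j. 0 \<le> j \<and> j \<le> 1/2 \<and> sigma_part \<sigma> u j \<noteq> {0}} = jj ` ?Y"
  proof (rule set_eqI)
    fix j
    have "sigma_part \<sigma> u j \<noteq> {0} \<longleftrightarrow> (\<exists>x\<in>X. jj x = j)" if "0 \<le> j" "j \<le> 1/2"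
      using that by (intro sigma_part_X) auto
    then show "j \<in> {j. 0 \<le> j \<and> j \<le> 1/2 \<and> sigma_part \<sigma> u j \<noteq> {0}} \<longleftrightarrow> j \<in> jj ` ?Y"
      using jj(1) by auto
  qed
  have "(\<Sum>x\<in>X. complex_of_real (\<psi> x) * lam x t) = (\<Sum>x\<in>?Y. complex_of_real (\<psi> x) * lam x t)"
    using finite_X by (intro sum.mono_neutral_right) (auto simp: \<psi>_def)
  also have "\<dots> = (\<Sum>j\<in>jj ` ?Y. \<Sum>x\<in>{x \<in> ?Y. jj x = j}. complex_of_real (\<psi> x) * lam x t)"
    using finite_X by (intro sum.image_gen) simp
  also have "\<dots> = (\<Sum>j\<in>jj ` ?Y. complex_of_real (1 - 2 * j) * rho_part \<sigma> u h P j t)"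
  proof (rule sum.cong[OF refl])
    fix j assume "j \<in> jj ` ?Y"
    then have j: "0 \<le> j" "j < 1" "j \<le> 1/2" using jj by auto
    have Y: "{x \<in> ?Y. jj x = j} = {x \<in> X. jj x = j}" using j by auto
    show "(\<Sum>x\<in>{x \<in> ?Y. jj x = j}. complex_of_real (\<psi> x) * lam x t)
        = complex_of_real (1 - 2 * j) * rho_part \<sigma> u h P j t"
    proof (cases "j = 0")
      case True
      then show ?thesis
        unfolding Y by (simp add: rho_part_def half_sum_roots_X) (rule sum.cong, auto simp: \<psi>_def)
    next
      case False
      then show ?thesis
        unfolding Y rho_part_def using j
        by (simp add: half_sum_weights_X sum_distrib_left) (rule sum.cong, auto simp: \<psi>_def)
    qed
  qed
  finally show ?thesis unfolding rho_sigma_def J by (rule sym)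
qed

definition R :: 'a
  where "R = cscale (- 1/2) (\<Sum>x\<in>X. cscale (complex_of_real (b x)) (x \<bullet> d x))"

lemma R_h: "R \<in> h"
  unfolding R_def using bracket_d_h by (intro subspace_scale subspace_sum subspace_h)

lemma lam_B: "x \<in> X \<Longrightarrow> t \<in> h \<Longrightarrow> lam x t = B (t \<bullet> x) (d x)"
  using lam[of x t] B_d[of x x] by (simp add: B_scale)

text \<open>Exchanging basis and dual basis turns the sum with \<open>\<psi>\<close> into minus the
  sum with \<open>\<psi>'\<close>, so twice the sum is the one with
  \<open>\<psi> - \<psi>' = - b\<close>. This is the source of the factor -1/2 in
  \<open>R\<close>.\<close>

lemma B_R: assumes t: "t \<in> h" shows "B R t = rho_sigma \<sigma> u h P t"
proof -
  let ?S = "\<lambda>\<phi>. \<Sum>x\<in>X. complex_of_real (\<phi> x) * lam x t"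
  have bl: "bilin (\<lambda>x y. B (t \<bullet> x) y)" by (simp add: bilin_def bracket_bilinear B_bilinear)
  have "?S \<psi> = (\<Sum>x\<in>X. complex_of_real (\<psi> x) * B (t \<bullet> x) (d x))"
    using t by (simp add: lam_B)
  also have "\<dots> = (\<Sum>x\<in>X. complex_of_real (\<psi>' x) * B (t \<bullet> d x) x)"
    using \<psi>_dual by (intro tensor_swap[OF X(1) bl]) auto
  also have "\<dots> = - ?S \<psi>'"
    unfolding sum_negf[symmetric]
  proof (rule sum.cong[OF refl])
    fix x assume "x \<in> X"
    then show "complex_of_real (\<psi>' x) * B (t \<bullet> d x) x = - (complex_of_real (\<psi>' x) * lam x t)"
      using t B_sym[of "d x"] by (simp add: lam_B B_skew[of t "d x"])
  qed
  finally have "2 * ?S \<psi> = ?S \<psi> - ?S \<psi>'" by simp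
  also have "\<dots> = (\<Sum>x\<in>X. complex_of_real (\<psi> x - \<psi>' x) * lam x t)"
    by (simp add: sum_subtractf left_diff_distrib)
  also have "\<dots> = - ?S b" using \<psi>_diff by (simp add: sum_negf)
  finally have "2 * ?S \<psi> = - ?S b" .
  moreover have "p = - 1/2 * q" if "2 * p = - q" for p q :: complex
    using that by (simp add: field_simps)
  ultimately have "?S \<psi> = - 1/2 * ?S b" by blast
  moreover have "B R t = - 1/2 * ?S b"
  proof -
    have "B R t = - 1/2 * (\<Sum>x\<in>X. complex_of_real (b x) * B (x \<bullet> d x) t)"
      by (simp only: R_def B_scale B_sum)
    then show ?thesis using t B_bracket_d by simp
  qed
  ultimately show ?thesis by (simp add: rho_sigma_\<psi>)
qed

lemma dual_norm_sq_R: "dual_norm_sq B h (rho_sigma \<sigma> u h P) = B R R"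
proof -
  have "form_representative B h (rho_sigma \<sigma> u h P) = R"
    unfolding form_representative_def
  proof (rule the_equality)
    show "R \<in> h \<and> (\<forall>t\<in>h. B R t = rho_sigma \<sigma> u h P t)" using R_h B_R by blast
    fix s assume s: "s \<in> h \<and> (\<forall>t\<in>h. B s t = rho_sigma \<sigma> u h P t)"
    then have "s - R \<in> h" using R_h subspace_diff[OF subspace_h] by blast
    moreover have "B (s - R) t = 0" if "t \<in> h" for t using s B_R that by (simp add: B_diff)
    ultimately have "s - R = 0" by (rule B_h_nondeg)
    then show "s = R" by simp
  qed
  then show ?thesis by (simp add: dual_norm_sq_def dual_form_def)
qed

section \<open>The symmetric array\<close>

definition c3 :: "'a \<Rightarrow> 'a \<Rightarrow> 'a \<Rightarrow> complex"
  where "c3 x y z = B (x \<bullet> y) z"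

text \<open>Both factors are alternating, so the product is totally symmetric. With this sign the
  Casimir eigenvalues are plain sums in \<open>Cas_\<tau>3\<close>.\<close>

definition \<tau>3 :: "'a \<Rightarrow> 'a \<Rightarrow> 'a \<Rightarrow> complex"
  where "\<tau>3 x y z = - (c3 x y z * c3 (d x) (d y) (d z))"

lemma c3_cycle: "c3 x y z = c3 y z x"
  using B_inv[of x y z] B_sym[of x "y \<bullet> z"] by (simp add: c3_def)

lemma c3_skew: "c3 x y z = - c3 y x z"
  using bracket_swap[of x y] by (simp add: c3_def B_minus)

lemma \<tau>3_cycle: "\<tau>3 x y z = \<tau>3 y z x"
  using c3_cycle[of x y z] c3_cycle[of "d x" "d y" "d z"] by (simp add: \<tau>3_def)

lemma \<tau>3_sym: "\<tau>3 x y z = \<tau>3 y x z"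
  using c3_skew[of x y z] c3_skew[of "d x" "d y" "d z"] by (simp add: \<tau>3_def)

lemma B_c3: "x \<in> u \<Longrightarrow> y \<in> u \<Longrightarrow> B (x \<bullet> y) (x' \<bullet> y') = (\<Sum>z\<in>X. c3 x y z * c3 x' y' (d z))"
  using B_expand[OF X(1) bracket_u[of x y], of "x' \<bullet> y'"] by (simp add: c3_def B_sym)

text \<open>The Jacobi identity splits the product of \<open>x \<bullet> d x\<close> and
  \<open>y \<bullet> d y\<close> into two terms. As \<open>b\<close> is odd under duality,
  exchanging x with its dual makes their weighted sums equal up to sign, so they add; doubling the
  1/4 from \<open>R\<close> gives 1/2.\<close>

lemma norm_R_\<tau>3:
  "B R R = - 1/2 * (\<Sum>x\<in>X. \<Sum>y\<in>X. \<Sum>z\<in>X. complex_of_real (b x * b y) * \<tau>3 x y z)"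
proof -
  let ?b = "\<lambda>x. complex_of_real (b x)"
  have br: "B (x \<bullet> d x) (y \<bullet> d y)
      = (\<Sum>z\<in>X. c3 x y z * c3 (d x) (d y) (d z)) - (\<Sum>z\<in>X. c3 (d x) y z * c3 x (d y) (d z))"
    if xy: "x \<in> X" "y \<in> X" for x y
  proof -
    have "B (x \<bullet> d x) (y \<bullet> d y) = B ((x \<bullet> d x) \<bullet> y) (d y)" by (simp add: B_inv)
    also have "(x \<bullet> d x) \<bullet> y = x \<bullet> (d x \<bullet> y) - d x \<bullet> (x \<bullet> y)"
      using bracket_leibniz[of x "d x" y] by simp
    also have "B \<dots> (d y) = B (x \<bullet> y) (d x \<bullet> d y) - B (d x \<bullet> y) (x \<bullet> d y)"
      by (simp add: B_diff B_skew)
    finally show ?thesis using xy X_u d_u by (simp add: B_c3)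
  qed
  have swap: "(\<Sum>x\<in>X. ?b x * (c3 (d x) y z * c3 x y' z')) = - (\<Sum>x\<in>X. ?b x * (c3 x y z * c3 (d x) y' z'))"
    for y z y' z'
  proof -
    have "bilin (\<lambda>p q. c3 p y z * c3 q y' z')"
      by (simp add: bilin_def c3_def bracket_bilinear B_bilinear algebra_simps)
    from tensor_swap[OF X(1) this, of "\<lambda>x. - ?b x" ?b]
    have "(\<Sum>x\<in>X. - ?b x * (c3 x y z * c3 (d x) y' z')) = (\<Sum>x\<in>X. ?b x * (c3 (d x) y z * c3 x y' z'))"
      using b_neg by fastforce
    then show ?thesis by (simp add: sum_negf)
  qed
  have "(\<Sum>x\<in>X. \<Sum>y\<in>X. ?b x * ?b y * B (x \<bullet> d x) (y \<bullet> d y))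
      = (\<Sum>y\<in>X. \<Sum>z\<in>X. ?b y * (\<Sum>x\<in>X. ?b x * (c3 x y z * c3 (d x) (d y) (d z))))
        - (\<Sum>y\<in>X. \<Sum>z\<in>X. ?b y * (\<Sum>x\<in>X. ?b x * (c3 (d x) y z * c3 x (d y) (d z))))"
  proof -
    have "(\<Sum>x\<in>X. \<Sum>y\<in>X. ?b x * ?b y * B (x \<bullet> d x) (y \<bullet> d y))
      = (\<Sum>x\<in>X. \<Sum>y\<in>X. \<Sum>z\<in>X. ?b y * (?b x * (c3 x y z * c3 (d x) (d y) (d z)))
          - ?b y * (?b x * (c3 (d x) y z * c3 x (d y) (d z))))"
      by (intro sum.cong refl)
        (simp add: br sum_subtractf sum_distrib_left right_diff_distrib mult.assoc mult.left_commute)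
    also have "\<dots> = (\<Sum>y\<in>X. \<Sum>z\<in>X. \<Sum>x\<in>X. ?b y * (?b x * (c3 x y z * c3 (d x) (d y) (d z)))
          - ?b y * (?b x * (c3 (d x) y z * c3 x (d y) (d z))))"
      by (rule sum_rotate)
    finally show ?thesis by (simp add: sum_subtractf sum_distrib_left)
  qed
  also have "\<dots> = 2 * (\<Sum>y\<in>X. \<Sum>z\<in>X. ?b y * (\<Sum>x\<in>X. ?b x * (c3 x y z * c3 (d x) (d y) (d z))))"
    unfolding swap by (simp add: sum_negf)
  also have "(\<Sum>y\<in>X. \<Sum>z\<in>X. ?b y * (\<Sum>x\<in>X. ?b x * (c3 x y z * c3 (d x) (d y) (d z))))
      = (\<Sum>y\<in>X. \<Sum>z\<in>X. \<Sum>x\<in>X. - (complex_of_real (b x * b y) * \<tau>3 x y z))"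
    unfolding sum_distrib_left \<tau>3_def by (intro sum.cong refl) simp
  also have "\<dots> = (\<Sum>x\<in>X. \<Sum>y\<in>X. \<Sum>z\<in>X. - (complex_of_real (b x * b y) * \<tau>3 x y z))"
    by (rule sum_rotate[symmetric])
  finally have *: "(\<Sum>x\<in>X. \<Sum>y\<in>X. ?b x * ?b y * B (x \<bullet> d x) (y \<bullet> d y))
      = - 2 * (\<Sum>x\<in>X. \<Sum>y\<in>X. \<Sum>z\<in>X. complex_of_real (b x * b y) * \<tau>3 x y z)"
    by (simp add: sum_negf)
  have "B R R = 1/4 * (\<Sum>x\<in>X. \<Sum>y\<in>X. ?b x * ?b y * B (x \<bullet> d x) (y \<bullet> d y))"
  proof -
    define S where "S = (\<Sum>x\<in>X. cscale (?b x) (x \<bullet> d x))"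
    have "B R R = - 1/2 * (- 1/2 * B S S)" by (simp only: R_def S_def B_scale)
    moreover have "B S S = (\<Sum>x\<in>X. \<Sum>y\<in>X. ?b x * ?b y * B (x \<bullet> d x) (y \<bullet> d y))"
      by (simp only: S_def B_sum(1)) (simp only: B_sum(2) B_scale mult.assoc mult.left_commute)
    ultimately show ?thesis by simp
  qed
  then show ?thesis unfolding * by simp
qed

lemma Cas_\<tau>3:
  assumes x: "x \<in> X" shows "2 * cc x = (\<Sum>y\<in>X. \<Sum>z\<in>X. \<tau>3 x y z)"
proof -
  have "2 * cc x = B (Cas x) (d x)" using cc[OF x] B_d[OF x x] by (simp add: B_scale)
  also have "\<dots> = (\<Sum>y\<in>X. B (y \<bullet> (d y \<bullet> x)) (d x))" by (rule B_Cas_basis[OF X(1)])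
  also have "\<dots> = (\<Sum>y\<in>X. \<Sum>z\<in>X. - (c3 (d y) x z * c3 y (d x) (d z)))"
  proof (rule sum.cong[OF refl])
    fix y assume y: "y \<in> X"
    have "B (y \<bullet> (d y \<bullet> x)) (d x) = - B (d y \<bullet> x) (y \<bullet> d x)" by (rule B_skew)
    also have "\<dots> = - (\<Sum>z\<in>X. c3 (d y) x z * c3 y (d x) (d z))"
      by (simp only: B_c3[OF d_u[OF y] X_u[OF x]])
    finally show "B (y \<bullet> (d y \<bullet> x)) (d x) = (\<Sum>z\<in>X. - (c3 (d y) x z * c3 y (d x) (d z)))"
      by (simp only: sum_negf)
  qed
  also have "\<dots> = (\<Sum>z\<in>X. - (\<Sum>y\<in>X. c3 (d y) x z * c3 y (d x) (d z)))"
    by (subst sum.swap) (simp add: sum_negf)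
  also have "\<dots> = (\<Sum>z\<in>X. - (\<Sum>y\<in>X. c3 y x z * c3 (d y) (d x) (d z)))"
  proof -
    have "(\<Sum>y\<in>X. c3 y x z * c3 (d y) (d x) (d z)) = (\<Sum>y\<in>X. c3 (d y) x z * c3 y (d x) (d z))" for z
    proof -
      have "bilin (\<lambda>p q. c3 p x z * c3 q (d x) (d z))"
        by (simp add: bilin_def c3_def bracket_bilinear B_bilinear algebra_simps)
      from tensor_swap[OF X(1) this, of "\<lambda>_. 1" "\<lambda>_. 1"] show ?thesis by simp
    qed
    then show ?thesis by simp
  qed
  also have "\<dots> = (\<Sum>z\<in>X. \<Sum>y\<in>X. \<tau>3 y x z)" by (simp add: \<tau>3_def sum_negf)
  also have "\<dots> = (\<Sum>y\<in>X. \<Sum>z\<in>X. \<tau>3 x y z)"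
    by (subst sum.swap) (simp add: \<tau>3_sym)
  finally show ?thesis .
qed

section \<open>The termwise identity\<close>

definition B2 :: "'a \<Rightarrow> real"
  where "B2 x = (jj x)\<^sup>2 - jj x + 1/6"

text \<open>Since 0 and 1 give the same value 1/6, the shifted index of a root may replace its
  index. Only h, with b = 0 at index 0, needs a separate clause.\<close>

lemma B2_b: assumes "x \<in> X" shows "B2 x = (if x \<in> h then 1/6 else (b x)\<^sup>2 - 1/12)"
  using X_h_iff[OF assms] by (auto simp: B2_def b_def power2_eq_square algebra_simps)

text \<open>For x in h the structure constant is a weight of y times B y z, so y and z are outside h
  with opposite b. Both sides are then twice the square of b y, as 1/6 cancels two times
  1/12.\<close>

lemma termwise_h:
  assumes xyz: "x \<in> X" "y \<in> X" "z \<in> X" and t: "\<tau>3 x y z \<noteq> 0" and x: "x \<in> h"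
  shows "B2 x + B2 y + B2 z = - 2 * (b x * b y + b y * b z + b z * b x)"
proof -
  have "c3 x y z = lam y x * B y z" using lam[OF xyz(2) x] by (simp add: c3_def B_scale)
  with t have nz: "lam y x \<noteq> 0" "B y z \<noteq> 0" by (auto simp: \<tau>3_def)
  have yh: "y \<notin> h" using nz X_h_iff[OF xyz(2)] by auto
  moreover have "z \<notin> h" using nz X_h_iff[OF xyz(3)] weight_sum_0(1)[OF xyz(2,3) nz(2)] by (auto simp: fun_eq_iff)
  moreover have "b y = - b z" using b_neg xyz nz by blast
  moreover have "b x = 0" using b_h xyz x by blast
  ultimately show ?thesis using x xyz by (simp add: B2_b power2_eq_square)
qed

lemma termwise:
  assumes xyz: "x \<in> X" "y \<in> X" "z \<in> X" and t: "\<tau>3 x y z \<noteq> 0"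
  shows "B2 x + B2 y + B2 z = - 2 * (b x * b y + b y * b z + b z * b x)"
proof (cases "x \<in> h \<or> y \<in> h \<or> z \<in> h")
  case True
  then show ?thesis
    using termwise_h[OF xyz t] termwise_h[OF xyz(2,3,1)] termwise_h[OF xyz(3,1,2)] t
      \<tau>3_cycle[of x y z] \<tau>3_cycle[of y z x] by (auto simp: algebra_simps)
next
  case False
  have c: "c3 x y z \<noteq> 0" "c3 (d x) (d y) (d z) \<noteq> 0" using t by (auto simp: \<tau>3_def)
  define n where "n = (b x + 1/2) + (b y + 1/2) + (b z + 1/2)"
  have b01: "0 \<le> b w + 1/2" "b w + 1/2 \<le> 1" "b w + 1/2 - jj w \<in> \<int>"
    "b w + 1/2 = 0 \<Longrightarrow> jj w = 0 \<and> lam w \<in> P" "b w + 1/2 = 1 \<Longrightarrow> jj w = 0 \<and> lam w \<notin> P"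
    if "w \<in> X" "w \<notin> h" for w
    using jj(1,2)[OF that(1)] that(2) by (auto simp: b_def split: if_splits)
  have "jj x + jj y + jj z \<in> \<int>" using weight_sum3_Ints xyz c by (simp add: c3_def)
  \<comment> \<open>The shifted indices differ from the true ones by integers, so their sum is an
    integer as well.\<close>
  then have "(jj x + jj y + jj z) + (b x + 1/2 - jj x) + (b y + 1/2 - jj y) + (b z + 1/2 - jj z) \<in> \<int>"
    using Ints_add[OF Ints_add[OF Ints_add[OF _ b01(3)] b01(3)] b01(3)] xyz False by blast
  then have "n \<in> \<int>" by (simp add: n_def algebra_simps)
  then obtain m :: int where m: "n = of_int m" by (auto elim: Ints_cases)
  have "n \<noteq> 0"
  proof
    assume "n = 0"
    then have "b x + 1/2 = 0 \<and> b y + 1/2 = 0 \<and> b z + 1/2 = 0"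
      using b01(1) xyz False unfolding n_def by (smt (verit))
    then have "c3 x y z = 0"
      unfolding c3_def
      by (intro P_triple[OF _ _ _ weight_space_X_mem weight_space_X_mem weight_space_X_mem])
        (use b01(4) xyz False in auto)
    with c show False by simp
  qed
  moreover have "n \<noteq> 3"
  proof
    assume "n = 3"
    then have *: "b x + 1/2 = 1 \<and> b y + 1/2 = 1 \<and> b z + 1/2 = 1"
      using b01(2) xyz False unfolding n_def by (smt (verit))
    \<comment> \<open>Negative roots at x, y, z are positive roots at the dual vectors, so here it
      is the second factor of \<open>\<tau>3\<close> that vanishes.\<close>
    then have "c3 (d x) (d y) (d z) = 0"
      unfolding c3_def
      by (intro P_triple[OF _ _ _ weight_space_d_mem weight_space_d_mem weight_space_d_mem])
        (use b01(5) xyz False negative_root in blast)+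
    with c show False by simp
  qed
  moreover have "0 \<le> n" "n \<le> 3"
    using b01(1,2) xyz False unfolding n_def by (smt (verit))+
  ultimately have "m = 1 \<or> m = 2" using m by auto
  then have "b x + b y + b z = - 1/2 \<or> b x + b y + b z = 1/2" using m by (auto simp: n_def)
  moreover have "s\<^sup>2 = 1/4" if "s = - 1/2 \<or> s = 1/2" for s :: real
    using that by (elim disjE) (hypsubst, simp add: power2_eq_square)+
  ultimately have "(b x + b y + b z)\<^sup>2 = 1/4" by blast
  \<comment> \<open>The three constants 1/12 of \<open>B2_b\<close> add up to 1/4, so the squared
    sum is the claim rearranged.\<close>
  then show ?thesis using False xyz by (simp add: B2_b power2_eq_square algebra_simps)
qed

lemma sum3_symmetrize:
  fixes f :: "'a \<Rightarrow> 'a \<Rightarrow> complex"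
  shows "3 * (\<Sum>x\<in>X. \<Sum>y\<in>X. \<Sum>z\<in>X. f x y * \<tau>3 x y z)
    = (\<Sum>x\<in>X. \<Sum>y\<in>X. \<Sum>z\<in>X. (f x y + f y z + f z x) * \<tau>3 x y z)"
proof -
  let ?S = "\<Sum>x\<in>X. \<Sum>y\<in>X. \<Sum>z\<in>X. f x y * \<tau>3 x y z"
  have rot: "(\<Sum>x\<in>X. \<Sum>y\<in>X. \<Sum>z\<in>X. F y z x) = (\<Sum>x\<in>X. \<Sum>y\<in>X. \<Sum>z\<in>X. F x y z)"
    for F :: "'a \<Rightarrow> 'a \<Rightarrow> 'a \<Rightarrow> complex"
    by (rule sum_rotate)
  have "(\<Sum>x\<in>X. \<Sum>y\<in>X. \<Sum>z\<in>X. f y z * \<tau>3 x y z) = ?S"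
  proof -
    have "(\<Sum>x\<in>X. \<Sum>y\<in>X. \<Sum>z\<in>X. f y z * \<tau>3 x y z) = (\<Sum>x\<in>X. \<Sum>y\<in>X. \<Sum>z\<in>X. f y z * \<tau>3 y z x)"
      by (intro sum.cong refl arg_cong2[where f = "(*)"] \<tau>3_cycle)
    also have "\<dots> = ?S" by (rule rot)
    finally show ?thesis .
  qed
  moreover have "(\<Sum>x\<in>X. \<Sum>y\<in>X. \<Sum>z\<in>X. f z x * \<tau>3 x y z) = ?S"
  proof -
    have "?S = (\<Sum>x\<in>X. \<Sum>y\<in>X. \<Sum>z\<in>X. f x y * \<tau>3 y z x)"
      by (intro sum.cong refl arg_cong2[where f = "(*)"] \<tau>3_cycle)
    also have "\<dots> = (\<Sum>x\<in>X. \<Sum>y\<in>X. \<Sum>z\<in>X. f z x * \<tau>3 x y z)" by (rule rot)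
    finally show ?thesis by (rule sym)
  qed
  ultimately show ?thesis by (simp add: distrib_right sum.distrib)
qed

theorem norm_rho_sigma:
  "dual_norm_sq B h (rho_sigma \<sigma> u h P)
   = (\<Sum>c\<in>casimir_half_eigenvalues B u. c / 12 * of_nat (dim (casimir_eigenspace B u c))
      - 2 * c * complex_of_real (z_sigma \<sigma> (casimir_eigenspace B u c)))"
proof -
  have "(\<Sum>x\<in>X. complex_of_real (B2 x) * (2 * cc x))
      = (\<Sum>x\<in>X. \<Sum>y\<in>X. \<Sum>z\<in>X. complex_of_real (B2 x) * \<tau>3 x y z)"
    by (simp add: Cas_\<tau>3 sum_distrib_left)
  then have "3 * (\<Sum>x\<in>X. complex_of_real (B2 x) * (2 * cc x))
      = (\<Sum>x\<in>X. \<Sum>y\<in>X. \<Sum>z\<in>X. (complex_of_real (B2 x) + complex_of_real (B2 y) + complex_of_real (B2 z)) * \<tau>3 x y z)"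
    by (simp only: sum3_symmetrize)
  also have "\<dots> = (\<Sum>x\<in>X. \<Sum>y\<in>X. \<Sum>z\<in>X. - 2 * ((complex_of_real (b x * b y) + complex_of_real (b y * b z)
      + complex_of_real (b z * b x)) * \<tau>3 x y z))"
  proof (intro sum.cong refl)
    fix x y z assume xyz: "x \<in> X" "y \<in> X" "z \<in> X"
    show "(complex_of_real (B2 x) + complex_of_real (B2 y) + complex_of_real (B2 z)) * \<tau>3 x y z
      = - 2 * ((complex_of_real (b x * b y) + complex_of_real (b y * b z) + complex_of_real (b z * b x)) * \<tau>3 x y z)"
    proof (cases "\<tau>3 x y z = 0")
      case False
      have "complex_of_real (B2 x + B2 y + B2 z) = complex_of_real (- 2 * (b x * b y + b y * b z + b z * b x))"
        by (simp only: termwise[OF xyz False])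
      then show ?thesis by (simp only: of_real_add of_real_mult of_real_minus of_real_numeral mult.assoc)
    qed simp
  qed
  also have "\<dots> = - 2 * (3 * (\<Sum>x\<in>X. \<Sum>y\<in>X. \<Sum>z\<in>X. complex_of_real (b x * b y) * \<tau>3 x y z))"
    unfolding sum3_symmetrize[of "\<lambda>x y. complex_of_real (b x * b y)"] by (simp only: sum_distrib_left)
  \<comment> \<open>By \<open>norm_R_\<tau>3\<close> the triple sum is -2 times the norm, and it
    carries the factor -6; the 3 from symmetrizing the left side leaves 4.\<close>
  also have "\<dots> = 12 * B R R" by (simp add: norm_R_\<tau>3)
  finally have "B R R = 1/4 * (\<Sum>x\<in>X. complex_of_real (B2 x) * (2 * cc x))" by simp
  then show ?thesis unfolding casimir_sum_X dual_norm_sq_R B2_def by simp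
qed

end

section \<open>Positive roots of a subalgebra\<close>

context twisted_lie
begin

lemma dual_space_uminus: "\<alpha> \<in> dual_space h \<Longrightarrow> (\<lambda>t. - \<alpha> t) \<in> dual_space h"
  by (simp add: dual_space_def)

lemma d_nonzero: "x \<in> X \<Longrightarrow> d x \<noteq> 0"
  using B_d[of x x] by (auto simp: B_0)

lemma roots_uminus: "\<alpha> \<in> roots u\<^sub>0 h \<Longrightarrow> (\<lambda>t. - \<alpha> t) \<in> roots u\<^sub>0 h"
proof -
  assume \<alpha>: "\<alpha> \<in> roots u\<^sub>0 h"
  then obtain x where x: "x \<in> X" "jj x = 0" "lam x = \<alpha>" and nz: "\<alpha> \<noteq> (\<lambda>t. 0)" using roots_X by blast
  have "(\<lambda>t. - \<alpha> t) \<noteq> (\<lambda>t. 0)" using nz by (auto simp: fun_eq_iff)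
  then show ?thesis
    using weight_space_d_mem[OF x(1,2)] d_nonzero[OF x(1)] dual_space_uminus[OF lam_dual_space[OF x(1)]] x(3)
    unfolding roots_def weights_def by blast
qed

lemma weight_space_line:
  assumes \<alpha>: "\<alpha> \<in> roots u\<^sub>0 h" and w: "w \<in> weight_space u\<^sub>0 h \<alpha>" "w \<noteq> 0"
  shows "weight_space u\<^sub>0 h \<alpha> \<subseteq> span {w}"
proof -
  obtain x where x: "x \<in> X" "jj x = 0" "lam x = \<alpha>" and nz: "\<alpha> \<noteq> (\<lambda>t. 0)" using \<alpha> roots_X by blast
  have \<alpha>h: "\<alpha> t = 0" if "t \<notin> h" for t using lam_outside[OF that, of x] x(3) by simp
  have "v \<in> span {x}" if v: "v \<in> weight_space u\<^sub>0 h \<alpha>" for v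
  proof -
    have vu: "v \<in> u" "\<sigma> v = v" "\<And>t. t \<in> h \<Longrightarrow> t \<bullet> v = cscale (\<alpha> t) v"
      using v by (auto simp: weight_space_def u0_iff)
    have "y = x" if r: "representation X v y \<noteq> 0" for y
    proof -
      have y: "y \<in> X" "jj y = 0" using rep_X[OF r] rep_jj[OF vu(1) _ _ _ r, of 0] vu(2) by auto
      have "lam y t = \<alpha> t" for t
        using rep_lam[OF vu(1) _ vu(3) r, of t] \<alpha>h[of t] lam_outside[of t y] by (cases "t \<in> h") auto
      then have "lam y = lam x" using x(3) by auto
      then show ?thesis using root_space_unique[of y x] x y nz by simp
    qed
    then show ?thesis using span_representation_subset[OF independent_X, of v "{x}"] vu(1) span_X by blast
  qed
  then have *: "\<exists>k. v = cscale k x" if "v \<in> weight_space u\<^sub>0 h \<alpha>" for v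
    using that by (auto simp: span_singleton)
  then obtain k where k: "w = cscale k x" using w by blast
  then have "x = cscale (inverse k) w" using w(2) by auto
  then have "cscale r x \<in> span {w}" for r by (simp add: span_scale span_base)
  then show ?thesis using * by blast
qed

end

context positive_lie
begin

section \<open>The sum of the positive root spaces\<close>

definition N :: "'a set"
  where "N = sum_of_root_spaces u\<^sub>0 h P"

lemma subspace_N: "subspace N"
  by (simp add: N_def sum_of_root_spaces_def)

lemma weight_space_N: "\<alpha> \<in> P \<Longrightarrow> x \<in> weight_space u\<^sub>0 h \<alpha> \<Longrightarrow> x \<in> N"
  unfolding N_def sum_of_root_spaces_def by (rule span_base) blast

lemma N_induct [consumes 1, case_names zero step]:
  assumes "x \<in> N" and "Q 0"
    and "\<And>c \<alpha> x y. \<alpha> \<in> P \<Longrightarrow> x \<in> weight_space u\<^sub>0 h \<alpha> \<Longrightarrow> Q y \<Longrightarrow> Q (cscale c x + y)"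
  shows "Q x"
  using assms(1) unfolding N_def sum_of_root_spaces_def
proof (induction rule: span_induct_alt)
  case base
  show ?case by (rule assms(2))
next
  case (step c x y)
  then obtain \<alpha> where "\<alpha> \<in> P" "x \<in> weight_space u\<^sub>0 h \<alpha>" by blast
  then show ?case by (rule assms(3)[OF _ _ step(2)])
qed

lemma N_u0: "x \<in> N \<Longrightarrow> x \<in> u\<^sub>0"
proof (induction rule: N_induct)
  case (step c \<alpha> x y)
  then show ?case
    by (simp add: u0_iff weight_space_def subspace_add subspace_scale subspace_u
        lp.linear_add[OF endo_\<sigma>] lp.linear_scale[OF endo_\<sigma>])
qed (simp add: u0_iff zero_u lp.linear_0[OF endo_\<sigma>])

lemma N_h: assumes t: "t \<in> h" shows "x \<in> N \<Longrightarrow> t \<bullet> x \<in> N"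
proof (induction rule: N_induct)
  case (step c \<alpha> x y)
  then have "t \<bullet> x = cscale (\<alpha> t) x" using t by (auto simp: weight_space_def)
  then show ?case using step weight_space_N
    by (simp add: bracket_bilinear subspace_add subspace_scale subspace_N)
qed (simp add: subspace_0[OF subspace_N])

lemma P_outside: "\<alpha> \<in> P \<Longrightarrow> t \<notin> h \<Longrightarrow> \<alpha> t = 0"
  using P_roots by (auto simp: roots_def weights_def dual_space_def)

lemma weight_space_orth:
  assumes \<alpha>: "\<alpha> \<in> P" and \<beta>: "\<beta> \<in> P" and x: "x \<in> weight_space u\<^sub>0 h \<alpha>" and y: "y \<in> weight_space u\<^sub>0 h \<beta>"
  shows "B x y = 0"
proof (rule ccontr)
  assume nz: "B x y \<noteq> 0"
  have "\<beta> t = - \<alpha> t" for t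
  proof (cases "t \<in> h")
    case True
    then have "\<alpha> t * B x y = - (\<beta> t * B x y)"
      using B_skew[of t x y] x y by (simp add: weight_space_def B_scale)
    then have "(\<beta> t + \<alpha> t) * B x y = 0" by (simp add: distrib_right)
    then show ?thesis using nz by (simp add: eq_neg_iff_add_eq_0)
  next
    case False
    then show ?thesis using P_outside[OF \<alpha> False] P_outside[OF \<beta> False] by simp
  qed
  then have "\<beta> = (\<lambda>t. - \<alpha> t)" by auto
  then show False using P_sign[of \<alpha>] \<alpha> \<beta> P_roots by blast
qed

lemma N_orth: assumes x: "x \<in> N" and y: "y \<in> N" shows "B x y = 0"
  using x
proof (induction rule: N_induct)
  case (step c \<alpha> x x')
  have "B x y = 0"
    using y by (induction rule: N_induct) (simp_all add: B_0 B_bilinear weight_space_orth[OF step(1) _ step(2)])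
  with step show ?case by (simp add: B_bilinear)
qed (simp add: B_0)

lemma N_triple: assumes x: "x \<in> N" and y: "y \<in> N" and z: "z \<in> N" shows "B (x \<bullet> y) z = 0"
  using x
proof (induction rule: N_induct)
  case (step c \<alpha> x x')
  have "B (x \<bullet> y) z = 0"
    using y
  proof (induction rule: N_induct)
    case (step c' \<beta> y y')
    have "B (x \<bullet> y) z = 0"
      using z
      by (induction rule: N_induct)
        (simp_all add: B_0 B_bilinear P_triple[OF \<open>\<alpha> \<in> P\<close> \<open>\<beta> \<in> P\<close> _ \<open>x \<in> weight_space u\<^sub>0 h \<alpha>\<close>
            \<open>y \<in> weight_space u\<^sub>0 h \<beta>\<close>])
    with step show ?case by (simp add: bracket_bilinear B_bilinear)
  qed (simp add: B_0)
  with step show ?case by (simp add: bracket_bilinear B_bilinear)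
qed (simp add: B_0)

text \<open>A coordinate of v at a negative root is its pairing with a dual vector, which lies in N;
  orthogonality to N leaves only coordinates in h and N.\<close>

lemma N_perp:
  assumes v: "v \<in> u\<^sub>0" and perp: "\<And>y. y \<in> N \<Longrightarrow> B v y = 0"
  obtains s m where "s \<in> h" "m \<in> N" "v = s + m"
proof -
  have vu: "v \<in> u" "\<sigma> v = v" using v by (auto simp: u0_iff)
  have "x \<in> h \<union> N" if r: "representation X v x \<noteq> 0" for x
  proof -
    have x: "x \<in> X" "jj x = 0" using rep_X[OF r] rep_jj[OF vu(1) _ _ _ r, of 0] vu(2) by auto
    have "B v (d x) \<noteq> 0" using representation_dual[OF X(1) vu(1) x(1)] r by simp
    then have "(\<lambda>t. - lam x t) \<notin> P"
      using perp weight_space_N weight_space_d_mem[OF x] by blast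
    then show ?thesis using negative_root[OF x] weight_space_N weight_space_X_mem[OF x] by blast
  qed
  then have "v \<in> span (h \<union> N)"
    using span_representation_subset[OF independent_X] vu(1) span_X by blast
  then obtain s m where "s \<in> span h" "m \<in> span N" "v = s + m" by (auto simp: span_Un)
  then show ?thesis using that subspace_h subspace_N by (metis span_eq_iff)
qed

text \<open>The element t maps h + N into N, since h is abelian; an eigenvector with nonzero
  eigenvalue is a multiple of its image.\<close>

lemma weight_in_N:
  assumes "s \<in> h" "m \<in> N" "t \<in> h" and "t \<bullet> (s + m) = cscale c (s + m)" "c \<noteq> 0"
  shows "s + m \<in> N"
proof -
  have "cscale c (s + m) = t \<bullet> m"
    using assms abelian_h[of t s] by (simp add: bracket_bilinear)
  then have "cscale c (s + m) \<in> N" using N_h assms by simp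
  then have "cscale (inverse c) (cscale c (s + m)) \<in> N" using subspace_scale[OF subspace_N] by blast
  then show ?thesis using assms(5) by simp
qed

end

text \<open>The point is that exactly one of \<alpha> and -\<alpha> has its root space in n. Not
  both, since n is isotropic while a basis vector and its dual pair to 1. If -\<alpha> fails, a
  vector v of weight \<alpha> is orthogonal to the part of n in \<open>a\<close> by weights and to
  the rest by choice of n; so v lies in h + n, and its nonzero weight puts it into n.\<close>

lemma subalgebra_positive_lie:
  fixes B :: "'a::complex_lie_algebra \<Rightarrow> 'a \<Rightarrow> complex"
  assumes G: "positive_lie Basis B UNIV \<sigma> h P" and A: "twisted_lie Basis B a \<sigma> ha" and hh: "ha \<subseteq> h"
    and n: "n = sum_of_root_spaces (sigma_part \<sigma> UNIV 0) h P"
    and n_sum: "is_direct_sum n (n \<inter> a) (n \<inter> orth_complement B a)"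
    and bb: "is_direct_sum bb ha (n \<inter> a)"
  shows "positive_lie Basis B a \<sigma> ha (roots_in (sigma_part \<sigma> a 0) ha bb)"
proof -
  interpret G: positive_lie Basis B UNIV \<sigma> h P by fact
  interpret A: twisted_lie Basis B a \<sigma> ha by fact
  let ?a0 = "sigma_part \<sigma> a 0" and ?Q = "roots_in (sigma_part \<sigma> a 0) ha bb"
  have nN: "n = G.N" by (simp add: n G.N_def)
  have bb_iff: "v \<in> bb \<longleftrightarrow> (\<exists>s m. s \<in> ha \<and> m \<in> n \<and> m \<in> a \<and> v = s + m)" for v
    using bb by (auto simp: is_direct_sum_def)
  have root_t: "\<exists>t\<in>ha. \<alpha> t \<noteq> 0" if "\<alpha> \<in> roots ?a0 ha" for \<alpha>
    using that A.roots_X A.lam_outside by fastforce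
  \<comment> \<open>A root vector in \<open>bb\<close> has nonzero weight under some t in
    \<open>ha\<close>, so by \<open>weight_in_N\<close> it lies in n.\<close>
  have Q_iff: "\<alpha> \<in> ?Q \<longleftrightarrow> weight_space ?a0 ha \<alpha> \<subseteq> n" if \<alpha>: "\<alpha> \<in> roots ?a0 ha" for \<alpha>
  proof
    assume "\<alpha> \<in> ?Q"
    then have sub: "weight_space ?a0 ha \<alpha> \<subseteq> bb" by (simp add: roots_in_def)
    obtain t where t: "t \<in> ha" "\<alpha> t \<noteq> 0" using root_t[OF \<alpha>] by blast
    show "weight_space ?a0 ha \<alpha> \<subseteq> n"
    proof
      fix v assume v: "v \<in> weight_space ?a0 ha \<alpha>"
      then obtain s m where sm: "s \<in> ha" "m \<in> n" "v = s + m" using sub bb_iff by blast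
      have "t \<bullet> v = cscale (\<alpha> t) v" using v t by (auto simp: weight_space_def)
      then show "v \<in> n" using G.weight_in_N[of s m t "\<alpha> t"] sm t hh nN by auto
    qed
  next
    assume sub: "weight_space ?a0 ha \<alpha> \<subseteq> n"
    have "v \<in> bb" if "v \<in> weight_space ?a0 ha \<alpha>" for v
      using that sub bb_iff A.zero_h by (intro bb_iff[THEN iffD2] exI[of _ 0] exI[of _ v])
        (auto simp: weight_space_def sigma_part_def)
    then show "\<alpha> \<in> ?Q" using \<alpha> by (auto simp: roots_in_def)
  qed
  have Q_roots: "?Q \<subseteq> roots ?a0 ha" by (auto simp: roots_in_def)
  show ?thesis
  proof unfold_locales
    show "?Q \<subseteq> roots ?a0 ha" by (rule Q_roots)
  next
    fix \<alpha> \<beta> \<gamma> x y z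
    assume "\<alpha> \<in> ?Q" "\<beta> \<in> ?Q" "\<gamma> \<in> ?Q"
      "x \<in> weight_space ?a0 ha \<alpha>" "y \<in> weight_space ?a0 ha \<beta>" "z \<in> weight_space ?a0 ha \<gamma>"
    then have "x \<in> n" "y \<in> n" "z \<in> n" using Q_iff Q_roots by blast+
    then show "B (x \<bullet> y) z = 0" using G.N_triple nN by simp
  next
    fix \<alpha> assume \<alpha>: "\<alpha> \<in> roots ?a0 ha"
    let ?m = "\<lambda>t. - \<alpha> t"
    have m\<alpha>: "?m \<in> roots ?a0 ha" by (rule A.roots_uminus[OF \<alpha>])
    have "\<not> (\<alpha> \<in> ?Q \<and> ?m \<in> ?Q)"
    proof
      assume *: "\<alpha> \<in> ?Q \<and> ?m \<in> ?Q"
      obtain x where x: "x \<in> A.X" "A.jj x = 0" "A.lam x = \<alpha>" using \<alpha> A.roots_X by blast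
      have "x \<in> n" using x * Q_iff[OF \<alpha>] A.jj(3)[OF x(1)] A.X_u[OF x(1)] A.lam[OF x(1)]
        by (auto simp: weight_space_def A.u0_iff)
      moreover have "A.d x \<in> n" using x * Q_iff[OF m\<alpha>] A.weight_space_d_mem[OF x(1,2)] by auto
      ultimately have "B x (A.d x) = 0" using G.N_orth nN by simp
      then show False using A.B_d[OF x(1) x(1)] by simp
    qed
    moreover have "\<alpha> \<in> ?Q \<or> ?m \<in> ?Q"
    proof (rule ccontr)
      assume *: "\<not> (\<alpha> \<in> ?Q \<or> ?m \<in> ?Q)"
      have "v \<in> n" if v: "v \<in> weight_space ?a0 ha \<alpha>" for v
      proof -
        have va: "v \<in> a" "\<sigma> v = v" and vt: "\<And>t. t \<in> ha \<Longrightarrow> t \<bullet> v = cscale (\<alpha> t) v"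
          using v by (auto simp: weight_space_def A.u0_iff)
        let ?V = "n \<inter> a"
        have subV: "csubspace ?V" using nN G.subspace_N A.subspace_u cvs.subspace_inter by auto
        have stV: "t \<bullet> w \<in> ?V" if "t \<in> ha" "w \<in> ?V" for t w
          using that hh nN G.N_h[of t w] A.bracket_u[OF A.h_u, of t w] by auto
        \<comment> \<open>The part of n in \<open>a\<close> is spanned by weight vectors of
          \<open>ha\<close>, so orthogonality of v can be tested on these.\<close>
        have "?V \<subseteq> cspan {w \<in> ?V. \<forall>f\<in>lie_bracket ` ha. \<exists>c. f w = cscale c w}"
        proof (rule G.joint_diag[OF _ subV])
          fix f assume "f \<in> lie_bracket ` ha"
          then obtain t where t: "t \<in> ha" "f = lie_bracket t" by blast
          show "G.diag_on f ?V" unfolding t(2)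
            by (rule G.diag_on_subspace[OF G.endo_bracket A.diag_on_h[OF t(1)] subV]) (use stV[OF t(1)] in auto)
        next
          fix f f' w assume "f \<in> lie_bracket ` ha" "f' \<in> lie_bracket ` ha"
          then obtain t t' where t: "t \<in> ha" "f = lie_bracket t" "t' \<in> ha" "f' = lie_bracket t'" by blast
          show "f (f' w) = f' (f w)"
            using bracket_leibniz[of t t' w] t by (simp add: A.abelian_h)
        qed (use G.endo_bracket stV in auto)
        then have span: "?V \<subseteq> cspan {w \<in> ?V. \<forall>t\<in>ha. \<exists>c. t \<bullet> w = cscale c w}" by simp
        have Bw: "B v w = 0" if w: "w \<in> ?V" "\<forall>t\<in>ha. \<exists>c. t \<bullet> w = cscale c w" for w
        proof (rule ccontr)
          assume nz: "B v w \<noteq> 0"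
          then have w0: "w \<noteq> 0" by (auto simp: A.B_0)
          have "t \<bullet> w = cscale (- \<alpha> t) w" if t: "t \<in> ha" for t
          proof -
            obtain c where c: "t \<bullet> w = cscale c w" using w t by blast
            have "\<alpha> t * B v w = - (c * B v w)"
              using A.B_skew[of t v w] vt[OF t] c by (simp add: A.B_scale)
            then have "(c + \<alpha> t) * B v w = 0" by (simp add: distrib_right)
            then have "c = - \<alpha> t" using nz by (simp add: eq_neg_iff_add_eq_0)
            with c show ?thesis by simp
          qed
          moreover have "\<sigma> w = w" using w nN G.N_u0 by (simp add: G.u0_iff)
          ultimately have "w \<in> weight_space ?a0 ha ?m" using w by (simp add: weight_space_def A.u0_iff)
          \<comment> \<open>Root spaces are lines, so a single vector of weight -\<alpha> in n
            carries the whole root space into n, against the assumption.\<close>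
          then have "weight_space ?a0 ha ?m \<subseteq> cspan {w}" using A.weight_space_line[OF m\<alpha> _ w0] by blast
          also have "\<dots> \<subseteq> n" using w nN G.subspace_N by (intro cvs.span_minimal) auto
          finally show False using * Q_iff[OF m\<alpha>] by blast
        qed
        have BV: "B v w = 0" if "w \<in> ?V" for w
        proof -
          have "w \<in> cspan {w \<in> ?V. \<forall>t\<in>ha. \<exists>c. t \<bullet> w = cscale c w}" using span that by blast
          then show ?thesis
            by (induction rule: cvs.span_induct_alt) (auto simp: A.B_0 A.B_bilinear Bw)
        qed
        have perp: "B v y = 0" if y: "y \<in> G.N" for y
        proof -
          obtain y1 y2 where y12: "y1 \<in> ?V" "y2 \<in> orth_complement B a" "y = y1 + y2"
          proof -
            have "n = {x + y | x y. x \<in> ?V \<and> y \<in> n \<inter> orth_complement B a}"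
              using n_sum by (simp only: is_direct_sum_def)
            moreover have "y \<in> n" using y by (simp only: nN)
            ultimately have "y \<in> {x + y | x y. x \<in> ?V \<and> y \<in> n \<inter> orth_complement B a}" by (rule subst)
            then show ?thesis using that by blast
          qed
          have "B v y2 = 0" using y12(2) va A.B_sym[of v y2] by (simp add: orth_complement_def)
          then show ?thesis using BV[OF y12(1)] y12(3) by (simp add: A.B_add)
        qed
        have "v \<in> sigma_part \<sigma> UNIV 0" using va by (simp add: G.u0_iff)
        then obtain s m where sm: "s \<in> h" "m \<in> G.N" "v = s + m" using G.N_perp[OF _ perp] by blast
        obtain t where t: "t \<in> ha" "\<alpha> t \<noteq> 0" using root_t[OF \<alpha>] by blast
        show "v \<in> n" using G.weight_in_N[OF sm(1,2), of t "\<alpha> t"] vt[OF t(1)] t hh sm(3) nN by auto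
      qed
      then show False using * Q_iff[OF \<alpha>] by blast
    qed
    ultimately show "(\<alpha> \<in> ?Q) \<noteq> (?m \<in> ?Q)" by blast
  qed
qed

section \<open>Verification of the hypotheses and conclusion\<close>

lemma solvable_ideal_radical: "lie_ideal u i \<Longrightarrow> solvable i \<Longrightarrow> i \<subseteq> radical u"
  unfolding radical_def by (rule order_trans[OF _ cvs.span_superset]) blast

text \<open>An invariant complement of the span of all eigenvectors contains no eigenvector, so it
  is zero.\<close>

lemma (in fd_lie) semisimple_operator_diag:
  assumes \<sigma>: "endo \<sigma>" and ss: "semisimple_operator \<sigma>"
  shows "diag_on \<sigma> UNIV"
proof -
  let ?E = "{v. \<exists>c. \<sigma> v = cscale c v}"
  have "\<sigma> v \<in> span ?E" if "v \<in> span ?E" for v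
    using that
  proof (induction rule: span_induct_alt)
    case (step c x y)
    then obtain e where "\<sigma> x = cscale e x" by blast
    then have "\<sigma> (cscale c x) \<in> span ?E" using step(1) by (simp add: lp.linear_scale[OF \<sigma>] span_scale span_base)
    with step show ?case by (simp add: lp.linear_add[OF \<sigma>] span_add)
  qed (simp add: lp.linear_0[OF \<sigma>] span_zero)
  then have "\<sigma> ` span ?E \<subseteq> span ?E" by (rule image_subsetI)
  with ss[unfolded semisimple_operator_def, THEN spec, of "span ?E"]
  have "\<exists>w. \<sigma> ` w \<subseteq> w \<and> is_direct_sum UNIV (span ?E) w" by (simp only: subspace_span simp_thms)
  then obtain w where w: "\<sigma> ` w \<subseteq> w" "is_direct_sum UNIV (span ?E) w" by (elim exE conjE)
  have sub: "subspace w" and int: "span ?E \<inter> w = {0}" and sum: "UNIV = {x + y | x y. x \<in> span ?E \<and> y \<in> w}"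
    using w(2) by (simp_all only: is_direct_sum_def)
  have "w \<subseteq> {0}"
  proof (rule ccontr)
    assume "\<not> w \<subseteq> {0}"
    then obtain v where v: "v \<in> w" "v \<notin> {0}" by blast
    obtain x z where x: "x \<in> w" "x \<notin> {0}" "shift \<sigma> z x \<in> {0}"
      using eigenvector_modulo[OF \<sigma> sub _ subspace_single_0 v] w(1) by blast
    then have "\<sigma> x = cscale z x" by (simp add: shift_def)
    then have "x \<in> span ?E" by (intro span_base) blast
    with x int show False by blast
  qed
  then have "v \<in> span ?E" for v
  proof -
    obtain x y where "v = x + y" "x \<in> span ?E" "y \<in> w" using sum by blast
    then show ?thesis using \<open>w \<subseteq> {0}\<close> by auto
  qed
  then show ?thesis by (simp add: diag_on_def subset_iff)
qed

text \<open>A nonzero value of B on three positive root vectors forces the roots to sum to zero.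
  Then -\<gamma> is a root that is a sum of two positive roots, hence positive, although \<gamma>
  is.\<close>

lemma positive_roots_positive_lie:
  fixes B :: "'a::complex_lie_algebra \<Rightarrow> 'a \<Rightarrow> complex"
  assumes "twisted_lie Basis B u \<sigma> h" and P: "positive_roots (sigma_part \<sigma> u 0) h P"
  shows "positive_lie Basis B u \<sigma> h P"
proof -
  interpret twisted_lie Basis B u \<sigma> h by fact
  have sub: "P \<subseteq> roots u\<^sub>0 h" and sign: "\<And>\<alpha>. \<alpha> \<in> roots u\<^sub>0 h \<Longrightarrow> (\<alpha> \<in> P) \<noteq> ((\<lambda>t. - \<alpha> t) \<in> P)"
    and add: "\<And>\<alpha> \<beta>. \<alpha> \<in> P \<Longrightarrow> \<beta> \<in> P \<Longrightarrow> (\<lambda>t. \<alpha> t + \<beta> t) \<in> roots u\<^sub>0 h \<Longrightarrow> (\<lambda>t. \<alpha> t + \<beta> t) \<in> P"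
    using P unfolding positive_roots_def by blast+
  show ?thesis
  proof unfold_locales
    fix \<alpha> \<beta> \<gamma> x y z
    assume abc: "\<alpha> \<in> P" "\<beta> \<in> P" "\<gamma> \<in> P"
      and x: "x \<in> weight_space u\<^sub>0 h \<alpha>" and y: "y \<in> weight_space u\<^sub>0 h \<beta>" and z: "z \<in> weight_space u\<^sub>0 h \<gamma>"
    show "B (x \<bullet> y) z = 0"
    proof (rule ccontr)
      assume nz: "B (x \<bullet> y) z \<noteq> 0"
      have out: "\<delta> t = 0" if "\<delta> \<in> P" "t \<notin> h" for \<delta> t
        using that sub by (auto simp: roots_def weights_def dual_space_def)
      have w: "t \<bullet> (x \<bullet> y) = cscale (\<alpha> t + \<beta> t) (x \<bullet> y)" if "t \<in> h" for t
        using bracket_weight[of t x "\<alpha> t" y "\<beta> t"] that x y by (simp add: weight_space_def)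
      have "\<alpha> t + \<beta> t = - \<gamma> t" for t
      proof (cases "t \<in> h")
        case True
        have "(\<alpha> t + \<beta> t) * B (x \<bullet> y) z = - (\<gamma> t * B (x \<bullet> y) z)"
          using B_skew[of t "x \<bullet> y" z] w[OF True] z True by (simp add: weight_space_def B_scale)
        then have "(\<alpha> t + \<beta> t + \<gamma> t) * B (x \<bullet> y) z = 0" by (simp add: distrib_right)
        then show ?thesis using nz by (simp add: eq_neg_iff_add_eq_0)
      next
        case False
        then show ?thesis using out[OF abc(1) False] out[OF abc(2) False] out[OF abc(3) False] by simp
      qed
      then have eq: "(\<lambda>t. \<alpha> t + \<beta> t) = (\<lambda>t. - \<gamma> t)" by auto
      have "(\<lambda>t. - \<gamma> t) \<in> roots u\<^sub>0 h" using roots_uminus abc(3) sub by blast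
      then have "(\<lambda>t. - \<gamma> t) \<in> P" using add[OF abc(1,2)] eq by simp
      then show False using sign[of \<gamma>] abc(3) sub by blast
    qed
  qed (use sub sign in auto)
qed

theorem corollary4p4:
  fixes B :: "'a::complex_lie_algebra \<Rightarrow> 'a \<Rightarrow> complex"
    and g :: real
    and \<sigma> :: "'a \<Rightarrow> 'a"
    and \<aa> \<hh>\<aa> \<hh>0 \<nn> \<bb> :: "'a set"
    and \<Delta>0 \<Delta>\<aa> :: "('a \<Rightarrow> complex) set"
  assumes "\<exists>X :: 'a set. finite X \<and> cspan X = UNIV"
    and "semisimple (UNIV :: 'a set) \<or> abelian (UNIV :: 'a set)"
    and "symmetric_bilinear B" and "invariant_form B" and "nondegenerate_on B UNIV"
    and "g \<ge> 0" and "\<forall>x. casimir B UNIV x = cscale (complex_of_real (2 * g)) x"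
    and "lie_automorphism \<sigma>" and "semisimple_operator \<sigma>"
    and "\<forall>c x. x \<noteq> 0 \<and> \<sigma> x = cscale c x \<longrightarrow> cmod c = 1"
    and "\<forall>x y. B (\<sigma> x) (\<sigma> y) = B x y"
    and "subalgebra \<aa>" and "reductive \<aa>" and "\<sigma> ` \<aa> \<subseteq> \<aa>" and "nondegenerate_on B \<aa>"
    and "cartan_subalgebra (sigma_part \<sigma> \<aa> 0) \<hh>\<aa>"
    and "cartan_subalgebra (sigma_part \<sigma> UNIV 0) \<hh>0"
    and "\<hh>\<aa> \<subseteq> \<hh>0"
    and "positive_roots (sigma_part \<sigma> UNIV 0) \<hh>0 \<Delta>0"
    and "\<nn> = sum_of_root_spaces (sigma_part \<sigma> UNIV 0) \<hh>0 \<Delta>0"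
    and "is_direct_sum \<nn> (\<nn> \<inter> \<aa>) (\<nn> \<inter> orth_complement B \<aa>)"
    and "is_direct_sum \<bb> \<hh>\<aa> (\<nn> \<inter> \<aa>)"
    and "borel_subalgebra (sigma_part \<sigma> \<aa> 0) \<bb>"
    and "\<Delta>\<aa> = roots_in (sigma_part \<sigma> \<aa> 0) \<hh>\<aa> \<bb>"
  shows "dual_norm_sq B \<hh>0 (rho_sigma \<sigma> UNIV \<hh>0 \<Delta>0)
           - dual_norm_sq B \<hh>\<aa> (rho_sigma \<sigma> \<aa> \<hh>\<aa> \<Delta>\<aa>)
         = complex_of_real (g / 12 * real (cdim (UNIV :: 'a set))
                              - 2 * g * z_sigma \<sigma> (UNIV :: 'a set))
           - (\<Sum>c\<in>casimir_half_eigenvalues B \<aa>.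
                c / 12 * of_nat (cdim (casimir_eigenspace B \<aa> c))
                  - 2 * c * complex_of_real (z_sigma \<sigma> (casimir_eigenspace B \<aa> c)))"
proof -
  obtain S :: "'a set" where S: "finite S" "cspan S = UNIV" using assms(1) by blast
  obtain Basis where Basis: "Basis \<subseteq> S" "\<not> cvs.dependent Basis" "S \<subseteq> cspan Basis"
    using cvs.maximal_independent_subset[of S] by blast
  have "cspan Basis = UNIV" using cvs.span_minimal[OF Basis(3) cvs.subspace_span] S(2) by blast
  then interpret fd_lie Basis
    using Basis S finite_subset by unfold_locales auto
  have aut: "endo \<sigma>" "\<And>x y. \<sigma> (x \<bullet> y) = \<sigma> x \<bullet> \<sigma> y"
    using assms(8) by (auto simp: lie_automorphism_def)
  have diag: "diag_on \<sigma> UNIV" by (rule semisimple_operator_diag[OF aut(1) assms(9)])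
  have sub_a: "csubspace \<aa>" using assms(12) by (simp add: subalgebra_def)
  have central: "i \<subseteq> center (UNIV :: 'a set)" if "lie_ideal UNIV i" "solvable i" for i :: "'a set"
    using assms(2)
  proof
    assume "semisimple (UNIV :: 'a set)"
    then have "i \<subseteq> {0}" using solvable_ideal_radical[OF that] by (simp add: semisimple_def)
    then show ?thesis by (auto simp: center_def)
  qed (auto simp: abelian_def center_def)
  have tG: "twisted_lie Basis B UNIV \<sigma> \<hh>0"
  proof unfold_locales
    show "diag_on \<sigma> UNIV" by (rule diag)
  qed (use assms(3,4,5,10,11,17) aut lp.linear_add[OF aut(1)] lp.linear_scale[OF aut(1)] central in
      \<open>auto simp: subalgebra_def\<close>)
  have tA: "twisted_lie Basis B \<aa> \<sigma> \<hh>\<aa>"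
  proof unfold_locales
    show "diag_on \<sigma> \<aa>" by (rule diag_on_subspace[OF aut(1) diag sub_a]) (use assms(14) in auto)
    show "i \<subseteq> center \<aa>" if "lie_ideal \<aa> i" "solvable i" for i
      using solvable_ideal_radical[OF that] assms(13) by (simp add: reductive_def)
  qed (use assms(3,4,10,11,12,14,15,16) aut lp.linear_add[OF aut(1)] lp.linear_scale[OF aut(1)] in auto)
  have pG: "positive_lie Basis B UNIV \<sigma> \<hh>0 \<Delta>0"
    by (rule positive_roots_positive_lie[OF tG assms(19)])
  interpret G: positive_lie Basis B UNIV \<sigma> \<hh>0 \<Delta>0 by (rule pG)
  interpret A: positive_lie Basis B \<aa> \<sigma> \<hh>\<aa> \<Delta>\<aa>
    unfolding assms(24) by (rule subalgebra_positive_lie[OF pG tA assms(18,20,21,22)])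
  \<comment> \<open>The Casimir operator of the whole algebra is a scalar, so its general formula
    has at most one summand, at half of 2g.\<close>
  have eig: "casimir_eigenspace B UNIV c = (if c = complex_of_real g then UNIV else {0})" for c
    using assms(7) by (auto simp: casimir_eigenspace_def)
  have "(\<Sum>c\<in>casimir_half_eigenvalues B UNIV. c / 12 * of_nat (cdim (casimir_eigenspace B UNIV c))
          - 2 * c * complex_of_real (z_sigma \<sigma> (casimir_eigenspace B UNIV c)))
      = complex_of_real (g / 12 * real (cdim (UNIV :: 'a set)) - 2 * g * z_sigma \<sigma> (UNIV :: 'a set))"
  \<comment> \<open>In the zero algebra the eigenspace for g is zero and does not count, so the sum
    is empty; the right side vanishes as well.\<close>
  proof (cases "(UNIV :: 'a set) = {0}")
    case True
    then have "casimir_half_eigenvalues B UNIV = {}" by (simp add: casimir_half_eigenvalues_def eig)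
    moreover have "sigma_part \<sigma> (UNIV :: 'a set) j = {0}" for j
    proof
      show "sigma_part \<sigma> UNIV j \<subseteq> {0}" using True by blast
      show "{0} \<subseteq> sigma_part \<sigma> UNIV j" by (simp add: sigma_part_def lp.linear_0[OF aut(1)])
    qed
    moreover have "cdim (UNIV :: 'a set) = 0" using True by (simp only: dim_eq_0)
    ultimately show ?thesis by (simp add: z_sigma_def)
  next
    case False
    then have "casimir_half_eigenvalues B UNIV = {complex_of_real g}"
      by (auto simp: casimir_half_eigenvalues_def eig)
    then show ?thesis by (simp add: eig)
  qed
  then show ?thesis using G.norm_rho_sigma A.norm_rho_sigma by simp
qed

end
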